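(* Let $2\le k<n$ and write $H^*=H^*(\Delta_{k,n};S_n)$. Then $H^*[1]$ is equal to the permutation character of the action of $S_n$ on the set of hypersimplicial $(k,n)$-DOSPs. Moreover, let $\sigma\in S_n$ be a permutation with $r$ disjoint cycles (fixed points counted as cycles), and for each $i\in[n]$ let $\lambda_i$ be the number of cycles of $\sigma$ of length $i$. Then the number of hypersimplicial $(k,n)$-DOSPs fixed by $\sigma$ is $$H^*[1](\sigma)=g\sum_{h=0}^{k-1}\left(\sum_{I\in\mathcal I_h}(-1)^{|I|}\binom{\lambda_1}{I_1}\cdots\binom{\lambda_{k-1}}{I_{k-1}}\right)(k-h)^{r-1},$$ where $g=\gcd(\{k\}\cup\{i\in[n]:\lambda_i\ge1\})$.
   Context: Notation: $[n]=\{1,\dots,n\}$. The hypersimplex is $\Delta_{k,n}=\{x\in\mathbb R^n: 0\le x_i\le 1 \text{ for all } i,\ x_1+\dots+x_n=k\}$; $S_n$ acts on $\mathbb R^n$ by permuting coordinates and leaves $\Delta_{k,n}$ invariant. Equivariant $H^*$-series: for $d\ge 1$ let $\chi_d$ be the character of the permutation representation of $S_n$ on $d\Delta_{k,n}\cap\mathbb Z^n$, so $\chi_d(\sigma)=|\{x\in d\Delta_{k,n}\cap\mathbb Z^n:\sigma(x)=x\}|$; let $\chi_0$ be the trivial character. Let $\rho(\sigma)$ be the $n\times n$ permutation matrix of $\sigma$. Then $H^*[t]=H^*(\Delta_{k,n};S_n)[t]=\sum_{m\ge0}H^*_mt^m$ is the power series with coefficients in the representation ring of $S_n$ (over $\mathbb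 C$, virtual representations identified with characters) defined by $\sum_{d\ge0}\chi_d(\sigma)t^d=\bigl(\sum_{m\ge0}H^*_m(\sigma)t^m\bigr)/\det(I_n-t\rho(\sigma))$ for all $\sigma\in S_n$. It is known to be a polynomial in $t$, and $H^*[1]=\sum_mH^*_m$ is its value at $t=1$. For $h\ge0$, $\mathcal I_h=\{I=(I_1,\dots,I_{k-1})\in\mathbb Z_{\ge0}^{k-1}:\sum_{i=1}^{k-1}i\,I_i=h\}$ and $|I|=I_1+\dots+I_{k-1}$. A $(k,n)$-DOSP (decorated ordered set partition) is a sequence of pairs $D=((L_1,\ell_1),\dots,(L_p,\ell_p))$, where $(L_1,\dots,L_p)$ is an ordered partition of $[n]$ into non-empty sets and $\ell_1,\dots,\ell_p$ are positive integers with $\ell_1+\dots+\ell_p=k$, considered up to cyclic permutation of the pairs. It is hypersimplicial if $|L_i|>\ell_i$ for every $i$. The group $S_n$ acts on DOSPs by $\sigma((L_1,\ell_1),\dots,(L_p,\ell_p))=((\sigma(L_1),\ell_1),\dots,(\sigma(L_p),\ell_p))$, preserving the hypersimplicial ones. The permutation character of an action on a finite set sends $\sigma$ to the number of elements fixed by $\sigma$. *)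

theory Defs
  imports
    "HOL-Analysis.Analysis"
    "HOL-Combinatorics.Combinatorics"
    "HOL-Computational_Algebra.Formal_Power_Series"
begin

text \<open>
  The index set \<open>[n]\<close> is a finite type \<open>'n\<close> with \<open>n = CARD('n)\<close>, and \<open>S\<^sub>n\<close> is the set of all \<open>\<sigma>\<close> with
  \<open>\<sigma> permutes UNIV\<close>.  Elements of the representation ring of \<open>S\<^sub>n\<close> over the complex numbers are
  identified with their characters, i.e. with functions \<open>('n \<Rightarrow> 'n) \<Rightarrow> complex\<close>, of which only the
  values at elements of \<open>S\<^sub>n\<close> are meaningful.
\<close>

definition perm_character :: "('g \<Rightarrow> 'x \<Rightarrow> 'x) \<Rightarrow> 'x set \<Rightarrow> 'g \<Rightarrow> complex" where
  "perm_character act X \<sigma> = of_nat (card {x \<in> X. act \<sigma> x = x})"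

section \<open>The equivariant \<open>H\<^sup>*\<close>-series of the hypersimplex\<close>

definition hypersimplex :: "nat \<Rightarrow> (real ^ 'n) set" where
  "hypersimplex k = {x. (\<forall>i. 0 \<le> x $ i \<and> x $ i \<le> 1) \<and> (\<Sum>i\<in>UNIV. x $ i) = real k}"

definition dilate_lattice_points :: "nat \<Rightarrow> nat \<Rightarrow> (real ^ 'n) set" where
  "dilate_lattice_points k d = {x \<in> (*\<^sub>R) (real d) ` hypersimplex k. \<forall>i. x $ i \<in> \<int>}"

definition perm_coords :: "('n \<Rightarrow> 'n) \<Rightarrow> real ^ 'n \<Rightarrow> real ^ 'n" where
  "perm_coords \<sigma> x = (\<chi> i. x $ inv \<sigma> i)"

definition ehrhart_character :: "nat \<Rightarrow> nat \<Rightarrow> ('n :: finite \<Rightarrow> 'n) \<Rightarrow> complex" where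
  "ehrhart_character k d \<sigma> =
     (if d = 0 then 1 else perm_character perm_coords (dilate_lattice_points k d) \<sigma>)"

definition perm_matrix :: "('n \<Rightarrow> 'n) \<Rightarrow> 'a :: zero_neq_one ^ 'n ^ 'n" where
  "perm_matrix \<sigma> = (\<chi> i j. if i = \<sigma> j then 1 else 0)"

definition det_I_minus_t :: "('n :: finite \<Rightarrow> 'n) \<Rightarrow> complex fps" where
  "det_I_minus_t \<sigma> = det (\<chi> i j. mat 1 $ i $ j - fps_X * perm_matrix \<sigma> $ i $ j)"

text \<open>
  The generating function of the characters is \<open>H\<^sup>*[t](\<sigma>) / det (I - t \<rho>(\<sigma>))\<close>; as the denominator is
  a unit, this determines \<open>H\<^sup>*[t](\<sigma>)\<close> as the product below (see \<open>Hstar_series_unique\<close>).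
\<close>

definition Hstar_series :: "nat \<Rightarrow> ('n :: finite \<Rightarrow> 'n) \<Rightarrow> complex fps" where
  "Hstar_series k \<sigma> = Abs_fps (\<lambda>d. ehrhart_character k d \<sigma>) * det_I_minus_t \<sigma>"

definition Hstar :: "nat \<Rightarrow> nat \<Rightarrow> ('n :: finite \<Rightarrow> 'n) \<Rightarrow> complex" where
  "Hstar k m \<sigma> = fps_nth (Hstar_series k \<sigma>) m"

text \<open>
  The value at \<open>t = 1\<close> is the sum over all \<open>m\<close> for which the character \<open>Hstar k m\<close> is non-zero on
  \<open>S\<^sub>n\<close>.  Since \<open>H\<^sup>*[t]\<close> is a polynomial there are only finitely many such \<open>m\<close>; this is not assumed.
  (If it failed, the sum would be \<open>0\<close> by convention.)
\<close>

definition Hstar_at_1 :: "nat \<Rightarrow> ('n :: finite \<Rightarrow> 'n) \<Rightarrow> complex" where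
  "Hstar_at_1 k \<sigma> =
     (\<Sum>m | \<exists>\<tau> :: 'n \<Rightarrow> 'n. \<tau> permutes UNIV \<and> Hstar k m \<tau> \<noteq> 0. Hstar k m \<sigma>)"

lemma perm_matrix_mult_vec:
  assumes "\<sigma> permutes (UNIV :: 'n :: finite set)"
  shows "perm_matrix \<sigma> *v x = perm_coords \<sigma> x"
proof -
  have "(\<Sum>j\<in>UNIV. (if i = \<sigma> j then 1 else 0) * x $ j) = x $ inv \<sigma> i" for i
  proof -
    have "i = \<sigma> j \<longleftrightarrow> j = inv \<sigma> i" for j
      using permutes_inverses[OF assms] by metis
    then show ?thesis by (simp add: of_bool_def [symmetric])
  qed
  then show ?thesis
    by (simp add: vec_eq_iff perm_coords_def perm_matrix_def matrix_vector_mult_def)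
qed

lemma fps_nth_0_det_I_minus_t: "fps_nth (det_I_minus_t \<sigma>) 0 = 1"
proof -
  have *: "fps_nth (prod f A) 0 = (\<Prod>i\<in>A. fps_nth (f i) 0)" for f :: "'a \<Rightarrow> complex fps" and A
    by (induction A rule: infinite_finite_induct) auto
  have **: "fps_nth (of_int z :: complex fps) 0 = of_int z" for z
    by (simp add: fps_of_int [symmetric])
  have ***: "fps_nth (mat 1 $ i $ j - fps_X * (perm_matrix \<sigma> :: complex fps ^ _ ^ _) $ i $ j) 0 = mat 1 $ i $ j"
    for i j
    by (simp add: mat_def)
  have "fps_nth (det_I_minus_t \<sigma>) 0 = det (mat 1 :: complex ^ 'a ^ 'a)"
    unfolding det_I_minus_t_def det_def by (simp add: fps_sum_nth * ** *** del: fps_sub_nth)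
  then show ?thesis by simp
qed

lemma Hstar_series_unique:
  "Abs_fps (\<lambda>d. ehrhart_character k d \<sigma>) = H / det_I_minus_t \<sigma> \<longleftrightarrow> H = Hstar_series k \<sigma>"
proof -
  have nz: "det_I_minus_t \<sigma> \<noteq> 0"
    using fps_nth_0_det_I_minus_t[of \<sigma>] by auto
  have unit: "det_I_minus_t \<sigma> dvd H"
    using fps_nth_0_det_I_minus_t[of \<sigma>]
    by (metis fps_is_unit_iff one_neq_zero unit_imp_dvd)
  show ?thesis
    using nz unit by (auto simp: Hstar_series_def)
qed

section \<open>Decorated ordered set partitions\<close>

definition decorated_lists :: "nat \<Rightarrow> ('n set \<times> nat) list set" where
  "decorated_lists k = {ds. distinct (map fst ds) \<and> partition_on UNIV (set (map fst ds)) \<and>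
     (\<forall>l \<in> set (map snd ds). 0 < l) \<and> sum_list (map snd ds) = k}"

definition cyclic_shift_rel :: "'a list set \<Rightarrow> 'a list rel" where
  "cyclic_shift_rel A = {(xs, ys). xs \<in> A \<and> ys \<in> A \<and> (\<exists>m. ys = rotate m xs)}"

lemma equiv_cyclic_shift_rel: "equiv A (cyclic_shift_rel A)"
proof (rule equivI)
  show "refl_on A (cyclic_shift_rel A)"
    by (auto simp: refl_on_def cyclic_shift_rel_def intro: exI[of _ 0])
  show "sym (cyclic_shift_rel A)"
  proof (rule symI)
    fix xs ys assume a: "(xs, ys) \<in> cyclic_shift_rel A"
    then obtain m where m: "ys = rotate m xs" by (auto simp: cyclic_shift_rel_def)
    have "rotate (length xs - m mod length xs) ys = xs"
    proof (cases "xs = []")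
      case False
      then have "length xs - m mod length xs + m mod length xs = length xs"
        by (simp add: less_imp_le)
      then show ?thesis unfolding m
        by (subst rotate_conv_mod[of m]) (simp add: rotate_rotate)
    qed (simp add: m)
    then show "(ys, xs) \<in> cyclic_shift_rel A"
      using a by (auto simp: cyclic_shift_rel_def) metis
  qed
  show "trans (cyclic_shift_rel A)"
    by (auto simp: trans_def cyclic_shift_rel_def rotate_rotate)
qed (auto simp: cyclic_shift_rel_def)

definition DOSPs :: "nat \<Rightarrow> ('n set \<times> nat) list set set" where
  "DOSPs k = decorated_lists k // cyclic_shift_rel (decorated_lists k)"

definition hypersimplicial :: "('n set \<times> nat) list set \<Rightarrow> bool" where
  "hypersimplicial D \<longleftrightarrow> (\<forall>ds \<in> D. \<forall>(L, l) \<in> set ds. l < card L)"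

definition hypersimplicial_DOSPs :: "nat \<Rightarrow> ('n set \<times> nat) list set set" where
  "hypersimplicial_DOSPs k = {D \<in> DOSPs k. hypersimplicial D}"

definition act_DOSP :: "('n \<Rightarrow> 'n) \<Rightarrow> ('n set \<times> nat) list set \<Rightarrow> ('n set \<times> nat) list set" where
  "act_DOSP \<sigma> D = map (\<lambda>(L, l). (\<sigma> ` L, l)) ` D"

section \<open>Cycle type and index sets\<close>

text \<open>For a permutation of a finite type, \<open>orbit \<sigma> x\<close> is the cycle containing \<open>x\<close>.\<close>

definition cycles_of :: "('n \<Rightarrow> 'n) \<Rightarrow> 'n set set" where
  "cycles_of \<sigma> = range (orbit \<sigma>)"

definition cycle_count :: "('n \<Rightarrow> 'n) \<Rightarrow> nat \<Rightarrow> nat" where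
  "cycle_count \<sigma> i = card {C \<in> cycles_of \<sigma>. card C = i}"

definition weighted_tuples :: "nat \<Rightarrow> nat \<Rightarrow> (nat \<Rightarrow> nat) set" where
  "weighted_tuples k h = {I \<in> {1..k - 1} \<rightarrow>\<^sub>E UNIV. (\<Sum>i = 1..k - 1. i * I i) = h}"

end

theory Submission
  imports Defs "HOL-Number_Theory.Totient" "HOL-Computational_Algebra.Formal_Laurent_Series"
begin

text \<open>
  Fix \<open>\<sigma>\<close> with \<open>r\<close> cycles, let \<open>c(C)\<close> be the size of a cycle \<open>C\<close> and \<open>c(S)\<close> the sum of the sizes of the
  cycles in a set \<open>S\<close> of cycles, and let \<open>g\<close> be the greatest common divisor of \<open>k\<close> and all cycle sizes.
  Both characters are computed separately, and each turns out to be \<open>g\<close> times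
  the sum of \<open>(-1)^\<bar>S\<bar> (k - c(S))^(r-1)\<close> over all \<open>S\<close> with \<open>c(S) < k\<close> (\<open>signed_subset_sum\<close>).  Sorting
  the sets \<open>S\<close> by their number of cycles of each length turns this into the sum over tuples
  (\<open>signed_subset_sum_eq_weighted_tuples\<close>).

  The series (\<open>Hstar_at_1_eq\<close>).  A fixed lattice point of the \<open>d\<close>-th dilate is a function on the
  cycles with values in \<open>{0..d}\<close> and weighted sum \<open>kd\<close>.  With \<open>P(x) = \<Prod> 1 / (1 - x^c(C))\<close>, the number
  of these is the coefficient of \<open>x^(kd)\<close> in \<open>P(x) \<Prod> (1 - x^((d+1) c(C)))\<close>, which is the sum over
  \<open>S\<close> of \<open>(-1)^\<bar>S\<bar>\<close> times the coefficient of \<open>x^(md - c(S))\<close> in \<open>P\<close>, where \<open>m = k - c(S)\<close>.  The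
  determinant is \<open>\<Prod> (1 - t^c(C))\<close>.  Multiplying it with the \<open>m\<close>-section of \<open>P\<close> leaves a section of the
  polynomial \<open>Q(x) = \<Prod> (1 + x^c(C) + \<dots> + x^((m-1) c(C)))\<close>, because \<open>P(x) = Q(x) / \<Prod> (1 - x^(m c(C)))\<close>
  and the denominator only involves powers of \<open>x^m\<close> (\<open>weight_gf_times_section\<close>).  In particular the
  series is a polynomial, and at \<open>t = 1\<close> the summand of \<open>S\<close> counts the solutions modulo \<open>m\<close> of a linear
  congruence with coefficients \<open>c(C)\<close>, of which there are \<open>g m^(r-1)\<close> (\<open>card_box_cong\<close>).

  The partitions (\<open>card_fixed_DOSPs\<close>).  Fix a point \<open>x0\<close>.  Every DOSP is represented by exactly one list
  whose first block contains \<open>x0\<close>, and \<open>\<sigma>\<close> fixes the DOSP if and only if it rotates this list.  Let the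
  rotation be by the fraction \<open>u/e\<close> of the length, in lowest terms.  Then the list is an \<open>e\<close>-fold cyclic
  cover of a shorter one, whose blocks are sets of cycles: the position of \<open>x\<close> in the long list is
  determined by the position of its cycle in the short list and by a coordinate \<open>y(x)\<close> modulo \<open>e\<close>
  with \<open>y(\<sigma> x) = y(x) + u\<close>.  There are \<open>e^(r-1)\<close> such coordinates with \<open>y(x0) = 0\<close>.  The short lists are
  again hypersimplicial, for cycles weighted by \<open>c(C)/e\<close> and total decoration \<open>k/e\<close>.  A generating
  function computation, in which lists of blocks become a geometric series
  (\<open>card_block_lists_pointed\<close>), shows that their number, as \<open>k < n\<close>, is the sum of
  \<open>(-1)^\<bar>S\<bar> ((k - c(S))/e)^(r-1)\<close>.  So every pair \<open>(e, u)\<close> contributes the same amount, and the number of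
  pairs is the sum of Euler's totient over the divisors of \<open>g\<close>, which is \<open>g\<close>.
\<close>

section \<open>Cycles of a permutation\<close>

lemma permutation_if_permutes_UNIV: "\<sigma> permutes (UNIV :: 'n::finite set) \<Longrightarrow> permutation \<sigma>"
  unfolding permutation_permutes by (intro exI[of _ UNIV]) simp

lemma mem_cycles_of_iff:
  assumes "\<sigma> permutes (UNIV :: 'n::finite set)"
  shows "C \<in> cycles_of \<sigma> \<and> x \<in> C \<longleftrightarrow> C = orbit \<sigma> x"
proof -
  have p: "permutation \<sigma>" using assms by (rule permutation_if_permutes_UNIV)
  have eq: "orbit \<sigma> x = orbit \<sigma> y" if "x \<in> orbit \<sigma> y" for y
    using orbit_cyclic_eq3[OF cyclic_on_orbit'[OF p] that] .
  show ?thesis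
  proof
    assume "C \<in> cycles_of \<sigma> \<and> x \<in> C"
    then obtain y where "C = orbit \<sigma> y" "x \<in> orbit \<sigma> y" unfolding cycles_of_def by blast
    then show "C = orbit \<sigma> x" using eq by simp
  next
    assume "C = orbit \<sigma> x"
    then show "C \<in> cycles_of \<sigma> \<and> x \<in> C"
      using permutation_self_in_orbit[OF p] by (simp add: cycles_of_def)
  qed
qed

lemma orbit_mem_iff:
  assumes "\<sigma> permutes (UNIV :: 'n::finite set)"
  shows "y \<in> orbit \<sigma> x \<longleftrightarrow> orbit \<sigma> y = orbit \<sigma> x"
proof -
  have "orbit \<sigma> x \<in> cycles_of \<sigma>" by (simp add: cycles_of_def)
  then show ?thesis using mem_cycles_of_iff[OF assms, of "orbit \<sigma> x" y] by metis
qed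

lemma self_in_orbit: "\<sigma> permutes (UNIV :: 'n::finite set) \<Longrightarrow> x \<in> orbit \<sigma> x"
  by (subst orbit_mem_iff) auto

lemma orbit_apply: "\<sigma> permutes (UNIV :: 'n::finite set) \<Longrightarrow> orbit \<sigma> (\<sigma> x) = orbit \<sigma> x"
  using permutation_orbit_step[OF permutation_if_permutes_UNIV] .

lemma orbit_in_cycles_of: "orbit \<sigma> x \<in> cycles_of \<sigma>"
  by (simp add: cycles_of_def)

lemma disjoint_cycles_of:
  assumes "\<sigma> permutes (UNIV :: 'n::finite set)" "C \<in> cycles_of \<sigma>" "C' \<in> cycles_of \<sigma>" "C \<noteq> C'"
  shows "C \<inter> C' = {}"
proof -
  have False if "x \<in> C" "x \<in> C'" for x
    using mem_cycles_of_iff[OF assms(1), of C x] mem_cycles_of_iff[OF assms(1), of C' x] that assms by simp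
  then show ?thesis by blast
qed

lemma card_cycle_pos: "C \<in> cycles_of \<sigma> \<Longrightarrow> 0 < card (C :: 'n::finite set)"
  unfolding cycles_of_def by (metis card_gt_0_iff finite imageE orbit_nonempty)

lemma sum_over_cycles:
  assumes "\<sigma> permutes (UNIV :: 'n::finite set)" "M \<subseteq> cycles_of \<sigma>"
  shows "sum f (\<Union>M) = (\<Sum>C\<in>M. sum f C)"
proof -
  have "\<forall>C\<in>M. \<forall>C'\<in>M. C \<noteq> C' \<longrightarrow> C \<inter> C' = {}"
    using assms(2) disjoint_cycles_of[OF assms(1)] by blast
  with sum.Union_disjoint[of M f] show ?thesis by simp
qed

lemma card_Union_cycles:
  assumes "\<sigma> permutes (UNIV :: 'n::finite set)" "M \<subseteq> cycles_of \<sigma>"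
  shows "card (\<Union>M) = (\<Sum>C\<in>M. card C)"
  using sum_over_cycles[OF assms, of "\<lambda>_. 1::nat"] by (simp only: card_eq_sum)

lemma Union_cycles_of: "\<sigma> permutes (UNIV :: 'n::finite set) \<Longrightarrow> \<Union>(cycles_of \<sigma>) = UNIV"
  using self_in_orbit[of \<sigma>] orbit_in_cycles_of[of \<sigma>] by (intro equalityI subsetI UNIV_I UnionI)

lemma invariant_on_orbit:
  assumes inv: "\<And>x. f (\<sigma> x) = f x" and "y \<in> orbit \<sigma> x"
  shows "f y = f x"
  using assms(2) by (induction rule: orbit.induct) (simp_all add: inv)

lemma orbit_eq_set_support:
  assumes "permutation \<sigma>"
  shows "orbit \<sigma> x = set (support \<sigma> x)"
  unfolding support_set[OF assms] orbit_altdef_permutation[OF assms] by auto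

lemma card_orbit_eq_least_power:
  assumes "permutation \<sigma>"
  shows "card (orbit \<sigma> x) = least_power \<sigma> x"
  unfolding orbit_eq_set_support[OF assms]
  using distinct_card[OF cycle_of_permutation[OF assms, of x]] by (simp only: length_map length_upt minus_nat.diff_0)

text \<open>
  So on a cycle the number of steps from a base point is well defined modulo every divisor of the
  length; this is what makes coordinates modulo such a divisor exist.
\<close>

lemma funpow_eq_imp_cong:
  assumes "\<sigma> permutes (UNIV :: 'n::finite set)" "(\<sigma> ^^ a) x = (\<sigma> ^^ b) x"
  shows "[a = b] (mod card (orbit \<sigma> x))"
proof -
  have p: "permutation \<sigma>" using assms(1) by (rule permutation_if_permutes_UNIV)
  have "[a = b] (mod card (orbit \<sigma> x))" if "a \<le> b" "(\<sigma> ^^ a) x = (\<sigma> ^^ b) x" for a b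
  proof -
    have "(\<sigma> ^^ (b - a)) x = x"
      using funpow_diff[OF permutes_inj[OF assms(1)] that] .
    then have "card (orbit \<sigma> x) dvd b - a"
      unfolding card_orbit_eq_least_power[OF p] by (rule least_power_minimal)
    then show ?thesis using that(1) by (simp add: cong_altdef_nat cong_sym_eq[of a])
  qed
  from this[of a b] this[of b a] show ?thesis
    using assms(2) by (metis cong_sym nat_le_linear)
qed

lemma funpow_card_orbit:
  assumes "\<sigma> permutes (UNIV :: 'n::finite set)"
  shows "(\<sigma> ^^ card (orbit \<sigma> x)) x = x"
  using least_power_of_permutation(1)[OF permutation_if_permutes_UNIV[OF assms]]
  by (simp add: card_orbit_eq_least_power[OF permutation_if_permutes_UNIV[OF assms]])

section \<open>The determinant of a permutation matrix\<close>

lemma sign_cycle_of_list: "distinct cs \<Longrightarrow> sign (cycle_of_list cs) = (-1) ^ (length cs - 1)"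
proof (induction cs rule: cycle_of_list.induct)
  case (1 i j cs)
  have "sign (cycle_of_list (i # j # cs)) = sign (Transposition.transpose i j) * sign (cycle_of_list (j # cs))"
    using sign_compose[OF permutation_swap_id permutation_of_cycle] by simp
  also have "\<dots> = (-1) ^ (length (i # j # cs) - 1)" using 1 by (simp add: sign_swap_id)
  finally show ?case .
qed simp_all

lemma perm_restrict_orbit:
  assumes "permutation \<sigma>"
  shows "perm_restrict \<sigma> (orbit \<sigma> x) = cycle_of_list (support \<sigma> x)"
proof
  fix y
  show "perm_restrict \<sigma> (orbit \<sigma> x) y = cycle_of_list (support \<sigma> x) y"
  proof (cases "y \<in> orbit \<sigma> x")
    case True
    then show ?thesis
      using cycle_restrict[OF assms, of y x] unfolding orbit_eq_set_support[OF assms]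
      by (simp add: perm_restrict_simps(1))
  next
    case False
    then have "y \<notin> set (support \<sigma> x)" unfolding orbit_eq_set_support[OF assms] .
    from perm_restrict_simps(2)[OF False] id_outside_supp[OF this] show ?thesis by simp
  qed
qed

text \<open>
  The restriction is a product of disjoint cycles, one for each member of \<open>M\<close>, and a cycle of length
  \<open>c\<close> has sign \<open>(-1)^(c-1)\<close>.
\<close>

lemma perm_restrict_Union_cycles:
  assumes \<sigma>: "\<sigma> permutes (UNIV :: 'n::finite set)" and "M \<subseteq> cycles_of \<sigma>"
  shows "permutation (perm_restrict \<sigma> (\<Union>M)) \<and> sign (perm_restrict \<sigma> (\<Union>M)) = (\<Prod>C\<in>M. (-1) ^ (card C - 1))"
proof -
  have p: "permutation \<sigma>" using \<sigma> by (rule permutation_if_permutes_UNIV)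
  have "finite M" by simp
  then show ?thesis using assms(2)
  proof (induction M rule: finite_induct)
    case empty
    have "perm_restrict \<sigma> {} = id" by (simp add: fun_eq_iff perm_restrict_simps)
    then show ?case by simp
  next
    case (insert C M)
    obtain x where C: "C = orbit \<sigma> x" using insert.prems by (auto simp: cycles_of_def)
    have "\<Union>M \<inter> C = {}"
      using insert disjoint_cycles_of[OF \<sigma>, of C] by blast
    moreover have "cyclic_on \<sigma> C" unfolding C using p by (rule cyclic_on_orbit')
    ultimately have eq: "perm_restrict \<sigma> (\<Union>(insert C M)) = perm_restrict \<sigma> (\<Union>M) \<circ> perm_restrict \<sigma> C"
      by (simp add: perm_restrict_comp Un_commute)
    have "permutation (perm_restrict \<sigma> C)" and "sign (perm_restrict \<sigma> C) = (-1) ^ (card C - 1)"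
      unfolding C perm_restrict_orbit[OF p] card_orbit_eq_least_power[OF p]
      by (rule permutation_of_cycle) (use sign_cycle_of_list[OF cycle_of_permutation[OF p, of x]] in simp)
    then show ?case
      using insert unfolding eq by (simp add: sign_compose permutation_compose del: o_apply)
  qed
qed

text \<open>
  If a cycle left \<open>U\<close> at the step from \<open>x\<close> to \<open>\<sigma> x\<close>, then both \<open>x\<close> and \<open>\<sigma> x\<close> would be sent to \<open>\<sigma> x\<close>.
\<close>

lemma perm_restrict_permutes_imp_Union_cycles:
  assumes \<sigma>: "\<sigma> permutes (UNIV :: 'n::finite set)" and inj: "inj (perm_restrict \<sigma> U)"
  shows "U = \<Union>{C \<in> cycles_of \<sigma>. C \<subseteq> U}"
proof -
  have step: "\<sigma> x \<in> U" if "x \<in> U" for x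
  proof (rule ccontr)
    assume "\<sigma> x \<notin> U"
    then have "perm_restrict \<sigma> U (\<sigma> x) = perm_restrict \<sigma> U x"
      using that by (simp add: perm_restrict_simps)
    then have "\<sigma> x = x" using inj by (simp add: inj_eq)
    then show False using that \<open>\<sigma> x \<notin> U\<close> by simp
  qed
  have "orbit \<sigma> x \<subseteq> U" if "x \<in> U" for x
  proof
    fix y assume "y \<in> orbit \<sigma> x"
    then show "y \<in> U" by induction (auto intro: step that)
  qed
  then show ?thesis
    using orbit_in_cycles_of[of \<sigma>] self_in_orbit[OF \<sigma>] by blast
qed

lemma minus_one_power_times_minus_power:
  fixes x :: "'a::comm_ring_1"
  shows "(-1) ^ c * (- x) ^ Suc c = - (x ^ Suc c)"
proof -
  have "(-1) ^ c * (- x) ^ Suc c = (- x) * ((-1) ^ c * (- x) ^ c)" by (simp only: power_Suc mult.left_commute)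
  also have "(-1) ^ c * (- x) ^ c = x ^ c" by (simp flip: power_mult_distrib)
  finally show ?thesis by simp
qed

text \<open>
  In the Leibniz formula, expand every factor \<open>[\<tau> i = i] - t [\<tau> i = \<sigma> i]\<close>.  Choosing the second summand
  exactly for the indices in \<open>U\<close> forces \<open>\<tau>\<close> to be the restriction of \<open>\<sigma>\<close> to \<open>U\<close>, which is a permutation
  only if \<open>U\<close> is a union of cycles.  The signs of these restrictions turn each chosen cycle into a factor
  \<open>- t^c\<close>.
\<close>

lemma det_I_minus_t_eq:
  assumes \<sigma>: "\<sigma> permutes (UNIV :: 'n::finite set)"
  shows "det_I_minus_t \<sigma> = (\<Prod>C\<in>cycles_of \<sigma>. 1 - fps_X ^ card C)"
proof -
  let ?a = "\<lambda>(\<tau>::'n\<Rightarrow>'n) i. if \<tau> i = \<sigma> i then - fps_X else (0::complex fps)"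
  let ?b = "\<lambda>(\<tau>::'n\<Rightarrow>'n) i. if \<tau> i = i then 1 else (0::complex fps)"
  let ?S = "{\<tau>. \<tau> permutes (UNIV :: 'n set)}"
  let ?s = "\<lambda>\<tau>. of_int (sign \<tau>) :: complex fps"
  define A :: "complex fps ^ 'n ^ 'n" where
    "A = (\<chi> i j. mat 1 $ i $ j - fps_X * perm_matrix \<sigma> $ i $ j)"
  have "det_I_minus_t \<sigma> = det (transpose A)"
    by (simp add: det_I_minus_t_def A_def det_transpose)
  also have "\<dots> = (\<Sum>\<tau>\<in>?S. ?s \<tau> * (\<Prod>i\<in>UNIV. ?a \<tau> i + ?b \<tau> i))"
    unfolding det_def
  proof (intro sum.cong refl arg_cong2[of _ _ _ _ "(*)"] prod.cong)
    fix \<tau> :: "'n \<Rightarrow> 'n" and i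
    show "transpose A $ i $ \<tau> i = ?a \<tau> i + ?b \<tau> i"
      by (simp add: transpose_def A_def mat_def perm_matrix_def)
  qed
  also have "\<dots> = (\<Sum>\<tau>\<in>?S. \<Sum>U\<in>UNIV. ?s \<tau> * ((\<Prod>i\<in>U. ?a \<tau> i) * (\<Prod>i\<in>UNIV - U. ?b \<tau> i)))"
    by (simp add: prod_add sum_distrib_left)
  also have "\<dots> = (\<Sum>U\<in>UNIV. \<Sum>\<tau>\<in>?S. ?s \<tau> * ((\<Prod>i\<in>U. ?a \<tau> i) * (\<Prod>i\<in>UNIV - U. ?b \<tau> i)))"
    by (rule sum.swap)
  also have "\<dots> = (\<Sum>U\<in>UNIV. \<Sum>\<tau>\<in>?S. if \<tau> = perm_restrict \<sigma> U then ?s \<tau> * (- fps_X) ^ card U else 0)"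
  proof (intro sum.cong refl)
    fix U :: "'n set" and \<tau> :: "'n \<Rightarrow> 'n"
    show "?s \<tau> * ((\<Prod>i\<in>U. ?a \<tau> i) * (\<Prod>i\<in>UNIV - U. ?b \<tau> i)) =
        (if \<tau> = perm_restrict \<sigma> U then ?s \<tau> * (- fps_X) ^ card U else 0)"
    proof (cases "\<tau> = perm_restrict \<sigma> U")
      case True
      have "(\<Prod>i\<in>U. ?a \<tau> i) = (\<Prod>i\<in>U. - fps_X)" "(\<Prod>i\<in>UNIV - U. ?b \<tau> i) = 1"
        unfolding True by (auto intro!: prod.cong prod.neutral simp: perm_restrict_simps)
      then show ?thesis using True by simp
    next
      case False
      then obtain i where "\<tau> i \<noteq> perm_restrict \<sigma> U i" by blast
      then have "(\<Prod>i\<in>U. ?a \<tau> i) = 0 \<or> (\<Prod>i\<in>UNIV - U. ?b \<tau> i) = 0"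
        by (cases "i \<in> U") (auto simp: perm_restrict_simps intro!: bexI[of _ i])
      then show ?thesis using False by auto
    qed
  qed
  also have "\<dots> = (\<Sum>U\<in>UNIV. if perm_restrict \<sigma> U permutes UNIV then ?s (perm_restrict \<sigma> U) * (- fps_X) ^ card U else 0)"
    by (intro sum.cong refl) (simp add: sum.delta' if_distrib cong: if_cong)
  also have "\<dots> = (\<Sum>U\<in>Union ` Pow (cycles_of \<sigma>). ?s (perm_restrict \<sigma> U) * (- fps_X) ^ card U)"
  proof (rule sum.mono_neutral_cong_right)
    show "\<forall>U\<in>UNIV - Union ` Pow (cycles_of \<sigma>).
      (if perm_restrict \<sigma> U permutes UNIV then ?s (perm_restrict \<sigma> U) * (- fps_X) ^ card U else 0) = 0"
    proof
      fix U assume U: "U \<in> UNIV - Union ` Pow (cycles_of \<sigma>)"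
      have "\<not> perm_restrict \<sigma> U permutes UNIV"
        using perm_restrict_permutes_imp_Union_cycles[OF \<sigma> permutes_inj, of U] U by blast
      then show "(if perm_restrict \<sigma> U permutes UNIV then ?s (perm_restrict \<sigma> U) * (- fps_X) ^ card U else 0) = 0"
        by simp
    qed
    fix U assume "U \<in> Union ` Pow (cycles_of \<sigma>)"
    then have "permutation (perm_restrict \<sigma> U)"
      using perm_restrict_Union_cycles[OF \<sigma>] by auto
    then have "perm_restrict \<sigma> U permutes UNIV"
      by (intro bij_imp_permutes permutation_bijective) auto
    then show "(if perm_restrict \<sigma> U permutes UNIV then ?s (perm_restrict \<sigma> U) * (- fps_X) ^ card U else 0) =
       ?s (perm_restrict \<sigma> U) * (- fps_X) ^ card U" by simp
  qed auto
  also have "\<dots> = (\<Sum>M\<in>Pow (cycles_of \<sigma>). ?s (perm_restrict \<sigma> (\<Union>M)) * (- fps_X) ^ card (\<Union>M))"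
  proof (rule sum.reindex_cong[OF _ refl refl])
    show "inj_on Union (Pow (cycles_of \<sigma>))"
    proof (rule inj_on_inverseI)
      fix M assume M: "M \<in> Pow (cycles_of \<sigma>)"
      have "C \<inter> \<Union>M \<noteq> {} \<longleftrightarrow> C \<in> M" if "C \<in> cycles_of \<sigma>" for C
      proof
        assume "C \<in> M"
        moreover have "C \<noteq> {}" using card_cycle_pos[OF that] by auto
        ultimately show "C \<inter> \<Union>M \<noteq> {}" by blast
      next
        assume "C \<inter> \<Union>M \<noteq> {}"
        then obtain C' where "C' \<in> M" "C \<inter> C' \<noteq> {}" by blast
        moreover have "C' \<in> cycles_of \<sigma>" using M \<open>C' \<in> M\<close> by blast
        ultimately show "C \<in> M" using disjoint_cycles_of[OF \<sigma> that, of C'] by auto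
      qed
      then show "{C \<in> cycles_of \<sigma>. C \<inter> \<Union>M \<noteq> {}} = M" using M by auto
    qed
  qed
  also have "\<dots> = (\<Sum>M\<in>Pow (cycles_of \<sigma>). \<Prod>C\<in>M. - (fps_X ^ card C))"
  proof (rule sum.cong[OF refl])
    fix M assume M: "M \<in> Pow (cycles_of \<sigma>)"
    have "?s (perm_restrict \<sigma> (\<Union>M)) * (- fps_X) ^ card (\<Union>M) =
       (\<Prod>C\<in>M. (-1) ^ (card C - 1) * (- fps_X) ^ card C)"
      using perm_restrict_Union_cycles[OF \<sigma>, of M] card_Union_cycles[OF \<sigma>, of M] M
      by (simp add: prod.distrib power_sum)
    also have "\<dots> = (\<Prod>C\<in>M. - (fps_X ^ card C))"
    proof (rule prod.cong[OF refl])
      fix C assume "C \<in> M"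
      then have "0 < card C" using M card_cycle_pos[of C \<sigma>] by blast
      then obtain c where "card C = Suc c" by (cases "card C") auto
      then show "(-1) ^ (card C - 1) * (- fps_X) ^ card C = - (fps_X ^ card C :: complex fps)"
        by (simp only: diff_Suc_1 minus_one_power_times_minus_power)
    qed
    finally show "?s (perm_restrict \<sigma> (\<Union>M)) * (- fps_X) ^ card (\<Union>M) = (\<Prod>C\<in>M. - (fps_X ^ card C))" .
  qed
  also have "\<dots> = (\<Prod>C\<in>cycles_of \<sigma>. - (fps_X ^ card C) + 1)"
    using prod_add[of "cycles_of \<sigma>" "\<lambda>C. - (fps_X ^ card C :: complex fps)" "\<lambda>_. 1"]
    by (simp only: finite prod.neutral_const mult_1_right)
  finally show ?thesis by (simp only: add.commute[of _ 1] add_uminus_conv_diff)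
qed

section \<open>Decorated lists and their rotations\<close>

definition move_block :: "('n \<Rightarrow> 'n) \<Rightarrow> 'n set \<times> nat \<Rightarrow> 'n set \<times> nat" where
  "move_block \<sigma> b = (\<sigma> ` fst b, snd b)"

lemma act_DOSP_eq: "act_DOSP \<sigma> D = map (move_block \<sigma>) ` D"
proof -
  have "(\<lambda>(L, l). (\<sigma> ` L, l)) = move_block \<sigma>" by (auto simp: move_block_def fun_eq_iff)
  then show ?thesis unfolding act_DOSP_def by simp
qed

lemma mem_set_map_fst_iff: "L \<in> set (map fst bs) \<longleftrightarrow> (\<exists>i<length bs. L = fst (bs ! i))"
  unfolding in_set_conv_nth length_map by (metis nth_map)

text \<open>
  All later constructions address blocks by their position in the list, so the partition property
  is rephrased in terms of positions.
\<close>

lemma list_partition_iff: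
  "distinct (map fst bs) \<and> partition_on A (set (map fst bs)) \<longleftrightarrow>
    (\<forall>i<length bs. fst (bs ! i) \<noteq> {} \<and> fst (bs ! i) \<subseteq> A) \<and> (\<forall>x\<in>A. \<exists>!i. i < length bs \<and> x \<in> fst (bs ! i))"
  (is "?L \<longleftrightarrow> ?R")
proof
  assume L: ?L
  have mem: "fst (bs ! i) \<in> set (map fst bs)" if "i < length bs" for i
    using that by simp
  have disj: "i = j" if "i < length bs" "j < length bs" "x \<in> fst (bs ! i)" "x \<in> fst (bs ! j)" for i j x
  proof -
    have "fst (bs ! i) = fst (bs ! j)"
      using L mem[OF that(1)] mem[OF that(2)] that(3,4)
      unfolding partition_on_def disjoint_def by (metis disjoint_iff)
    then show "i = j" using L that nth_eq_iff_index_eq[of "map fst bs" i j] by simp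
  qed
  show ?R
  proof (intro conjI allI impI ballI)
    fix i assume "i < length bs"
    then show "fst (bs ! i) \<noteq> {}" "fst (bs ! i) \<subseteq> A"
      using L mem[of i] unfolding partition_on_def by (metis, metis Union_upper)
  next
    fix x assume "x \<in> A"
    then have "x \<in> \<Union>(set (map fst bs))" using L unfolding partition_on_def by metis
    then obtain b where "b \<in> set bs" "x \<in> fst b" by auto
    then obtain i where "i < length bs" "x \<in> fst (bs ! i)" by (auto simp: in_set_conv_nth)
    then show "\<exists>!i. i < length bs \<and> x \<in> fst (bs ! i)" using disj by blast
  qed
next
  assume R: ?R
  have disj: "i = j" if "i < length bs" "j < length bs" "x \<in> fst (bs ! i)" "x \<in> fst (bs ! j)" for i j x
  proof -
    have "x \<in> A" using R that(1,3) by blast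
    then have "\<exists>!i. i < length bs \<and> x \<in> fst (bs ! i)" using R by blast
    then show "i = j" using that by (elim ex1E) metis
  qed
  have "distinct (map fst bs)"
    unfolding distinct_conv_nth
  proof (intro allI impI)
    fix i j assume ij: "i < length (map fst bs)" "j < length (map fst bs)" "i \<noteq> j"
    then have "fst (bs ! i) \<noteq> {}" using R by simp
    then obtain x where "x \<in> fst (bs ! i)" by blast
    then show "map fst bs ! i \<noteq> map fst bs ! j" using disj[of i j x] ij by auto
  qed
  moreover have "partition_on A (set (map fst bs))"
  proof (rule partition_onI)
    show "\<Union>(set (map fst bs)) = A"
    proof (intro equalityI subsetI)
      fix x assume "x \<in> \<Union>(set (map fst bs))"
      then obtain i where "i < length bs" "x \<in> fst (bs ! i)" by (auto simp: in_set_conv_nth)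
      then show "x \<in> A" using R by blast
    next
      fix x assume "x \<in> A"
      then have "\<exists>!i. i < length bs \<and> x \<in> fst (bs ! i)" using R by blast
      then obtain i where i: "i < length bs" "x \<in> fst (bs ! i)" by (elim ex1E) blast
      from i(1) have "fst (bs ! i) \<in> set (map fst bs)" by simp
      then show "x \<in> \<Union>(set (map fst bs))" using i(2) by (rule UnionI)
    qed
    fix p q assume "p \<in> set (map fst bs)" "q \<in> set (map fst bs)" "p \<noteq> q"
    then obtain i j where ij: "i < length bs" "j < length bs" "p = fst (bs ! i)" "q = fst (bs ! j)" "i \<noteq> j"
      unfolding mem_set_map_fst_iff by blast
    have False if "x \<in> p" "x \<in> q" for x using disj[of i j x] ij that by simp
    then show "disjnt p q" unfolding disjnt_def by blast
  next
    show "{} \<notin> set (map fst bs)" using R unfolding mem_set_map_fst_iff by metis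
  qed
  ultimately show ?L ..
qed

lemma sum_list_rotate: "sum_list (rotate m xs) = (sum_list xs :: nat)"
proof -
  have "sum_list (rotate m xs) = sum_list (take (m mod length xs) xs) + sum_list (drop (m mod length xs) xs)"
    unfolding rotate_drop_take by simp
  also have "\<dots> = sum_list xs" by (simp flip: sum_list_append)
  finally show ?thesis .
qed

lemma rotate_in_decorated_lists:
  "ds \<in> decorated_lists k \<Longrightarrow> rotate m ds \<in> decorated_lists k"
  by (simp add: decorated_lists_def rotate_map[symmetric] sum_list_rotate)

lemma decorated_list_nth:
  assumes "ds \<in> decorated_lists k"
  shows "\<exists>!i. i < length ds \<and> x \<in> fst (ds ! i)" and "i < length ds \<Longrightarrow> fst (ds ! i) \<noteq> {}"
proof -
  have "distinct (map fst ds) \<and> partition_on UNIV (set (map fst ds))"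
    using assms by (simp add: decorated_lists_def)
  note * = list_partition_iff[THEN iffD1, OF this]
  show "\<exists>!i. i < length ds \<and> x \<in> fst (ds ! i)" using *[THEN conjunct2] by (rule bspec) simp
  show "i < length ds \<Longrightarrow> fst (ds ! i) \<noteq> {}" using *[THEN conjunct1] by simp
qed

lemma decorated_list_nth_unique:
  assumes "ds \<in> decorated_lists k" "i < length ds" "j < length ds" "x \<in> fst (ds ! i)" "x \<in> fst (ds ! j)"
  shows "i = j"
  using decorated_list_nth(1)[OF assms(1), of x] assms(2-5) by metis

lemma decorated_list_not_Nil: "ds \<in> decorated_lists k \<Longrightarrow> ds \<noteq> []"
  using decorated_list_nth(1)[of ds k undefined] by (metis less_nat_zero_code list.size(3))

lemma decorated_list_rotate_eq_iff:
  assumes "ds \<in> decorated_lists k"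
  shows "rotate m ds = rotate m' ds \<longleftrightarrow> m mod length ds = m' mod length ds"
proof
  assume eq: "rotate m ds = rotate m' ds"
  have pos: "0 < length ds" using decorated_list_not_Nil[OF assms] by simp
  then have "ds ! (m mod length ds) = ds ! (m' mod length ds)"
    using nth_rotate[of 0 ds m] nth_rotate[of 0 ds m'] eq by simp
  moreover have "distinct ds" using assms by (simp add: decorated_lists_def distinct_map)
  ultimately show "m mod length ds = m' mod length ds"
    using pos by (simp add: nth_eq_iff_index_eq)
qed (metis rotate_conv_mod)

text \<open>
  Requiring a fixed point \<open>x0\<close> to lie in the first block selects one list from each cyclic class.
\<close>

definition pointed_lists :: "nat \<Rightarrow> 'n \<Rightarrow> ('n set \<times> nat) list set" where
  "pointed_lists k x0 = {ds \<in> decorated_lists k. (\<forall>(L, l)\<in>set ds. l < card L) \<and> x0 \<in> fst (hd ds)}"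

lemma shift_class_eq:
  "ds \<in> decorated_lists k \<Longrightarrow>
    cyclic_shift_rel (decorated_lists k) `` {ds} = range (\<lambda>m. rotate m ds)"
  by (auto simp: cyclic_shift_rel_def rotate_in_decorated_lists)

text \<open>
  The cyclic class of a list is mapped to itself if and only if one, equivalently every, member is
  mapped to a rotation of itself.
\<close>

lemma card_fixed_DOSPs_eq_pointed_lists:
  "card {D \<in> hypersimplicial_DOSPs k. act_DOSP \<sigma> D = D} =
   card {ds \<in> pointed_lists k x0. \<exists>s. map (move_block \<sigma>) ds = rotate s ds}"
proof -
  let ?A = "decorated_lists k"
  let ?T = "{ds \<in> pointed_lists k x0. \<exists>s. map (move_block \<sigma>) ds = rotate s ds}"
  let ?c = "\<lambda>ds. range (\<lambda>m. rotate m ds)"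
  have T: "ds \<in> ?A" "x0 \<in> fst (ds ! 0)" if "ds \<in> pointed_lists k x0" for ds
    using that decorated_list_not_Nil[of ds k] by (auto simp: pointed_lists_def hd_conv_nth)
  have inj: "inj_on ?c (pointed_lists k x0)"
  proof (rule inj_onI)
    fix ds ds' assume ds: "ds \<in> pointed_lists k x0" "ds' \<in> pointed_lists k x0" and eq: "?c ds = ?c ds'"
    have "rotate 0 ds' \<in> ?c ds" unfolding eq by (rule rangeI)
    then obtain m where m: "ds' = rotate m ds" by auto
    have pos: "0 < length ds" using decorated_list_not_Nil[OF T(1)[OF ds(1)]] by simp
    have "x0 \<in> fst (ds ! (m mod length ds))"
      using T(2)[OF ds(2)] nth_rotate[OF pos, of m] unfolding m by simp
    then have "m mod length ds = 0"
      using decorated_list_nth_unique[OF T(1)[OF ds(1)], of "m mod length ds" 0 x0] T(2)[OF ds(1)] pos by simp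
    then show "ds = ds'" unfolding m by (metis id_apply rotate_conv_mod rotate0)
  qed
  have fixed_iff: "map (move_block \<sigma>) ` ?c ds = ?c ds \<longleftrightarrow> (\<exists>s. map (move_block \<sigma>) ds = rotate s ds)"
    if "ds \<noteq> []" for ds
  proof
    assume eq: "map (move_block \<sigma>) ` ?c ds = ?c ds"
    have "map (move_block \<sigma>) (rotate 0 ds) \<in> map (move_block \<sigma>) ` ?c ds" by blast
    then show "\<exists>s. map (move_block \<sigma>) ds = rotate s ds" unfolding eq by auto
  next
    assume "\<exists>s. map (move_block \<sigma>) ds = rotate s ds"
    then obtain s where s: "map (move_block \<sigma>) ds = rotate s ds" by blast
    have "map (move_block \<sigma>) ` ?c ds = range (\<lambda>m. rotate m (rotate s ds))"
      by (simp add: image_image rotate_map[symmetric] s)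
    also have "\<dots> = ?c ds"
    proof (intro equalityI image_subsetI)
      fix m show "rotate m (rotate s ds) \<in> ?c ds" by (simp add: rotate_rotate)
      obtain l where l: "length ds = Suc l" using \<open>ds \<noteq> []\<close> by (cases ds) auto
      define j where "j = m + l * s"
      have "j + s = m + s * length ds" by (simp add: j_def l)
      then have j: "(j + s) mod length ds = m mod length ds" by (metis mod_mult_self1)
      have "rotate m ds = rotate j (rotate s ds)"
        unfolding rotate_rotate by (metis j rotate_conv_mod)
      then show "rotate m ds \<in> range (\<lambda>m. rotate m (rotate s ds))" by blast
    qed
    finally show "map (move_block \<sigma>) ` ?c ds = ?c ds" .
  qed
  have "?c ` ?T = {D \<in> hypersimplicial_DOSPs k. act_DOSP \<sigma> D = D}"
  proof (intro equalityI subsetI)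
    fix D assume "D \<in> ?c ` ?T"
    then obtain ds where ds: "ds \<in> pointed_lists k x0" "\<exists>s. map (move_block \<sigma>) ds = rotate s ds" "D = ?c ds"
      by blast
    have "D \<in> DOSPs k" unfolding ds(3) DOSPs_def shift_class_eq[OF T(1)[OF ds(1)], symmetric]
      by (rule quotientI) (rule T(1)[OF ds(1)])
    moreover have "hypersimplicial D"
      using ds(1) unfolding ds(3) hypersimplicial_def pointed_lists_def by simp
    ultimately show "D \<in> {D \<in> hypersimplicial_DOSPs k. act_DOSP \<sigma> D = D}"
      using ds(2) fixed_iff[OF decorated_list_not_Nil[OF T(1)[OF ds(1)]]] by (simp add: hypersimplicial_DOSPs_def act_DOSP_eq ds(3))
  next
    fix D assume D: "D \<in> {D \<in> hypersimplicial_DOSPs k. act_DOSP \<sigma> D = D}"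
    then obtain cs where cs: "cs \<in> ?A" "D = ?c cs"
      using shift_class_eq by (force simp: hypersimplicial_DOSPs_def DOSPs_def elim!: quotientE)
    obtain i where i: "i < length cs" "x0 \<in> fst (cs ! i)"
      using decorated_list_nth(1)[OF cs(1), of x0] by blast
    define ds where "ds = rotate i cs"
    have dsA: "ds \<in> ?A" unfolding ds_def by (rule rotate_in_decorated_lists[OF cs(1)])
    have "ds \<in> D" unfolding cs(2) ds_def by blast
    have len: "0 < length cs" using i(1) by linarith
    have "ds ! 0 = cs ! i" unfolding ds_def using nth_rotate[OF len, of i] i by simp
    then have "x0 \<in> fst (hd ds)"
      using i decorated_list_not_Nil[OF dsA] by (simp add: hd_conv_nth)
    moreover have "\<forall>(L, l)\<in>set ds. l < card L"
      using D \<open>ds \<in> D\<close> by (auto simp: hypersimplicial_DOSPs_def hypersimplicial_def)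
    ultimately have ds: "ds \<in> pointed_lists k x0" using dsA by (simp add: pointed_lists_def)
    have "D = ?c ds"
    proof -
      let ?r = "cyclic_shift_rel ?A"
      have "(cs, ds) \<in> ?r" using cs(1) dsA unfolding cyclic_shift_rel_def ds_def by blast
      then have "?r `` {cs} = ?r `` {ds}" by (rule equiv_class_eq[OF equiv_cyclic_shift_rel])
      then show ?thesis unfolding cs(2) shift_class_eq[OF cs(1), symmetric] shift_class_eq[OF dsA, symmetric] .
    qed
    moreover have "\<exists>s. map (move_block \<sigma>) ds = rotate s ds"
      using D fixed_iff[OF decorated_list_not_Nil[OF dsA]] unfolding \<open>D = ?c ds\<close> act_DOSP_eq by simp
    ultimately show "D \<in> ?c ` ?T" using ds by blast
  qed
  moreover have "card (?c ` ?T) = card ?T"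
    by (rule card_image) (rule inj_on_subset[OF inj], blast)
  ultimately show ?thesis by simp
qed

text \<open>
  The lists that \<open>\<sigma>\<close> rotates by the fraction \<open>u/e\<close> of their length.
\<close>

definition rotation_lists :: "('n \<Rightarrow> 'n) \<Rightarrow> nat \<Rightarrow> 'n \<Rightarrow> nat \<Rightarrow> nat \<Rightarrow> ('n set \<times> nat) list set" where
  "rotation_lists \<sigma> k x0 e u = {ds \<in> pointed_lists k x0. e dvd length ds \<and>
     map (move_block \<sigma>) ds = rotate (u * (length ds div e)) ds}"

text \<open>
  Reduce the rotation amount, taken in \<open>{1..p}\<close> for a list of length \<open>p\<close>, to a fraction of \<open>p\<close> in lowest
  terms.  The trivial rotation is the fraction \<open>1/1\<close>, in agreement with \<open>totatives 1 = {1}\<close>.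
\<close>

lemma fixed_pointed_lists_eq:
  "{ds \<in> pointed_lists k x0. \<exists>s. map (move_block \<sigma>) ds = rotate s ds} =
   (\<Union>(e, u)\<in>(SIGMA e:{0<..}. totatives e). rotation_lists \<sigma> k x0 e u)"
proof (intro equalityI subsetI)
  fix ds assume "ds \<in> {ds \<in> pointed_lists k x0. \<exists>s. map (move_block \<sigma>) ds = rotate s ds}"
  then obtain s where ds: "ds \<in> pointed_lists k x0" and s: "map (move_block \<sigma>) ds = rotate s ds" by blast
  let ?p = "length ds"
  have p: "0 < ?p" using ds decorated_list_not_Nil[of ds k] by (simp add: pointed_lists_def)
  \<comment> \<open>The representative of \<open>s\<close> in \<open>{1..p}\<close>, which is the range of \<open>u * d\<close> for \<open>u\<close> in \<open>totatives e\<close>.\<close>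
  define s' where "s' = (if s mod ?p = 0 then ?p else s mod ?p)"
  have s': "0 < s'" "s' \<le> ?p" "s' mod ?p = s mod ?p"
    using p mod_less_divisor[OF p, of s] by (auto simp: s'_def)
  define d where "d = gcd s' ?p"
  define e where "e = ?p div d"
  define u where "u = s' div d"
  have d: "0 < d" "d dvd s'" "d dvd ?p" using s' by (auto simp: d_def)
  have eq: "e * d = ?p" "u * d = s'" using d by (simp_all add: e_def u_def)
  have "coprime u e"
    unfolding u_def e_def d_def using s' by (intro div_gcd_coprime) auto
  moreover have "0 < u" "u \<le> e" "0 < e" using eq s' d p by (auto intro!: Nat.gr0I) 
  moreover have "?p div e = d" using eq \<open>0 < e\<close> by (metis nonzero_mult_div_cancel_left not_gr0)
  moreover have "rotate s ds = rotate (u * d) ds"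
    unfolding eq(2) by (metis rotate_conv_mod s'(3))
  moreover have "e dvd ?p" using eq(1) by (metis dvd_triv_left)
  ultimately show "ds \<in> (\<Union>(e, u)\<in>(SIGMA e:{0<..}. totatives e). rotation_lists \<sigma> k x0 e u)"
    using ds s by (intro UN_I[of "(e, u)"]) (simp_all add: rotation_lists_def in_totatives_iff)
next
  fix ds assume "ds \<in> (\<Union>(e, u)\<in>(SIGMA e:{0<..}. totatives e). rotation_lists \<sigma> k x0 e u)"
  then show "ds \<in> {ds \<in> pointed_lists k x0. \<exists>s. map (move_block \<sigma>) ds = rotate s ds}"
    unfolding rotation_lists_def by blast
qed

text \<open>
  The blocks of a list are distinct, so its rotation amount is unique modulo the length, and a
  fraction in lowest terms is determined by its value.
\<close>

lemma rotation_lists_disjoint: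
  assumes "ds \<in> rotation_lists \<sigma> k x0 e u" "ds \<in> rotation_lists \<sigma> k x0 e' u'"
    "u \<in> totatives e" "u' \<in> totatives e'"
  shows "e = e' \<and> u = u'"
proof -
  let ?p = "length ds"
  have ds: "ds \<in> decorated_lists k" using assms(1) by (simp add: rotation_lists_def pointed_lists_def)
  have p: "0 < ?p" using decorated_list_not_Nil[OF ds] by simp
  have e: "e dvd ?p" "e' dvd ?p" using assms by (auto simp: rotation_lists_def)
  have ranges: "0 < u * (?p div e)" "u * (?p div e) \<le> ?p" "0 < u' * (?p div e')" "u' * (?p div e') \<le> ?p"
  proof -
    have "0 < v * (?p div f) \<and> v * (?p div f) \<le> ?p" if fp: "f dvd ?p" "v \<in> totatives f" for f v
    proof -
      obtain q where q: "?p = f * q" using fp(1) unfolding dvd_def by blast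
      then have "0 < f" "0 < q" using p by auto
      then show ?thesis using fp(2) q by (simp add: in_totatives_iff)
    qed
    then show "0 < u * (?p div e)" "u * (?p div e) \<le> ?p" "0 < u' * (?p div e')" "u' * (?p div e') \<le> ?p"
      using e assms by blast+
  qed
  have "rotate (u * (?p div e)) ds = rotate (u' * (?p div e')) ds"
    using assms by (simp add: rotation_lists_def)
  then have cong: "(u * (?p div e)) mod ?p = (u' * (?p div e')) mod ?p"
    unfolding decorated_list_rotate_eq_iff[OF ds] .
  have "a = b" if "0 < a" "a \<le> ?p" "0 < b" "b \<le> ?p" "a mod ?p = b mod ?p" for a b
    using that by (cases "a = ?p"; cases "b = ?p") auto
  from this[OF ranges cong] have eq: "u * (?p div e) = u' * (?p div e')" .
  have "u * e' * ?p = u' * e * ?p"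
  proof -
    obtain q q' where q: "?p = e * q" "?p = e' * q'" using e unfolding dvd_def by blast
    have "0 < e" "0 < e'" using p e by (metis dvd_0_left gr0I)+
    then have "?p div e = q" "?p div e' = q'" using q by (metis nonzero_mult_div_cancel_left not_gr0)+
    then have "u * q = u' * q'" using eq by simp
    have "u * e' * ?p = (u * q) * (e * e')" unfolding q(1) by (simp only: ac_simps)
    also have "\<dots> = (u' * q') * (e * e')" unfolding \<open>u * q = u' * q'\<close> ..
    also have "\<dots> = u' * e * ?p" unfolding q(2) by (simp only: ac_simps)
    finally show ?thesis .
  qed
  then have "u * e' = u' * e" using p by simp
  then show ?thesis
    using assms(3,4) coprime_crossproduct_nat[of u e u' e']
    by (simp add: in_totatives_iff mult.commute coprime_commute)
qed

section \<open>Rotated lists as cyclic covers of lists of cycle sets\<close>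

text \<open>
  The coordinates that tell in which of the \<open>e\<close> sheets of a cyclic cover a point lies; the normalisation
  at \<open>x0\<close> corresponds to \<open>x0\<close> being in the first block.
\<close>

definition equivariant_maps :: "('n \<Rightarrow> 'n) \<Rightarrow> 'n \<Rightarrow> nat \<Rightarrow> nat \<Rightarrow> ('n \<Rightarrow> nat) set" where
  "equivariant_maps \<sigma> x0 e u = {y. (\<forall>x. y x < e) \<and> (\<forall>x. y (\<sigma> x) = (y x + u) mod e) \<and> y x0 = 0}"

text \<open>
  The quotients of the rotated lists.  The conditions are those of a pointed hypersimplicial list on the
  cycles, where a cycle \<open>C\<close> has weight \<open>card C / e\<close> and the decorations sum to \<open>k / e\<close>; they are multiplied
  by \<open>e\<close> here because nothing is assumed about divisibility.
\<close>

definition cycle_lists :: "('n \<Rightarrow> 'n) \<Rightarrow> nat \<Rightarrow> 'n \<Rightarrow> nat \<Rightarrow> ('n set set \<times> nat) list set" where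
  "cycle_lists \<sigma> k x0 e = {bs. distinct (map fst bs) \<and> partition_on (cycles_of \<sigma>) (set (map fst bs)) \<and>
     (\<forall>(M, l)\<in>set bs. 0 < l \<and> l * e < (\<Sum>C\<in>M. card C)) \<and> e * sum_list (map snd bs) = k \<and>
     orbit \<sigma> x0 \<in> fst (hd bs)}"

text \<open>
  The \<open>e\<close>-fold cover consists of \<open>e\<close> copies of \<open>bs\<close> one after the other.  The points of a cycle in the
  \<open>i\<close>-th block of \<open>bs\<close> are distributed over the \<open>i\<close>-th blocks of the copies, according to \<open>y\<close>.
\<close>

definition lift_list :: "('n \<Rightarrow> 'n) \<Rightarrow> nat \<Rightarrow> ('n \<Rightarrow> nat) \<Rightarrow> ('n set set \<times> nat) list \<Rightarrow> ('n set \<times> nat) list" where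
  "lift_list \<sigma> e y bs = map (\<lambda>m. ({x. y x = m div length bs \<and> orbit \<sigma> x \<in> fst (bs ! (m mod length bs))},
     snd (bs ! (m mod length bs)))) [0..<e * length bs]"

lemma exists_multiple_cong:
  assumes "coprime u e" "0 < (e::nat)"
  shows "\<exists>t. [j + t * u = j'] (mod e)"
proof -
  obtain v where v: "[u * v = Suc 0] (mod e)" using cong_solve_coprime_nat[OF assms(1)] by blast
  \<comment> \<open>Congruent to \<open>j' - j\<close> modulo \<open>e\<close>.\<close>
  define c where "c = j' + (e - 1) * j"
  have "[u * v * c = Suc 0 * c] (mod e)" using v by (rule cong_scalar_right)
  then have "[j + (v * c) * u = j + c] (mod e)" by (intro cong_add) (simp_all add: ac_simps)
  moreover have "j + c = j' + e * j" using assms(2) by (cases e) (simp_all add: c_def)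
  moreover have "[j' + e * j = j'] (mod e)" by (simp add: cong_def)
  ultimately show ?thesis by (metis cong_trans)
qed

lemma sum_mod_block: "(\<Sum>m<e * d. f (m mod d)) = e * (\<Sum>i<d. f i)" for f :: "nat \<Rightarrow> nat"
proof -
  have "(\<Sum>m<e * d. f (m mod d)) = (\<Sum>a<e. \<Sum>m = a * d..<a * d + d. f (m mod d))"
    by (simp add: sum.nat_group)
  also have "\<dots> = (\<Sum>a<e. \<Sum>i<d. f i)"
  proof (rule sum.cong[OF refl])
    fix a
    have "(\<Sum>m = 0 + a * d..<d + a * d. f (m mod d)) = (\<Sum>i = 0..<d. f ((i + a * d) mod d))"
      by (rule sum.shift_bounds_nat_ivl)
    also have "\<dots> = (\<Sum>i<d. f i)" by (intro sum.cong) auto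
    finally show "(\<Sum>m = a * d..<a * d + d. f (m mod d)) = (\<Sum>i<d. f i)" by (simp add: add.commute)
  qed
  finally show ?thesis by simp
qed

lemma add_mult_div_mod:
  fixes m d e u :: nat
  assumes "m < e * d"
  shows "((m + u * d) mod (e * d)) div d = (m div d + u) mod e" and "((m + u * d) mod (e * d)) mod d = m mod d"
proof -
  have "0 < d" using assms by (cases d) auto
  have eq: "(m + u * d) mod (e * d) = d * ((m div d + u) mod e) + m mod d"
    using mod_mult2_eq[of "m + u * d" d e] \<open>0 < d\<close> by (simp add: mult.commute add.commute)
  show "((m + u * d) mod (e * d)) div d = (m div d + u) mod e"
    unfolding eq using \<open>0 < d\<close> by simp
  show "((m + u * d) mod (e * d)) mod d = m mod d"
    unfolding eq by simp
qed

context
  fixes \<sigma> :: "'n::finite \<Rightarrow> 'n" and e u :: nat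
  assumes \<sigma>: "\<sigma> permutes UNIV" and cop: "coprime u e" and e_pos: "0 < e"
begin

lemma equivariant_maps_funpow:
  assumes "y \<in> equivariant_maps \<sigma> x0 e u"
  shows "y ((\<sigma> ^^ t) x) = (y x + t * u) mod e"
proof (induction t)
  case 0
  then show ?case using assms by (simp add: equivariant_maps_def)
next
  case (Suc t)
  have "y ((\<sigma> ^^ Suc t) x) = (y ((\<sigma> ^^ t) x) + u) mod e"
    using assms by (simp add: equivariant_maps_def)
  then show ?case unfolding Suc by (simp add: mod_simps algebra_simps)
qed

text \<open>
  Going once around \<open>C\<close> adds \<open>card C * u\<close> to the coordinate, and \<open>u\<close> is invertible modulo \<open>e\<close>.
\<close>

lemma equivariant_maps_dvd:
  assumes "y \<in> equivariant_maps \<sigma> x0 e u" "C \<in> cycles_of \<sigma>"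
  shows "e dvd card C"
proof -
  obtain x where C: "C = orbit \<sigma> x" using assms(2) by (auto simp: cycles_of_def)
  have "y x = (y x + card C * u) mod e"
    using equivariant_maps_funpow[OF assms(1), of "card C" x] funpow_card_orbit[OF \<sigma>, of x] unfolding C by simp
  moreover have "y x < e" using assms(1) by (simp add: equivariant_maps_def)
  ultimately have "[y x + card C * u = y x + 0] (mod e)" by (simp add: cong_def)
  then have "[card C * u = 0] (mod e)" by (simp only: cong_add_lcancel_nat)
  then have "e dvd card C * u" by (simp add: cong_0_iff)
  then show ?thesis using cop by (simp add: coprime_dvd_mult_left_iff coprime_commute)
qed

lemma orbit_funpow: "orbit \<sigma> ((\<sigma> ^^ t) x) = orbit \<sigma> x"
  by (induction t) (simp_all add: orbit_apply[OF \<sigma>])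

text \<open>
  As \<open>u\<close> is invertible modulo \<open>e\<close>, some power of \<open>\<sigma>\<close> maps any fibre injectively into any other
  fibre.  So all fibres have the same size.
\<close>

lemma card_equivariant_fibre:
  assumes y: "y \<in> equivariant_maps \<sigma> x0 e u" and M: "M \<subseteq> cycles_of \<sigma>" and "j < e"
  shows "e * card {x. y x = j \<and> orbit \<sigma> x \<in> M} = (\<Sum>C\<in>M. card C)"
proof -
  let ?F = "\<lambda>j. {x. y x = j \<and> orbit \<sigma> x \<in> M}"
  have le: "card (?F i) \<le> card (?F j)" if "i < e" "j < e" for i j
  proof -
    obtain t where t: "[i + t * u = j] (mod e)" using exists_multiple_cong[OF cop e_pos] by blast
    show ?thesis
    proof (rule card_inj_on_le[of "\<sigma> ^^ t"])
      show "inj_on (\<sigma> ^^ t) (?F i)"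
        using permutes_inj[OF permutes_funpow[OF \<sigma>]] inj_on_subset by blast
      show "(\<sigma> ^^ t) ` ?F i \<subseteq> ?F j"
      proof (rule image_subsetI)
        fix x assume "x \<in> ?F i"
        then show "(\<sigma> ^^ t) x \<in> ?F j"
          using equivariant_maps_funpow[OF y, of t x] t that(2) orbit_funpow[of t x] by (simp add: cong_def)
      qed
    qed simp
  qed
  have eq: "card (?F i) = card (?F j)" if "i < e" for i
    using le[OF that assms(3)] le[OF assms(3) that] by simp
  have "\<Union>M = (\<Union>i\<in>{..<e}. ?F i)"
  proof (intro equalityI subsetI)
    fix x assume "x \<in> \<Union>M"
    then obtain C where "C \<in> M" "x \<in> C" by blast
    then have "orbit \<sigma> x \<in> M" using mem_cycles_of_iff[OF \<sigma>, of C x] M by auto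
    moreover have "y x < e" using y by (simp add: equivariant_maps_def)
    ultimately show "x \<in> (\<Union>i\<in>{..<e}. ?F i)" by simp
  next
    fix x assume "x \<in> (\<Union>i\<in>{..<e}. ?F i)"
    then have "orbit \<sigma> x \<in> M" by blast
    then show "x \<in> \<Union>M" using self_in_orbit[OF \<sigma>] by (rule UnionI)
  qed
  then have "card (\<Union>M) = (\<Sum>i<e. card (?F i))"
    by (simp only:) (rule card_UN_disjoint; auto)
  also have "\<dots> = (\<Sum>i<e. card (?F j))" by (intro sum.cong refl eq) simp
  finally show ?thesis using card_Union_cycles[OF \<sigma> M] by simp
qed

text \<open>
  The coordinate can be prescribed freely at one base point of each cycle, except that the cycle of
  \<open>x0\<close> is already normalised; it extends around each cycle because \<open>e\<close> divides its length.
\<close>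

lemma card_equivariant_maps:
  assumes dvd: "\<forall>C\<in>cycles_of \<sigma>. e dvd card C"
  shows "card (equivariant_maps \<sigma> x0 e u) = e ^ (card (cycles_of \<sigma>) - 1)"
proof -
  define C0 where "C0 = orbit \<sigma> x0"
  define R where "R = cycles_of \<sigma> - {C0}"
  define rep where "rep = (\<lambda>C. if C = C0 then x0 else SOME x. x \<in> C)"
  have rep: "rep C \<in> C" if "C \<in> cycles_of \<sigma>" for C
    using that someI_ex[of "\<lambda>x. x \<in> C"] card_cycle_pos[OF that] self_in_orbit[OF \<sigma>, of x0]
    by (auto simp: rep_def C0_def card_gt_0_iff)
  have rep_orbit: "orbit \<sigma> (rep (orbit \<sigma> x)) = orbit \<sigma> x" for x
    using rep[OF orbit_in_cycles_of, of x] orbit_mem_iff[OF \<sigma>] by blast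
  have "\<exists>t. (\<sigma> ^^ t) (rep (orbit \<sigma> x)) = x" for x
  proof -
    have "x \<in> orbit \<sigma> (rep (orbit \<sigma> x))" unfolding rep_orbit by (rule self_in_orbit[OF \<sigma>])
    then have "\<exists>n. x = (\<sigma> ^^ n) (rep (orbit \<sigma> x)) \<and> 0 < n"
      unfolding orbit_altdef[of \<sigma> "rep (orbit \<sigma> x)"] mem_Collect_eq .
    then show ?thesis by (elim exE conjE) (rule exI, rule sym)
  qed
  then obtain t where t: "(\<sigma> ^^ t x) (rep (orbit \<sigma> x)) = x" for x by metis
  have inj: "inj_on (\<lambda>y. restrict (\<lambda>C. y (rep C)) R) (equivariant_maps \<sigma> x0 e u)"
  proof (rule inj_onI, rule ext)
    fix y y' x assume y: "y \<in> equivariant_maps \<sigma> x0 e u" "y' \<in> equivariant_maps \<sigma> x0 e u"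
      and eq: "restrict (\<lambda>C. y (rep C)) R = restrict (\<lambda>C. y' (rep C)) R"
    have "y (rep (orbit \<sigma> x)) = y' (rep (orbit \<sigma> x))"
    proof (cases "orbit \<sigma> x = C0")
      case True
      then show ?thesis using y by (simp add: rep_def equivariant_maps_def)
    next
      case False
      then have "orbit \<sigma> x \<in> R" by (simp add: R_def orbit_in_cycles_of)
      then show ?thesis using fun_cong[OF eq, of "orbit \<sigma> x"] by simp
    qed
    then show "y x = y' x"
      using equivariant_maps_funpow[OF y(1), of "t x" "rep (orbit \<sigma> x)"]
        equivariant_maps_funpow[OF y(2), of "t x" "rep (orbit \<sigma> x)"] by (simp add: t)
  qed
  have "(\<lambda>y. restrict (\<lambda>C. y (rep C)) R) ` equivariant_maps \<sigma> x0 e u = R \<rightarrow>\<^sub>E {..<e}"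
  proof (intro equalityI subsetI)
    fix a assume "a \<in> (\<lambda>y. restrict (\<lambda>C. y (rep C)) R) ` equivariant_maps \<sigma> x0 e u"
    then show "a \<in> R \<rightarrow>\<^sub>E {..<e}" by (auto simp: equivariant_maps_def)
  next
    fix a assume a: "a \<in> R \<rightarrow>\<^sub>E {..<e}"
    define b where "b = a(C0 := 0)"
    define y where "y = (\<lambda>x. (b (orbit \<sigma> x) + t x * u) mod e)"
    have y_eq: "y ((\<sigma> ^^ s) (rep (orbit \<sigma> x))) = (b (orbit \<sigma> x) + s * u) mod e" for s x
    proof -
      let ?z = "(\<sigma> ^^ s) (rep (orbit \<sigma> x))"
      have o: "orbit \<sigma> ?z = orbit \<sigma> x" by (simp only: orbit_funpow rep_orbit)
      have "(\<sigma> ^^ t ?z) (rep (orbit \<sigma> x)) = (\<sigma> ^^ s) (rep (orbit \<sigma> x))"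
        using t[of ?z] unfolding o .
      then have "[t ?z = s] (mod card (orbit \<sigma> (rep (orbit \<sigma> x))))" by (rule funpow_eq_imp_cong[OF \<sigma>])
      then have "[t ?z = s] (mod e)"
        unfolding rep_orbit using bspec[OF dvd orbit_in_cycles_of] by (rule cong_dvd_modulus_nat)
      then have "[b (orbit \<sigma> x) + t ?z * u = b (orbit \<sigma> x) + s * u] (mod e)"
        by (intro cong_add cong_scalar_right) auto
      then show ?thesis unfolding y_def o by (simp add: cong_def)
    qed
    have "y (\<sigma> x) = (y x + u) mod e" for x
    proof -
      have "(\<sigma> ^^ Suc (t x)) (rep (orbit \<sigma> x)) = \<sigma> x" using t[of x] by simp
      then have "y (\<sigma> x) = (b (orbit \<sigma> x) + Suc (t x) * u) mod e" using y_eq[of "Suc (t x)" x] by metis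
      then show ?thesis by (simp add: y_def mod_simps algebra_simps)
    qed
    moreover have y_rep: "y (rep C) = b C" if CR: "C \<in> cycles_of \<sigma>" for C
    proof -
      obtain x where C: "C = orbit \<sigma> x" using CR by (auto simp: cycles_of_def)
      have "b C < e"
      proof (cases "C = C0")
        case True then show ?thesis using e_pos by (simp add: b_def)
      next
        case False
        then have "C \<in> R" using CR by (simp add: R_def)
        then show ?thesis using PiE_mem[OF a] False by (simp add: b_def)
      qed
      then show ?thesis using y_eq[of 0 x] unfolding C by simp
    qed
    moreover have "y x0 = 0"
      using y_rep[of C0] by (simp add: C0_def orbit_in_cycles_of rep_def b_def)
    ultimately have "y \<in> equivariant_maps \<sigma> x0 e u"
      using e_pos by (simp add: equivariant_maps_def y_def)
    moreover have "a = restrict (\<lambda>C. y (rep C)) R"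
    proof (rule PiE_ext[OF a])
      show "restrict (\<lambda>C. y (rep C)) R \<in> R \<rightarrow>\<^sub>E {..<e}" using e_pos by (auto simp: y_def)
      show "a C = restrict (\<lambda>C. y (rep C)) R C" if "C \<in> R" for C
        using that y_rep[of C] by (simp add: R_def b_def)
    qed
    ultimately show "a \<in> (\<lambda>y. restrict (\<lambda>C. y (rep C)) R) ` equivariant_maps \<sigma> x0 e u" by blast
  qed
  then have "card (equivariant_maps \<sigma> x0 e u) = card (R \<rightarrow>\<^sub>E {..<e})"
    using card_image[OF inj] by simp
  also have "\<dots> = e ^ card R" by (simp add: card_funcsetE)
  also have "card R = card (cycles_of \<sigma>) - 1"
    unfolding R_def C0_def by (simp add: orbit_in_cycles_of)
  finally show ?thesis .
qed

lemma cycle_list_nth: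
  assumes "bs \<in> cycle_lists \<sigma> k x0 e"
  shows "C \<in> cycles_of \<sigma> \<Longrightarrow> \<exists>!i. i < length bs \<and> C \<in> fst (bs ! i)"
    and "i < length bs \<Longrightarrow> fst (bs ! i) \<subseteq> cycles_of \<sigma>"
    and "i < length bs \<Longrightarrow> 0 < snd (bs ! i) \<and> snd (bs ! i) * e < (\<Sum>C\<in>fst (bs ! i). card C)"
    and "e * (\<Sum>i<length bs. snd (bs ! i)) = k"
    and "0 < length bs" and "orbit \<sigma> x0 \<in> fst (bs ! 0)"
proof -
  have "distinct (map fst bs) \<and> partition_on (cycles_of \<sigma>) (set (map fst bs))"
    using assms by (simp add: cycle_lists_def)
  note * = list_partition_iff[THEN iffD1, OF this]
  show ex: "\<exists>!i. i < length bs \<and> C \<in> fst (bs ! i)" if "C \<in> cycles_of \<sigma>" for C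
    using *[THEN conjunct2] that by (rule bspec)
  show "i < length bs \<Longrightarrow> fst (bs ! i) \<subseteq> cycles_of \<sigma>" using *[THEN conjunct1] by simp
  have all: "\<forall>b\<in>set bs. 0 < snd b \<and> snd b * e < (\<Sum>C\<in>fst b. card C)"
    using assms by (simp add: cycle_lists_def case_prod_unfold)
  show "i < length bs \<Longrightarrow> 0 < snd (bs ! i) \<and> snd (bs ! i) * e < (\<Sum>C\<in>fst (bs ! i). card C)"
    using bspec[OF all nth_mem] .
  show "e * (\<Sum>i<length bs. snd (bs ! i)) = k"
    using assms by (simp add: cycle_lists_def sum_list_sum_nth atLeast0LessThan)
  obtain i where "i < length bs" using ex[OF orbit_in_cycles_of] by blast
  then show "0 < length bs" by linarith
  then show "orbit \<sigma> x0 \<in> fst (bs ! 0)"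
    using assms by (simp add: cycle_lists_def hd_conv_nth)
qed

lemma lift_list_nth:
  "m < e * length bs \<Longrightarrow> lift_list \<sigma> e y bs ! m =
    ({x. y x = m div length bs \<and> orbit \<sigma> x \<in> fst (bs ! (m mod length bs))}, snd (bs ! (m mod length bs)))"
  by (simp add: lift_list_def)

lemma length_lift_list: "length (lift_list \<sigma> e y bs) = e * length bs"
  by (simp add: lift_list_def)

text \<open>
  Applying \<open>\<sigma>\<close> keeps the cycle and adds \<open>u\<close> to the coordinate, so it moves every block forward by \<open>u\<close>
  copies of \<open>bs\<close>.  The block sizes are fibre sizes, hence the size conditions on the cover and on \<open>bs\<close>
  are equivalent.
\<close>

lemma lift_list_in_rotation_lists:
  assumes y: "y \<in> equivariant_maps \<sigma> x0 e u" and bs: "bs \<in> cycle_lists \<sigma> k x0 e"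
  shows "lift_list \<sigma> e y bs \<in> rotation_lists \<sigma> k x0 e u"
proof -
  define ds where "ds = lift_list \<sigma> e y bs"
  define d where "d = length bs"
  note bsD = cycle_list_nth[OF bs, folded d_def]
  have d: "0 < d" using bsD(5) .
  have len: "length ds = e * d" unfolding ds_def d_def by (rule length_lift_list)
  have nth: "ds ! m = ({x. y x = m div d \<and> orbit \<sigma> x \<in> fst (bs ! (m mod d))}, snd (bs ! (m mod d)))"
    if "m < e * d" for m
    unfolding ds_def d_def by (rule lift_list_nth) (use that in \<open>simp add: d_def\<close>)
  have div_less: "m div d < e" if "m < e * d" for m using that by (simp add: less_mult_imp_div_less)
  have card_fst: "e * card (fst (ds ! m)) = (\<Sum>C\<in>fst (bs ! (m mod d)). card C)" if "m < e * d" for m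
    unfolding nth[OF that] fst_conv
    by (rule card_equivariant_fibre[OF y]) (use bsD(2) d div_less[OF that] in auto)
  have card_gt: "snd (ds ! m) < card (fst (ds ! m))" if "m < e * d" for m
  proof -
    have "e * snd (ds ! m) < e * card (fst (ds ! m))"
      unfolding card_fst[OF that] using bsD(3)[of "m mod d"] d nth[OF that] by (simp add: mult.commute)
    then show ?thesis by simp
  qed
  have "distinct (map fst ds) \<and> partition_on UNIV (set (map fst ds))"
    unfolding list_partition_iff len
  proof (intro conjI allI impI ballI)
    fix m assume "m < e * d"
    then have "0 < card (fst (ds ! m))" using card_gt by (metis gr0I less_nat_zero_code)
    then show "fst (ds ! m) \<noteq> {}" by auto
  next
    fix x
    obtain i where i: "i < d" "orbit \<sigma> x \<in> fst (bs ! i)"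
      and uniq: "\<And>j. j < d \<Longrightarrow> orbit \<sigma> x \<in> fst (bs ! j) \<Longrightarrow> j = i"
      using bsD(1)[OF orbit_in_cycles_of, of x] by (elim ex1E) metis
    have yx: "y x < e" using y by (simp add: equivariant_maps_def)
    show "\<exists>!m. m < e * d \<and> x \<in> fst (ds ! m)"
    proof (rule ex1I)
      have "y x * d + i < Suc (y x) * d" using i(1) by simp
      also have "\<dots> \<le> e * d" using yx by (intro mult_le_mono1) simp
      finally have lt: "y x * d + i < e * d" .
      then show "y x * d + i < e * d \<and> x \<in> fst (ds ! (y x * d + i))"
        using nth[OF lt] i d by simp
      fix m assume m: "m < e * d \<and> x \<in> fst (ds ! m)"
      then have "y x = m div d" "m mod d = i"
        using nth[of m] uniq[of "m mod d"] d by auto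
      then show "m = y x * d + i" by (metis div_mult_mod_eq)
    qed
  qed simp
  moreover have "\<forall>l\<in>set (map snd ds). 0 < l"
  proof
    fix l assume "l \<in> set (map snd ds)"
    then obtain m where "m < e * d" "l = snd (ds ! m)" using len by (metis in_set_conv_nth length_map nth_map)
    then show "0 < l" using bsD(3)[of "m mod d"] d nth[of m] by simp
  qed
  moreover have "sum_list (map snd ds) = k"
  proof -
    have "sum_list (map snd ds) = (\<Sum>m<e * d. snd (ds ! m))"
      by (simp add: sum_list_sum_nth atLeast0LessThan len)
    also have "\<dots> = (\<Sum>m<e * d. snd (bs ! (m mod d)))" by (intro sum.cong refl) (simp add: nth)
    also have "\<dots> = k" using bsD(4) by (simp add: sum_mod_block[of "\<lambda>i. snd (bs ! i)"])
    finally show ?thesis .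
  qed
  ultimately have "ds \<in> decorated_lists k" by (simp add: decorated_lists_def)
  moreover have "\<forall>(L, l)\<in>set ds. l < card L"
  proof
    fix b assume "b \<in> set ds"
    then obtain m where "m < e * d" "b = ds ! m" using len by (metis in_set_conv_nth)
    then show "case b of (L, l) \<Rightarrow> l < card L" using card_gt by (simp add: case_prod_unfold)
  qed
  moreover have "x0 \<in> fst (hd ds)"
  proof -
    have "0 < e * d" using e_pos d by simp
    then show ?thesis using nth[of 0] bsD(6) y len
      by (subst hd_conv_nth) (auto simp: equivariant_maps_def)
  qed
  moreover have "map (move_block \<sigma>) ds = rotate (u * d) ds"
  proof (rule nth_equalityI)
    fix m assume "m < length (map (move_block \<sigma>) ds)"
    then have m: "m < e * d" using len by simp
    let ?m = "(m + u * d) mod (e * d)"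
    have m': "?m < e * d" using m by (intro mod_less_divisor) linarith
    have "\<sigma> ` {x. y x = m div d \<and> orbit \<sigma> x \<in> fst (bs ! (m mod d))} =
       {x. y x = (m div d + u) mod e \<and> orbit \<sigma> x \<in> fst (bs ! (m mod d))}"
    proof (intro equalityI subsetI)
      fix x assume "x \<in> \<sigma> ` {x. y x = m div d \<and> orbit \<sigma> x \<in> fst (bs ! (m mod d))}"
      then obtain z where "x = \<sigma> z" "y z = m div d" "orbit \<sigma> z \<in> fst (bs ! (m mod d))" by blast
      then show "x \<in> {x. y x = (m div d + u) mod e \<and> orbit \<sigma> x \<in> fst (bs ! (m mod d))}"
        using y orbit_apply[OF \<sigma>, of z] by (simp add: equivariant_maps_def)
    next
      fix x assume x: "x \<in> {x. y x = (m div d + u) mod e \<and> orbit \<sigma> x \<in> fst (bs ! (m mod d))}"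
      obtain z where z: "x = \<sigma> z" using permutes_surj[OF \<sigma>] by (metis surjD)
      have "[y z + u = m div d + u] (mod e)"
        using x y unfolding z by (simp add: equivariant_maps_def cong_def)
      then have "[y z = m div d] (mod e)" by (simp only: cong_add_rcancel_nat)
      moreover have "y z < e" "m div d < e" using y div_less[OF m] by (simp_all add: equivariant_maps_def)
      ultimately have "y z = m div d" by (simp add: cong_def)
      moreover have "orbit \<sigma> z \<in> fst (bs ! (m mod d))"
        using x orbit_apply[OF \<sigma>, of z] unfolding z by simp
      ultimately show "x \<in> \<sigma> ` {x. y x = m div d \<and> orbit \<sigma> x \<in> fst (bs ! (m mod d))}"
        unfolding z by blast
    qed
    then have "move_block \<sigma> (ds ! m) = ds ! ?m"
      unfolding move_block_def nth[OF m] nth[OF m'] add_mult_div_mod[OF m] by simp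
    then show "map (move_block \<sigma>) ds ! m = rotate (u * d) ds ! m"
      using nth_rotate[of m ds "u * d"] m len by (simp add: add.commute)
  qed simp
  ultimately show ?thesis
    unfolding ds_def[symmetric] rotation_lists_def pointed_lists_def using len e_pos by simp
qed

text \<open>
  Let \<open>d\<close> be the length divided by \<open>e\<close>.  Since \<open>\<sigma>\<close> shifts positions by \<open>u * d\<close>, the position of a point
  modulo \<open>d\<close> depends only on its cycle and yields the short list, while the quotient of the position by
  \<open>d\<close> is the required coordinate.
\<close>

lemma rotation_list_is_lift:
  assumes ds: "ds \<in> rotation_lists \<sigma> k x0 e u"
  shows "\<exists>y\<in>equivariant_maps \<sigma> x0 e u. \<exists>bs\<in>cycle_lists \<sigma> k x0 e. ds = lift_list \<sigma> e y bs"
proof -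
  define d where "d = length ds div e"
  have dsA: "ds \<in> decorated_lists k" using ds by (simp add: rotation_lists_def pointed_lists_def)
  have len: "length ds = e * d" using ds by (simp add: rotation_lists_def d_def)
  have p: "0 < e * d" using decorated_list_not_Nil[OF dsA] by (simp add: len[symmetric] del: nat_0_less_mult_iff)
  then have d: "0 < d" by simp
  have mv: "move_block \<sigma> (ds ! m) = ds ! ((m + u * d) mod (e * d))" if "m < e * d" for m
  proof -
    have "map (move_block \<sigma>) ds ! m = rotate (u * d) ds ! m"
      using ds by (simp add: rotation_lists_def d_def)
    then show ?thesis using nth_rotate[of m ds "u * d"] that len by (simp add: add.commute)
  qed
  have uniq: "i = j" if "i < e * d" "j < e * d" "x \<in> fst (ds ! i)" "x \<in> fst (ds ! j)" for i j x
    using decorated_list_nth_unique[OF dsA, of i j x] that len by simp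
  have "\<exists>i. i < e * d \<and> x \<in> fst (ds ! i)" for x
    using ex1_implies_ex[OF decorated_list_nth(1)[OF dsA, of x]] unfolding len .
  then obtain pos where pos: "pos x < e * d" "x \<in> fst (ds ! pos x)" for x by metis
  have mem_iff: "x \<in> fst (ds ! m) \<longleftrightarrow> pos x = m" if "m < e * d" for x m
    using uniq[OF pos(1) that pos(2), of x] pos(2)[of x] by auto
  have pos_step: "pos (\<sigma> x) = (pos x + u * d) mod (e * d)" for x
  proof (rule uniq[OF pos(1) _ pos(2)])
    show "(pos x + u * d) mod (e * d) < e * d" using p by simp
    show "\<sigma> x \<in> fst (ds ! ((pos x + u * d) mod (e * d)))"
      unfolding mv[OF pos(1), symmetric] move_block_def using pos(2)[of x] by simp
  qed
  define y where "y = (\<lambda>x. pos x div d)"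
  define q where "q = (\<lambda>x. pos x mod d)"
  have pos_eq: "pos x = y x * d + q x" for x by (simp add: y_def q_def)
  have "x0 \<in> fst (ds ! 0)"
    using ds decorated_list_not_Nil[OF dsA] by (simp add: rotation_lists_def pointed_lists_def hd_conv_nth)
  then have "pos x0 = 0" using mem_iff[OF p] by simp
  then have y: "y \<in> equivariant_maps \<sigma> x0 e u"
    using pos(1) by (simp add: equivariant_maps_def y_def less_mult_imp_div_less pos_step add_mult_div_mod(1))
  have q_step: "q (\<sigma> x) = q x" for x
    unfolding q_def pos_step by (rule add_mult_div_mod(2)[OF pos(1)])
  have q_orbit: "q x = q z" if "orbit \<sigma> x = orbit \<sigma> z" for x z
    by (rule invariant_on_orbit[where f = q, OF q_step]) (simp add: orbit_mem_iff[OF \<sigma>] that)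
  have orbit_iff: "orbit \<sigma> x \<in> orbit \<sigma> ` fst (ds ! i) \<longleftrightarrow> q x = i" if "i < d" for x i
  proof -
    have i: "i < e * d" using that e_pos by (metis One_nat_def Suc_leI mult_le_mono1 nat_mult_1 order_less_le_trans)
    show ?thesis
    proof
      assume "orbit \<sigma> x \<in> orbit \<sigma> ` fst (ds ! i)"
      then obtain z where z: "orbit \<sigma> x = orbit \<sigma> z" "z \<in> fst (ds ! i)" by blast
      then have "q z = i" using mem_iff[OF i, of z] that by (simp add: q_def)
      then show "q x = i" using q_orbit[OF z(1)] by simp
    next
      assume "q x = i"
      obtain t where "[y x + t * u = 0] (mod e)" using exists_multiple_cong[OF cop e_pos] by blast
      then have "y ((\<sigma> ^^ t) x) = 0"
        using equivariant_maps_funpow[OF y, of t x] by (simp add: cong_def)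
      moreover have "q ((\<sigma> ^^ t) x) = i" using q_orbit[OF orbit_funpow] \<open>q x = i\<close> by simp
      ultimately have "(\<sigma> ^^ t) x \<in> fst (ds ! i)" using mem_iff[OF i] pos_eq by simp
      then show "orbit \<sigma> x \<in> orbit \<sigma> ` fst (ds ! i)" using orbit_funpow[of t x] by (metis imageI)
    qed
  qed
  have snd_funpow: "snd (ds ! ((m + t * u * d) mod (e * d))) = snd (ds ! m)" if "m < e * d" for m t
  proof (induction t)
    case 0
    then show ?case using that by simp
  next
    case (Suc t)
    let ?m = "(m + t * u * d) mod (e * d)"
    have "(m + Suc t * u * d) mod (e * d) = (?m + u * d) mod (e * d)"
      by (simp add: mod_simps algebra_simps)
    then have "snd (ds ! ((m + Suc t * u * d) mod (e * d))) = snd (move_block \<sigma> (ds ! ?m))"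
      using mv[of ?m] p by simp
    then show ?case using Suc by (simp add: move_block_def)
  qed
  \<comment> \<open>The decorations have period \<open>u * d\<close>, and \<open>u\<close> is invertible modulo \<open>e\<close>, so they have period \<open>d\<close>.\<close>
  have snd_mod: "snd (ds ! m) = snd (ds ! (m mod d))" if m: "m < e * d" for m
  proof -
    obtain t where t: "[m div d + t * u = 0] (mod e)" using exists_multiple_cong[OF cop e_pos] by blast
    let ?m = "(m + t * u * d) mod (e * d)"
    have "?m div d = 0" "?m mod d = m mod d"
      using add_mult_div_mod[OF m, of "t * u"] t by (simp_all add: cong_def)
    then have "?m = m mod d" by (metis add_0 div_mult_mod_eq mult_0)
    then show ?thesis using snd_funpow[OF m, of t] by simp
  qed
  define bs where "bs = map (\<lambda>i. (orbit \<sigma> ` fst (ds ! i), snd (ds ! i))) [0..<d]"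
  have bs_len: "length bs = d" by (simp add: bs_def)
  have bs_nth: "bs ! i = (orbit \<sigma> ` fst (ds ! i), snd (ds ! i))" if "i < d" for i
    using that by (simp add: bs_def)
  have fibre: "{x. y x = m div d \<and> orbit \<sigma> x \<in> fst (bs ! (m mod d))} = fst (ds ! m)" if m: "m < e * d" for m
  proof (rule set_eqI)
    fix x
    have "x \<in> {x. y x = m div d \<and> orbit \<sigma> x \<in> fst (bs ! (m mod d))} \<longleftrightarrow> y x = m div d \<and> q x = m mod d"
      using bs_nth[of "m mod d"] orbit_iff[of "m mod d" x] d by simp
    also have "\<dots> \<longleftrightarrow> pos x = m"
      unfolding y_def q_def by (metis div_mult_mod_eq)
    finally show "x \<in> {x. y x = m div d \<and> orbit \<sigma> x \<in> fst (bs ! (m mod d))} \<longleftrightarrow> x \<in> fst (ds ! m)"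
      unfolding mem_iff[OF m] .
  qed
  have lift: "ds = lift_list \<sigma> e y bs"
  proof (rule nth_equalityI)
    show "length ds = length (lift_list \<sigma> e y bs)" by (simp add: length_lift_list len bs_len)
    fix m assume "m < length ds"
    then have m: "m < e * d" using len by simp
    then show "ds ! m = lift_list \<sigma> e y bs ! m"
      using lift_list_nth[of m bs y] fibre[OF m] snd_mod[OF m] bs_nth[of "m mod d"] d
      by (simp add: bs_len prod_eq_iff)
  qed
  have small: "i < e * d" if "i < d" for i
    using that e_pos by (metis One_nat_def Suc_leI mult_le_mono1 nat_mult_1 order_less_le_trans)
  have part: "distinct (map fst bs) \<and> partition_on (cycles_of \<sigma>) (set (map fst bs))"
    unfolding list_partition_iff bs_len
  proof (intro conjI allI impI ballI)
    fix i assume i: "i < d"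
    show "fst (bs ! i) \<noteq> {}"
      using decorated_list_nth(2)[OF dsA, of i] len small[OF i] bs_nth[OF i] by simp
    show "fst (bs ! i) \<subseteq> cycles_of \<sigma>"
      unfolding bs_nth[OF i] fst_conv by (intro image_subsetI orbit_in_cycles_of)
  next
    fix C assume "C \<in> cycles_of \<sigma>"
    then obtain x where C: "C = orbit \<sigma> x" by (auto simp: cycles_of_def)
    have iff: "i < d \<and> C \<in> fst (bs ! i) \<longleftrightarrow> q x = i" for i
    proof (cases "i < d")
      case True
      then show ?thesis using orbit_iff[OF True, of x] unfolding bs_nth[OF True] C by simp
    next
      case False
      moreover have "q x < d" using d by (simp add: q_def)
      ultimately show ?thesis by auto
    qed
    then show "\<exists>!i. i < d \<and> C \<in> fst (bs ! i)" unfolding iff by auto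
  qed
  moreover have "\<forall>(M, l)\<in>set bs. 0 < l \<and> l * e < (\<Sum>C\<in>M. card C)"
  proof
    fix b assume "b \<in> set bs"
    then obtain i where i: "i < d" and b: "b = bs ! i" using bs_len by (metis in_set_conv_nth)
    have mem: "ds ! i \<in> set ds" using small[OF i] len by simp
    have "fst b \<subseteq> cycles_of \<sigma>" unfolding b bs_nth[OF i] fst_conv by (intro image_subsetI orbit_in_cycles_of)
    from card_equivariant_fibre[OF y this e_pos] have "e * card (fst (ds ! i)) = (\<Sum>C\<in>fst b. card C)"
      using fibre[OF small[OF i]] i b by simp
    moreover have "snd (ds ! i) < card (fst (ds ! i))"
      using ds mem by (auto simp: rotation_lists_def pointed_lists_def)
    ultimately have "snd b * e < (\<Sum>C\<in>fst b. card C)"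
      using e_pos b bs_nth[OF i] by (metis mult.commute nat_mult_less_cancel1 snd_conv)
    moreover have "0 < snd b" using dsA mem b bs_nth[OF i] by (auto simp: decorated_lists_def)
    ultimately show "case b of (M, l) \<Rightarrow> 0 < l \<and> l * e < (\<Sum>C\<in>M. card C)" by (simp add: case_prod_unfold)
  qed
  moreover have "e * sum_list (map snd bs) = k"
  proof -
    have "k = (\<Sum>m<e * d. snd (ds ! m))"
      using dsA by (simp add: decorated_lists_def sum_list_sum_nth atLeast0LessThan len)
    also have "\<dots> = (\<Sum>m<e * d. snd (ds ! (m mod d)))" by (intro sum.cong refl snd_mod) simp
    also have "\<dots> = e * (\<Sum>i<d. snd (ds ! i))" by (rule sum_mod_block)
    also have "(\<Sum>i<d. snd (ds ! i)) = sum_list (map snd bs)"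
      by (simp add: sum_list_sum_nth atLeast0LessThan bs_len bs_nth)
    finally show ?thesis by simp
  qed
  moreover have "orbit \<sigma> x0 \<in> fst (hd bs)"
  proof -
    have "bs \<noteq> []" using bs_len d by auto
    then show ?thesis using \<open>x0 \<in> fst (ds ! 0)\<close> bs_nth[OF d] by (simp add: hd_conv_nth)
  qed
  ultimately have "bs \<in> cycle_lists \<sigma> k x0 e" by (simp add: cycle_lists_def)
  with y lift show ?thesis by blast
qed

lemma lift_list_inj:
  assumes y: "y \<in> equivariant_maps \<sigma> x0 e u" "y' \<in> equivariant_maps \<sigma> x0 e u"
    and bs: "bs \<in> cycle_lists \<sigma> k x0 e" "bs' \<in> cycle_lists \<sigma> k x0 e"
    and eq: "lift_list \<sigma> e y bs = lift_list \<sigma> e y' bs'"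
  shows "y = y' \<and> bs = bs'"
proof -
  define d where "d = length bs"
  have d': "length bs' = d"
    using arg_cong[OF eq, of length] e_pos by (simp add: length_lift_list d_def)
  have d: "0 < d" using cycle_list_nth(5)[OF bs(1)] by (simp add: d_def)
  have small: "i < e * d" if "i < d" for i
    using that e_pos by (metis One_nat_def Suc_leI mult_le_mono1 nat_mult_1 order_less_le_trans)
  have fst_eq: "fst (cs ! i) = orbit \<sigma> ` fst (lift_list \<sigma> e z cs ! i)"
    if z: "z \<in> equivariant_maps \<sigma> x0 e u" and cs: "cs \<in> cycle_lists \<sigma> k x0 e" "length cs = d" and i: "i < d" for z cs i
  proof -
    have lift: "fst (lift_list \<sigma> e z cs ! i) = {x. z x = 0 \<and> orbit \<sigma> x \<in> fst (cs ! i)}"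
      using lift_list_nth[of i cs z] cs(2) small[OF i] i by simp
    show ?thesis unfolding lift
    proof (intro equalityI subsetI)
      fix C assume C: "C \<in> fst (cs ! i)"
      then have "C \<in> cycles_of \<sigma>" using cycle_list_nth(2)[OF cs(1), of i] cs(2) i by blast
      then have "e * card {x. z x = 0 \<and> orbit \<sigma> x \<in> {C}} = card C"
        using card_equivariant_fibre[OF z, of "{C}" 0] e_pos by simp
      then have "{x. z x = 0 \<and> orbit \<sigma> x \<in> {C}} \<noteq> {}"
        using card_cycle_pos[OF \<open>C \<in> cycles_of \<sigma>\<close>] by (metis card.empty less_numeral_extra(3) mult_0_right)
      then show "C \<in> orbit \<sigma> ` {x. z x = 0 \<and> orbit \<sigma> x \<in> fst (cs ! i)}" using C by blast
    qed blast
  qed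
  have "bs = bs'"
  proof (rule nth_equalityI)
    show "length bs = length bs'" by (simp add: d' d_def)
    fix i assume "i < length bs"
    then have i: "i < d" by (simp add: d_def)
    have "fst (bs ! i) = fst (bs' ! i)"
      using fst_eq[OF y(1) bs(1) d_def[symmetric] i] fst_eq[OF y(2) bs(2) d' i] eq by simp
    moreover have "snd (bs ! i) = snd (bs' ! i)"
      using arg_cong[OF eq, of "\<lambda>ds. snd (ds ! i)"] lift_list_nth[of i bs y] lift_list_nth[of i bs' y'] small[OF i] i
      by (simp add: d' d_def[symmetric])
    ultimately show "bs ! i = bs' ! i" by (rule prod_eqI)
  qed
  moreover have "y x = y' x" for x
  proof -
    obtain i where i: "i < d" "orbit \<sigma> x \<in> fst (bs ! i)"
      using ex1_implies_ex[OF cycle_list_nth(1)[OF bs(1) orbit_in_cycles_of, of x]] unfolding d_def[symmetric] by blast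
    let ?m = "y x * d + i"
    have "?m < Suc (y x) * d" using i(1) by simp
    also have "\<dots> \<le> e * d" using y(1) by (intro mult_le_mono1) (simp add: equivariant_maps_def Suc_le_eq)
    finally have lt: "?m < e * d" .
    have "x \<in> fst (lift_list \<sigma> e y bs ! ?m)"
      using lift_list_nth[of ?m bs y] lt i by (simp add: d_def[symmetric])
    then have "y' x = ?m div d"
      unfolding eq using lift_list_nth[of ?m bs' y'] lt by (simp add: d')
    then show ?thesis using i(1) by simp
  qed
  ultimately show ?thesis by blast
qed

lemma card_rotation_lists:
  "card (rotation_lists \<sigma> k x0 e u) = card (equivariant_maps \<sigma> x0 e u) * card (cycle_lists \<sigma> k x0 e)"
proof -
  let ?f = "\<lambda>(y, bs). lift_list \<sigma> e y bs"
  let ?S = "equivariant_maps \<sigma> x0 e u \<times> cycle_lists \<sigma> k x0 e"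
  have "inj_on ?f ?S"
  proof (rule inj_onI)
    fix a b assume ab: "a \<in> ?S" "b \<in> ?S" "?f a = ?f b"
    then show "a = b"
      using lift_list_inj[of "fst a" x0 "fst b" "snd a" k "snd b"] by (simp add: mem_Times_iff case_prod_unfold prod_eq_iff)
  qed
  moreover have "?f ` ?S = rotation_lists \<sigma> k x0 e u"
  proof (intro equalityI subsetI)
    fix ds assume "ds \<in> ?f ` ?S"
    then obtain y bs where "y \<in> equivariant_maps \<sigma> x0 e u" "bs \<in> cycle_lists \<sigma> k x0 e" "ds = lift_list \<sigma> e y bs"
      by (elim imageE SigmaE) simp
    then show "ds \<in> rotation_lists \<sigma> k x0 e u" using lift_list_in_rotation_lists by simp
  next
    fix ds assume "ds \<in> rotation_lists \<sigma> k x0 e u"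
    from rotation_list_is_lift[OF this] show "ds \<in> ?f ` ?S" by force
  qed
  ultimately have "card (rotation_lists \<sigma> k x0 e u) = card ?S" by (metis card_image)
  then show ?thesis by (simp add: card_cartesian_product)
qed

end

unbundle no vec_syntax
unbundle fps_syntax

section \<open>Counting weighted hypersimplicial lists\<close>

text \<open>
  The series \<open>\<Sum>m. X^m * P m\<close>.  It converges for arbitrary coefficients \<open>P m\<close>, because only the terms with
  \<open>m \<le> K\<close> contribute to the \<open>K\<close>-th coefficient.
\<close>

definition fps_powsum :: "(nat \<Rightarrow> 'a::comm_ring_1 fps) \<Rightarrow> 'a fps" where
  "fps_powsum P = Abs_fps (\<lambda>K. \<Sum>m\<le>K. P m $ (K - m))"

lemma fps_powsum_nth: "fps_powsum P $ K = (\<Sum>m\<le>K. P m $ (K - m))"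
  by (simp add: fps_powsum_def)

lemma fps_powsum_truncate:
  assumes "j \<le> N"
  shows "fps_powsum P $ j = (\<Sum>m\<le>N. fps_X ^ m * P m) $ j"
proof -
  have "(\<Sum>m\<le>N. fps_X ^ m * P m) $ j = (\<Sum>m\<le>N. if m \<le> j then P m $ (j - m) else 0)"
    unfolding fps_sum_nth by (intro sum.cong refl) (simp add: fps_X_power_mult_nth not_less)
  also have "\<dots> = (\<Sum>m\<le>j. P m $ (j - m))"
    using assms by (intro sum.mono_neutral_cong_right) auto
  finally show ?thesis by (simp add: fps_powsum_nth)
qed

lemma fps_powsum_sum: "fps_powsum (\<lambda>m. \<Sum>i\<in>A. P i m) = (\<Sum>i\<in>A. fps_powsum (P i))"
  by (rule fps_ext) (simp add: fps_powsum_nth fps_sum_nth sum.swap[of _ A])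

lemma fps_powsum_mult: "fps_powsum (\<lambda>m. Q * P m) = Q * fps_powsum P"
proof (rule fps_ext)
  fix K
  have "fps_powsum (\<lambda>m. Q * P m) $ K = (Q * (\<Sum>m\<le>K. fps_X ^ m * P m)) $ K"
    by (subst fps_powsum_truncate[OF order_refl]) (simp add: sum_distrib_left mult_ac)
  also have "\<dots> = (Q * fps_powsum P) $ K"
    unfolding fps_mult_nth by (intro sum.cong refl arg_cong2[of _ _ _ _ "(*)"] fps_powsum_truncate[symmetric]) auto
  finally show "fps_powsum (\<lambda>m. Q * P m) $ K = (Q * fps_powsum P) $ K" .
qed

lemma fps_powsum_shift: "fps_powsum P = P 0 + fps_X * fps_powsum (\<lambda>m. P (Suc m))"
proof (rule fps_ext)
  fix K
  show "fps_powsum P $ K = (P 0 + fps_X * fps_powsum (\<lambda>m. P (Suc m))) $ K"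
    by (cases K) (simp_all add: fps_powsum_nth sum.atMost_Suc_shift del: sum.atMost_Suc)
qed

text \<open>
  The hypersimplicial lists on a set with weights; for cycles, the weights account for the number of
  points in each cycle.
\<close>

definition block_lists :: "'a set \<Rightarrow> ('a \<Rightarrow> nat) \<Rightarrow> nat \<Rightarrow> ('a set \<times> nat) list set" where
  "block_lists R w K = {bs. distinct (map fst bs) \<and> partition_on R (set (map fst bs)) \<and>
     (\<forall>(L, l)\<in>set bs. 0 < l \<and> l < sum w L) \<and> sum_list (map snd bs) = K}"

lemma finite_decorated_partitions:
  fixes K :: nat
  assumes "finite R"
  shows "finite {bs. distinct (map fst bs) \<and> partition_on R (set (map fst bs)) \<and> sum_list (map snd bs) = K}"
    (is "finite ?B")
proof (rule finite_subset)
  show "?B \<subseteq> {bs. set bs \<subseteq> Pow R \<times> {..K} \<and> length bs \<le> card (Pow R)}"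
  proof safe
    fix bs L l assume bs: "distinct (map fst bs)" "partition_on R (set (map fst bs))" "K = sum_list (map snd bs)"
    have sub: "set (map fst bs) \<subseteq> Pow R" using bs(2) by (auto simp: partition_on_def)
    show "length bs \<le> card (Pow R)"
      using card_mono[OF _ sub] assms distinct_card[OF bs(1)] by simp
    assume mem: "(L, l) \<in> set bs"
    show "x \<in> R" if "x \<in> L" for x using sub mem that by force
    show "l \<le> sum_list (map snd bs)"
      using mem by (intro member_le_sum_list) force+
  qed
  show "finite {bs. set bs \<subseteq> Pow R \<times> {..K} \<and> length bs \<le> card (Pow R)}"
    using assms by (intro finite_lists_length_le) auto
qed

lemma finite_block_lists:
  assumes "finite R"
  shows "finite (block_lists R w K)"
  by (rule finite_subset[OF _ finite_decorated_partitions[OF assms, of K]]) (auto simp: block_lists_def)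

lemma block_lists_empty: "block_lists {} w K = (if K = 0 then {[]} else {})"
  by (auto simp: block_lists_def partition_on_empty)

lemma Cons_in_block_lists_iff:
  "(L, l) # bs \<in> block_lists R w K \<longleftrightarrow>
     L \<noteq> {} \<and> L \<subseteq> R \<and> 0 < l \<and> l < sum w L \<and> l \<le> K \<and> bs \<in> block_lists (R - L) w (K - l)"
proof (cases "L \<noteq> {} \<and> L \<inter> \<Union>(set (map fst bs)) = {}")
  case True
  then have "L \<notin> set (map fst bs)" by auto
  with True show ?thesis
    by (auto simp: block_lists_def partition_on_insert disjnt_def)
next
  case False
  have "(L, l) # bs \<notin> block_lists R w K"
  proof
    assume *: "(L, l) # bs \<in> block_lists R w K"
    then have "disjoint (insert L (set (map fst bs)))" "L \<noteq> {}" "L \<notin> set (map fst bs)"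
      by (auto simp: block_lists_def partition_on_def)
    then have "L \<inter> M = {}" if "M \<in> set (map fst bs)" for M
      using that unfolding disjoint_def by (metis insertCI)
    with False \<open>L \<noteq> {}\<close> show False by blast
  qed
  moreover have "bs \<notin> block_lists (R - L) w (K - l)" if "L \<noteq> {}"
    using False that by (auto simp: block_lists_def partition_on_def)
  ultimately show ?thesis by blast
qed

definition block_lists_gf :: "('a \<Rightarrow> nat) \<Rightarrow> 'a set \<Rightarrow> int fps" where
  "block_lists_gf w R = Abs_fps (\<lambda>K. int (card (block_lists R w K)))"

text \<open>
  The generating function of the admissible decorations of a block of weight \<open>a\<close>.
\<close>

definition decoration_gf :: "nat \<Rightarrow> int fps" where
  "decoration_gf a = (\<Sum>l\<in>{0<..<a}. fps_X ^ l)"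

lemma decoration_gf_times: "a > 0 \<Longrightarrow> (1 - fps_X) * decoration_gf a = fps_X - fps_X ^ a"
proof (induction a rule: nat_induct_non_zero)
  case 1 then show ?case by (simp add: decoration_gf_def)
next
  case (Suc a)
  have "{0<..<Suc a} = insert a {0<..<a}" using Suc by auto
  then have "decoration_gf (Suc a) = fps_X ^ a + decoration_gf a"
    by (simp add: decoration_gf_def)
  then have "(1 - fps_X) * decoration_gf (Suc a) = (1 - fps_X) * fps_X ^ a + (1 - fps_X) * decoration_gf a"
    by (simp only: distrib_left)
  then show ?case unfolding Suc.IH by (simp add: left_diff_distrib)
qed

text \<open>
  Splitting off the first block leaves an arbitrary list on the remaining elements.
\<close>

lemma card_block_lists_head:
  assumes "finite R" and F: "\<And>L. L \<in> F \<Longrightarrow> L \<noteq> {} \<and> L \<subseteq> R"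
  shows "int (card {bs \<in> block_lists R w K. bs \<noteq> [] \<and> fst (hd bs) \<in> F}) =
         (\<Sum>L\<in>F. decoration_gf (sum w L) * block_lists_gf w (R - L)) $ K"
proof -
  define T where "T = (SIGMA L:F. SIGMA l:{l. 0 < l \<and> l < sum w L \<and> l \<le> K}. block_lists (R - L) w (K - l))"
  have finF: "finite F" using assms by (intro finite_subset[of F "Pow R"]) auto
  have finT: "finite {l. 0 < l \<and> l < sum w L \<and> l \<le> K}" for L by simp
  have "bij_betw (\<lambda>(L, l, bs). (L, l) # bs) T {bs \<in> block_lists R w K. bs \<noteq> [] \<and> fst (hd bs) \<in> F}"
  proof (rule bij_betw_imageI)
    show "inj_on (\<lambda>(L, l, bs). (L, l) # bs) T" by (auto simp: inj_on_def)
    show "(\<lambda>(L, l, bs). (L, l) # bs) ` T = {bs \<in> block_lists R w K. bs \<noteq> [] \<and> fst (hd bs) \<in> F}"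
    proof safe
      fix bs assume "bs \<in> block_lists R w K" "bs \<noteq> []" "fst (hd bs) \<in> F"
      then obtain L l cs where "bs = (L, l) # cs" by (cases bs) auto
      with \<open>bs \<in> _\<close> \<open>fst (hd bs) \<in> F\<close> show "bs \<in> (\<lambda>(L, l, bs). (L, l) # bs) ` T"
        by (intro image_eqI[of _ _ "(L, l, cs)"]) (auto simp: T_def Cons_in_block_lists_iff)
    qed (use F in \<open>auto simp: T_def Cons_in_block_lists_iff\<close>)
  qed
  then have "card {bs \<in> block_lists R w K. bs \<noteq> [] \<and> fst (hd bs) \<in> F} = card T"
    by (rule bij_betw_same_card[symmetric])
  also have "\<dots> = (\<Sum>L\<in>F. \<Sum>l | 0 < l \<and> l < sum w L \<and> l \<le> K. card (block_lists (R - L) w (K - l)))"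
  proof -
    have fin: "finite (block_lists (R - L) w j)" for L j
      using assms(1) by (simp add: finite_block_lists)
    show ?thesis
      unfolding T_def
      by (subst card_SigmaI, rule finF, blast intro: finite_SigmaI finT fin)
         (intro sum.cong refl card_SigmaI finT ballI fin)
  qed
  also have "int \<dots> = (\<Sum>L\<in>F. (decoration_gf (sum w L) * block_lists_gf w (R - L)) $ K)"
    unfolding of_nat_sum
  proof (rule sum.cong[OF refl])
    fix L assume "L \<in> F"
    have "(decoration_gf (sum w L) * block_lists_gf w (R - L)) $ K =
          (\<Sum>l\<in>{0<..<sum w L}. if l \<le> K then int (card (block_lists (R - L) w (K - l))) else 0)"
      unfolding decoration_gf_def sum_distrib_right fps_sum_nth
      by (intro sum.cong refl) (simp add: fps_X_power_mult_nth not_less block_lists_gf_def)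
    also have "\<dots> = (\<Sum>l | 0 < l \<and> l < sum w L \<and> l \<le> K. int (card (block_lists (R - L) w (K - l))))"
      by (intro sum.mono_neutral_cong_right) auto
    finally show "(\<Sum>l | 0 < l \<and> l < sum w L \<and> l \<le> K. int (card (block_lists (R - L) w (K - l)))) =
       (decoration_gf (sum w L) * block_lists_gf w (R - L)) $ K" by simp
  qed
  finally show ?thesis by (simp add: fps_sum_nth)
qed

text \<open>
  The decorations of a non-empty block \<open>L\<close> have the generating function \<open>(X - X^w(L)) / (1 - X)\<close>.  Convolution over
  subsets makes functions of finite sets into an algebra, in which \<open>E = (L \<mapsto> 1)\<close> and \<open>W = (L \<mapsto> X^w(L))\<close> are
  exponentials.  The lists of blocks form a geometric series with the value \<open>(1 - X) / (W - X E)\<close>, which is \<open>1 - X\<close>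
  times the sum of \<open>X^m E^m W^(-m-1)\<close>.  Products of powers of exponentials are products over the elements
  of the set; this gives the expression below for the value of the sum at \<open>R\<close>.
\<close>

definition block_kernel :: "('a \<Rightarrow> nat) \<Rightarrow> 'a set \<Rightarrow> int fps" where
  "block_kernel w R = fps_powsum (\<lambda>m. \<Prod>i\<in>R. of_nat m - of_nat (Suc m) * fps_X ^ w i)"

lemma sum_Pow_times_block_kernel:
  assumes "finite R"
  shows "(\<Sum>L\<in>Pow R. (\<Prod>i\<in>L. f i) * block_kernel w (R - L)) =
    fps_powsum (\<lambda>m. \<Prod>i\<in>R. f i + (of_nat m - of_nat (Suc m) * fps_X ^ w i))"
proof -
  have "(\<Sum>L\<in>Pow R. (\<Prod>i\<in>L. f i) * block_kernel w (R - L)) =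
     fps_powsum (\<lambda>m. \<Sum>L\<in>Pow R. (\<Prod>i\<in>L. f i) * (\<Prod>i\<in>R - L. of_nat m - of_nat (Suc m) * fps_X ^ w i))"
    by (simp add: fps_powsum_sum fps_powsum_mult block_kernel_def del: of_nat_Suc)
  then show ?thesis by (simp add: prod_add[OF assms] del: of_nat_Suc)
qed

text \<open>
  The first one is multiplication by \<open>W\<close>, the second one multiplication by \<open>E\<close>.
\<close>

lemma block_kernel_with_powers:
  assumes "finite R"
  shows "(\<Sum>L\<in>Pow R. fps_X ^ sum w L * block_kernel w (R - L)) =
    (\<Prod>i\<in>R. 1 - fps_X ^ w i) * fps_powsum (\<lambda>m. of_nat m ^ card R)"
    and "(\<Sum>L\<in>Pow R. block_kernel w (R - L)) =
    (\<Prod>i\<in>R. 1 - fps_X ^ w i) * fps_powsum (\<lambda>m. of_nat (Suc m) ^ card R)"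
proof -
  have "(\<Prod>i\<in>R. fps_X ^ w i + (of_nat m - of_nat (Suc m) * fps_X ^ w i)) =
      (\<Prod>i\<in>R. 1 - fps_X ^ w i) * (of_nat m ^ card R :: int fps)" for m
  proof -
    have "(\<Prod>i\<in>R. fps_X ^ w i + (of_nat m - of_nat (Suc m) * fps_X ^ w i)) =
       (\<Prod>i\<in>R. (1 - fps_X ^ w i) * (of_nat m :: int fps))"
      by (intro prod.cong refl) (simp add: algebra_simps)
    then show ?thesis by (simp add: prod.distrib)
  qed
  then show "(\<Sum>L\<in>Pow R. fps_X ^ sum w L * block_kernel w (R - L)) =
    (\<Prod>i\<in>R. 1 - fps_X ^ w i) * fps_powsum (\<lambda>m. of_nat m ^ card R)"
    using sum_Pow_times_block_kernel[OF assms, of "\<lambda>i. fps_X ^ w i" w]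
    by (simp add: power_sum fps_powsum_mult del: of_nat_Suc)
next
  have "(\<Prod>i\<in>R. 1 + (of_nat m - of_nat (Suc m) * fps_X ^ w i)) =
      (\<Prod>i\<in>R. 1 - fps_X ^ w i) * (of_nat (Suc m) ^ card R :: int fps)" for m
  proof -
    have "(\<Prod>i\<in>R. 1 + (of_nat m - of_nat (Suc m) * fps_X ^ w i)) =
       (\<Prod>i\<in>R. (1 - fps_X ^ w i) * (of_nat (Suc m) :: int fps))"
      by (intro prod.cong refl) (simp add: algebra_simps)
    then show ?thesis by (simp add: prod.distrib)
  qed
  then show "(\<Sum>L\<in>Pow R. block_kernel w (R - L)) =
    (\<Prod>i\<in>R. 1 - fps_X ^ w i) * fps_powsum (\<lambda>m. of_nat (Suc m) ^ card R)"
    using sum_Pow_times_block_kernel[OF assms, of "\<lambda>i. 1" w]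
    by (simp add: power_sum fps_powsum_mult del: of_nat_Suc)
qed

text \<open>
  Multiplication by \<open>W - X E\<close> makes the series telescope, leaving the term \<open>m = 0\<close> only.
\<close>

lemma block_kernel_convolution:
  assumes "finite R"
  shows "(\<Sum>L\<in>Pow R. (fps_X ^ sum w L - fps_X) * block_kernel w (R - L)) = (if R = {} then 1 else 0)"
proof -
  let ?D = "\<Prod>i\<in>R. 1 - fps_X ^ w i :: int fps"
  have "(\<Sum>L\<in>Pow R. (fps_X ^ sum w L - fps_X) * block_kernel w (R - L)) =
     (\<Sum>L\<in>Pow R. fps_X ^ sum w L * block_kernel w (R - L)) - fps_X * (\<Sum>L\<in>Pow R. block_kernel w (R - L))"
    by (simp add: left_diff_distrib sum_subtractf sum_distrib_left)
  also have "\<dots> = ?D * (fps_powsum (\<lambda>m. of_nat m ^ card R) - fps_X * fps_powsum (\<lambda>m. of_nat (Suc m) ^ card R))"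
    unfolding block_kernel_with_powers[OF assms] by (simp add: algebra_simps)
  also have "fps_powsum (\<lambda>m. of_nat m ^ card R) - fps_X * fps_powsum (\<lambda>m. of_nat (Suc m) ^ card R) = (0 ^ card R :: int fps)"
    by (subst fps_powsum_shift) simp
  finally show ?thesis using assms by (auto simp: card_gt_0_iff zero_power)
qed

lemma sum_weights_pos:
  fixes w :: "'a \<Rightarrow> nat"
  assumes "finite R" "\<And>i. i \<in> R \<Longrightarrow> 0 < w i" "L \<subseteq> R" "L \<noteq> {}"
  shows "0 < sum w L"
proof (rule sum_pos)
  show "finite L" using assms(1,3) by (rule rev_finite_subset)
  show "0 < w i" if "i \<in> L" for i using assms(2,3) that by blast
qed (rule assms(4))

text \<open>
  Both sides satisfy the recursion over the first block.
\<close>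

lemma block_lists_gf_eq:
  assumes "finite R" and "\<And>i. i \<in> R \<Longrightarrow> 0 < w i"
  shows "block_lists_gf w R = (1 - fps_X) * block_kernel w R"
  using assms
proof (induction R rule: finite_psubset_induct)
  case (psubset R)
  show ?case
  proof (cases "R = {}")
    case True
    have "block_lists_gf w {} = 1"
      by (rule fps_ext) (simp add: block_lists_gf_def block_lists_empty)
    then show ?thesis using True block_kernel_convolution[of "{}" w] by simp
  next
    case False
    let ?F = "Pow R - {{}}"
    have "block_lists_gf w R = (\<Sum>L\<in>?F. decoration_gf (sum w L) * block_lists_gf w (R - L))"
    proof (rule fps_ext)
      fix K
      have "block_lists R w K = {bs \<in> block_lists R w K. bs \<noteq> [] \<and> fst (hd bs) \<in> ?F}"
      proof -
        have "bs \<noteq> [] \<and> fst (hd bs) \<in> ?F" if "bs \<in> block_lists R w K" for bs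
          using that False
          by (cases bs) (auto simp: Cons_in_block_lists_iff block_lists_def[of R w K] partition_on_def)
        then show ?thesis by blast
      qed
      then have "block_lists_gf w R $ K = int (card {bs \<in> block_lists R w K. bs \<noteq> [] \<and> fst (hd bs) \<in> ?F})"
        by (simp add: block_lists_gf_def)
      also have "\<dots> = (\<Sum>L\<in>?F. decoration_gf (sum w L) * block_lists_gf w (R - L)) $ K"
        by (rule card_block_lists_head[OF psubset(1)]) auto
      finally show "block_lists_gf w R $ K = (\<Sum>L\<in>?F. decoration_gf (sum w L) * block_lists_gf w (R - L)) $ K" .
    qed
    also have "\<dots> = (\<Sum>L\<in>?F. - ((fps_X ^ sum w L - fps_X) * block_kernel w (R - L)))"
    proof (rule sum.cong[OF refl])
      fix L assume L: "L \<in> ?F"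
      have "block_lists_gf w (R - L) = (1 - fps_X) * block_kernel w (R - L)"
        using L psubset.prems by (intro psubset.IH) auto
      moreover have "(1 - fps_X) * decoration_gf (sum w L) = fps_X - fps_X ^ sum w L"
        using L psubset by (intro decoration_gf_times sum_weights_pos[of R]) auto
      ultimately show "decoration_gf (sum w L) * block_lists_gf w (R - L) = - ((fps_X ^ sum w L - fps_X) * block_kernel w (R - L))"
        by (metis (no_types, lifting) minus_diff_eq mult.assoc mult.left_commute mult_minus_left)
    qed
    also have "\<dots> = - ((\<Sum>L\<in>Pow R. (fps_X ^ sum w L - fps_X) * block_kernel w (R - L)) - (1 - fps_X) * block_kernel w R)"
      using psubset(1) by (simp add: sum_negf sum_diff1)
    finally show ?thesis
      using False by (simp add: block_kernel_convolution[OF psubset(1)])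
  qed
qed

text \<open>
  Inclusion and exclusion, applied to a product of binomials.
\<close>

lemma fps_nth_prod_one_minus:
  fixes P :: "'a::comm_ring_1 fps" and R :: "'b set"
  assumes "finite R"
  shows "((\<Prod>i\<in>R. 1 - fps_X ^ w i) * P) $ K =
    (\<Sum>S | S \<subseteq> R \<and> sum w S \<le> K. (-1) ^ card S * P $ (K - sum w S))"
proof -
  have "(\<Prod>i\<in>R. 1 - fps_X ^ w i) = (\<Prod>i\<in>R. - (fps_X ^ w i :: 'a fps) + 1)" by simp
  also have "\<dots> = (\<Sum>S\<in>Pow R. \<Prod>i\<in>S. - (fps_X ^ w i))"
    by (subst prod_add[OF assms]) simp
  also have "\<dots> = (\<Sum>S\<in>Pow R. (-1) ^ card S * fps_X ^ sum w S)"
    by (simp add: prod_uminus power_sum)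
  finally have "((\<Prod>i\<in>R. 1 - fps_X ^ w i) * P) $ K = (\<Sum>S\<in>Pow R. ((-1) ^ card S * (fps_X ^ sum w S * P)) $ K)"
    by (simp add: sum_distrib_right fps_sum_nth mult.assoc)
  also have "\<dots> = (\<Sum>S\<in>Pow R. if sum w S \<le> K then (-1) ^ card S * P $ (K - sum w S) else 0)"
  proof (rule sum.cong[OF refl])
    fix S :: "'b set"
    have "((-1) ^ card S :: 'a fps) = fps_const ((-1) ^ card S)"
      by (metis fps_const_1_eq_1 fps_const_neg fps_const_power)
    then show "((-1) ^ card S * (fps_X ^ sum w S * P)) $ K = (if sum w S \<le> K then (-1) ^ card S * P $ (K - sum w S) else 0)"
      by (simp only: fps_mult_left_const_nth fps_X_power_mult_nth) simp
  qed
  also have "\<dots> = (\<Sum>S | S \<subseteq> R \<and> sum w S \<le> K. (-1) ^ card S * P $ (K - sum w S))"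
    using assms by (intro sum.mono_neutral_cong_right) auto
  finally show ?thesis .
qed

text \<open>
  Split off the first block, which contains \<open>r0\<close>, and sum over all possibilities.  With \<open>R' = R - {r0}\<close> and
  \<open>s = card R'\<close>, the two convolutions combine to
  \<open>\<Prod>(1 - X^w) * (\<Sum>m\<ge>1. m^s X^m)\<close>, the product being over \<open>R\<close>; if \<open>s = 0\<close>, there is an additional term
  \<open>- X^(w r0)\<close>, which does not contribute below the total weight.
\<close>

proposition card_block_lists_pointed:
  assumes "finite R" and pos: "\<And>i. i \<in> R \<Longrightarrow> 0 < w i" and "r0 \<in> R" and K: "0 < K" "K < sum w R"
  shows "int (card {bs \<in> block_lists R w K. bs \<noteq> [] \<and> r0 \<in> fst (hd bs)}) =
    (\<Sum>S | S \<subseteq> R \<and> sum w S < K. (-1) ^ card S * int (K - sum w S) ^ (card R - 1))"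
proof -
  define R' where "R' = R - {r0}"
  have R: "R = insert r0 R'" "r0 \<notin> R'" and finR': "finite R'" using assms by (auto simp: R'_def)
  let ?F = "{L. L \<subseteq> R \<and> r0 \<in> L}"
  let ?D = "\<Prod>i\<in>R'. 1 - fps_X ^ w i :: int fps"
  let ?G = "\<lambda>f. fps_powsum (\<lambda>m. of_nat (f m) ^ card R' :: int fps)"
  have bs_sub: "fst (hd bs) \<subseteq> R" if "bs \<in> block_lists R w K" "bs \<noteq> []" for bs
    using that by (cases bs) (auto simp: block_lists_def partition_on_def)
  have "{bs \<in> block_lists R w K. bs \<noteq> [] \<and> r0 \<in> fst (hd bs)} = {bs \<in> block_lists R w K. bs \<noteq> [] \<and> fst (hd bs) \<in> ?F}"
    using bs_sub by blast
  then have "int (card {bs \<in> block_lists R w K. bs \<noteq> [] \<and> r0 \<in> fst (hd bs)}) =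
      (\<Sum>L\<in>?F. decoration_gf (sum w L) * block_lists_gf w (R - L)) $ K"
    using card_block_lists_head[OF assms(1), of ?F w K] by auto
  also have "(\<Sum>L\<in>?F. decoration_gf (sum w L) * block_lists_gf w (R - L)) =
      (\<Sum>L\<in>?F. (fps_X - fps_X ^ sum w L) * block_kernel w (R - L))"
  proof (rule sum.cong[OF refl])
    fix L assume L: "L \<in> ?F"
    have "block_lists_gf w (R - L) = (1 - fps_X) * block_kernel w (R - L)"
      using assms by (intro block_lists_gf_eq) auto
    moreover have "(1 - fps_X) * decoration_gf (sum w L) = fps_X - fps_X ^ sum w L"
      using L assms by (intro decoration_gf_times sum_weights_pos[of R]) auto
    ultimately show "decoration_gf (sum w L) * block_lists_gf w (R - L) = (fps_X - fps_X ^ sum w L) * block_kernel w (R - L)"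
      by (metis mult.assoc mult.commute)
  qed
  also have "\<dots> = (\<Sum>L\<in>Pow R'. (fps_X - fps_X ^ w r0 * fps_X ^ sum w L) * block_kernel w (R' - L))"
  proof (rule sum.reindex_bij_witness[of _ "insert r0" "\<lambda>L. L - {r0}"])
    fix L assume L: "L \<in> ?F"
    have "sum w L = w r0 + sum w (L - {r0})"
      using L assms(1) by (auto intro!: sum.remove intro: finite_subset)
    moreover have "R' - (L - {r0}) = R - L" using L by (auto simp: R'_def)
    ultimately show "(fps_X - fps_X ^ w r0 * fps_X ^ sum w (L - {r0})) * block_kernel w (R' - (L - {r0})) =
       (fps_X - fps_X ^ sum w L) * block_kernel w (R - L)"
      by (simp add: power_add)
  qed (use R in auto)
  also have "\<dots> = fps_X * (\<Sum>L\<in>Pow R'. block_kernel w (R' - L)) - fps_X ^ w r0 * (\<Sum>L\<in>Pow R'. fps_X ^ sum w L * block_kernel w (R' - L))"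
    by (simp add: left_diff_distrib sum_subtractf sum_distrib_left mult.assoc)
  also have "\<dots> = ?D * (fps_X * ?G Suc - fps_X ^ w r0 * ?G (\<lambda>m. m))"
    unfolding block_kernel_with_powers[OF finR'] by (simp add: algebra_simps)
  also have "fps_X * ?G Suc = ?G (\<lambda>m. m) - 0 ^ card R'"
    by (subst (2) fps_powsum_shift) simp
  also have "?D * (?G (\<lambda>m. m) - 0 ^ card R' - fps_X ^ w r0 * ?G (\<lambda>m. m)) =
     (\<Prod>i\<in>R. 1 - fps_X ^ w i) * ?G (\<lambda>m. m) - ?D * 0 ^ card R'"
    using R finR' by (simp add: algebra_simps)
  also have "\<dots> = (\<Prod>i\<in>R. 1 - fps_X ^ w i) * (?G (\<lambda>m. m) - 0 ^ card R') - (if R' = {} then fps_X ^ w r0 else 0)"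
    using R finR' by (auto simp: card_gt_0_iff zero_power algebra_simps)
  also have "\<dots> $ K = ((\<Prod>i\<in>R. 1 - fps_X ^ w i) * (?G (\<lambda>m. m) - 0 ^ card R')) $ K"
    using K R by (auto simp: fps_X_power_nth)
  also have "\<dots> = (\<Sum>S | S \<subseteq> R \<and> sum w S \<le> K. (-1) ^ card S * (?G (\<lambda>m. m) - 0 ^ card R') $ (K - sum w S))"
    by (rule fps_nth_prod_one_minus[OF assms(1)])
  also have "\<dots> = (\<Sum>S | S \<subseteq> R \<and> sum w S < K. (-1) ^ card S * int (K - sum w S) ^ (card R - 1))"
  proof (rule sum.mono_neutral_cong_right)
    have G: "(?G (\<lambda>m. m) - 0 ^ card R') $ j = (if j = 0 then 0 else int j ^ card R')" for j
    proof -
      have *: "(of_nat m ^ c :: int fps) $ i = (if i = 0 then int m ^ c else 0)" for m c i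
        by (simp flip: of_nat_power add: fps_of_nat[symmetric])
      have "?G (\<lambda>m. m) $ j = (\<Sum>m\<le>j. if m = j then int m ^ card R' else 0)"
        unfolding fps_powsum_nth * by (intro sum.cong) auto
      then show ?thesis using *[of 0 "card R'" j] by (auto simp: zero_power)
    qed
    have cR: "card R - 1 = card R'" using R finR' by simp
    show "\<forall>S\<in>{S. S \<subseteq> R \<and> sum w S \<le> K} - {S. S \<subseteq> R \<and> sum w S < K}.
        (-1) ^ card S * (?G (\<lambda>m. m) - 0 ^ card R') $ (K - sum w S) = 0"
      unfolding G by auto
    show "(-1) ^ card S * (?G (\<lambda>m. m) - 0 ^ card R') $ (K - sum w S) = (-1) ^ card S * int (K - sum w S) ^ (card R - 1)"
      if "S \<in> {S. S \<subseteq> R \<and> sum w S < K}" for S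
      using that unfolding G cR by auto
  qed (use assms(1) in auto)
  finally show ?thesis .
qed

section \<open>The number of fixed hypersimplicial DOSPs\<close>

text \<open>
  The common value, up to the factor \<open>g\<close>, of the two characters.
\<close>

definition signed_subset_sum :: "'a set \<Rightarrow> ('a \<Rightarrow> nat) \<Rightarrow> nat \<Rightarrow> nat \<Rightarrow> complex" where
  "signed_subset_sum R w k p = (\<Sum>S | S \<subseteq> R \<and> sum w S < k. (-1) ^ card S * of_nat (k - sum w S) ^ p)"

lemma finite_decorated_lists: "finite (decorated_lists k :: ('n::finite set \<times> nat) list set)"
  by (rule finite_subset[OF _ finite_decorated_partitions[of UNIV k]]) (auto simp: decorated_lists_def)

lemma cycle_lists_eq_block_lists:
  fixes \<sigma> :: "'n::finite \<Rightarrow> 'n"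
  assumes "0 < e" "e dvd k" and dvd: "\<forall>C\<in>cycles_of \<sigma>. e dvd card C"
  shows "cycle_lists \<sigma> k x0 e = {bs \<in> block_lists (cycles_of \<sigma>) (\<lambda>C. card C div e) (k div e).
    bs \<noteq> [] \<and> orbit \<sigma> x0 \<in> fst (hd bs)}"
proof -
  let ?w = "\<lambda>C. card C div e"
  have scale: "e * sum ?w M = (\<Sum>C\<in>M. card C)" if "M \<subseteq> cycles_of \<sigma>" for M
    unfolding sum_distrib_left using that dvd by (intro sum.cong) auto
  have "l * e < (\<Sum>C\<in>M. card C) \<longleftrightarrow> l < sum ?w M" if "M \<subseteq> cycles_of \<sigma>" for l M
    unfolding scale[OF that, symmetric] using \<open>0 < e\<close> by (simp add: mult.commute[of l])
  then have "(\<forall>(M, l)\<in>set bs. 0 < l \<and> l * e < (\<Sum>C\<in>M. card C)) \<longleftrightarrow> (\<forall>(M, l)\<in>set bs. 0 < l \<and> l < sum ?w M)"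
    if "partition_on (cycles_of \<sigma>) (set (map fst bs))" for bs
  proof -
    assume *: "\<And>M l. M \<subseteq> cycles_of \<sigma> \<Longrightarrow> (l * e < (\<Sum>C\<in>M. card C)) = (l < sum ?w M)"
    have "fst b \<subseteq> cycles_of \<sigma>" if "b \<in> set bs" for b
      using partition_onD1[OF \<open>partition_on _ _\<close>] that by auto
    then show ?thesis using * by (intro ball_cong refl) (simp add: case_prod_unfold)
  qed
  moreover have "e * s = k \<longleftrightarrow> s = k div e" for s using assms(1,2) by auto
  moreover have "bs \<noteq> []" if "partition_on (cycles_of \<sigma>) (set (map fst bs))" for bs
    using partition_onD1[OF that] orbit_in_cycles_of[of \<sigma> x0] by auto
  ultimately show ?thesis
    unfolding cycle_lists_def block_lists_def by blast
qed

text \<open>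
  The number of coordinates, \<open>e ^ (r - 1)\<close>, cancels the denominators that come from dividing the weights and \<open>k\<close>
  by \<open>e\<close>; this is why the result does not depend on \<open>e\<close>.
\<close>

lemma card_cycle_lists:
  fixes \<sigma> :: "'n::finite \<Rightarrow> 'n"
  assumes \<sigma>: "\<sigma> permutes UNIV" and k: "0 < k" "k < CARD('n)"
    and e: "0 < e" "e dvd k" and dvd: "\<forall>C\<in>cycles_of \<sigma>. e dvd card C"
  shows "of_nat (e ^ (card (cycles_of \<sigma>) - 1) * card (cycle_lists \<sigma> k x0 e)) =
    signed_subset_sum (cycles_of \<sigma>) card k (card (cycles_of \<sigma>) - 1)"
proof -
  let ?R = "cycles_of \<sigma>" and ?w = "\<lambda>C. card C div e"
  let ?p = "card ?R - 1"
  have scale: "e * sum ?w M = sum card M" if "M \<subseteq> ?R" for M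
    unfolding sum_distrib_left using that dvd by (intro sum.cong) auto
  have n: "sum card ?R = CARD('n)"
    using card_Union_cycles[OF \<sigma> order_refl] Union_cycles_of[OF \<sigma>] by simp
  obtain K where K: "k = e * K" using e(2) by (elim dvdE)
  have kdiv: "k div e = K" using K e(1) by simp
  have "e * K < e * sum ?w ?R" using scale[OF order_refl] n k(2) K by simp
  then have K_less: "K < sum ?w ?R" by simp
  have w_pos: "0 < ?w C" if "C \<in> ?R" for C
    using bspec[OF dvd that] card_cycle_pos[OF that] e(1) by (simp add: div_greater_zero_iff dvd_imp_le)
  have "int (card (cycle_lists \<sigma> k x0 e)) = (\<Sum>S | S \<subseteq> ?R \<and> sum ?w S < K. (-1) ^ card S * int (K - sum ?w S) ^ ?p)"
    unfolding cycle_lists_eq_block_lists[OF e(1,2) dvd] kdiv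
    using k(1) K by (intro card_block_lists_pointed w_pos orbit_in_cycles_of K_less) auto
  then have "int (e ^ ?p * card (cycle_lists \<sigma> k x0 e)) =
     (\<Sum>S | S \<subseteq> ?R \<and> sum ?w S < K. int e ^ ?p * ((-1) ^ card S * int (K - sum ?w S) ^ ?p))"
    by (simp only: of_nat_mult of_nat_power sum_distrib_left)
  also have "\<dots> = (\<Sum>S | S \<subseteq> ?R \<and> sum card S < k. (-1) ^ card S * int (k - sum card S) ^ ?p)"
  proof (rule sum.cong)
    show "{S. S \<subseteq> ?R \<and> sum ?w S < K} = {S. S \<subseteq> ?R \<and> sum card S < k}"
    proof (intro Collect_cong conj_cong refl)
      fix S assume "S \<subseteq> ?R"
      from scale[OF this] show "sum ?w S < K \<longleftrightarrow> sum card S < k"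
        unfolding K using e(1) by (metis mult_less_cancel1)
    qed
    fix S assume "S \<in> {S. S \<subseteq> ?R \<and> sum card S < k}"
    then have "k - sum card S = e * (K - sum ?w S)" using scale[of S] K by (simp add: diff_mult_distrib2)
    then show "int e ^ ?p * ((-1) ^ card S * int (K - sum ?w S) ^ ?p) = (-1) ^ card S * int (k - sum card S) ^ ?p"
      by (simp add: power_mult_distrib)
  qed
  finally have "int (e ^ ?p * card (cycle_lists \<sigma> k x0 e)) =
     (\<Sum>S | S \<subseteq> ?R \<and> sum card S < k. (-1) ^ card S * int (k - sum card S) ^ ?p)" .
  then have "(of_int (int (e ^ ?p * card (cycle_lists \<sigma> k x0 e))) :: complex) =
     of_int (\<Sum>S | S \<subseteq> ?R \<and> sum card S < k. (-1) ^ card S * int (k - sum card S) ^ ?p)"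
    by (rule arg_cong)
  then show ?thesis unfolding signed_subset_sum_def by simp
qed

text \<open>
  Only divisors \<open>e\<close> of \<open>g\<close> occur as denominators of a rotation, by \<open>equivariant_maps_dvd\<close>.
\<close>

proposition card_fixed_DOSPs:
  fixes \<sigma> :: "'n::finite \<Rightarrow> 'n"
  assumes \<sigma>: "\<sigma> permutes UNIV" and k: "0 < k" "k < CARD('n)"
  shows "of_nat (card {D \<in> hypersimplicial_DOSPs k. act_DOSP \<sigma> D = D}) =
    of_nat (Gcd (insert k (card ` cycles_of \<sigma>))) * signed_subset_sum (cycles_of \<sigma>) card k (card (cycles_of \<sigma>) - 1)"
proof -
  fix x0 :: 'n
  define g where "g = Gcd (insert k (card ` cycles_of \<sigma>))"
  let ?Y = "\<lambda>(e, u). rotation_lists \<sigma> k x0 e u"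
  let ?I = "SIGMA e:{e. e dvd g}. totatives e"
  let ?W = "signed_subset_sum (cycles_of \<sigma>) card k (card (cycles_of \<sigma>) - 1)"
  have "g dvd k" unfolding g_def by (rule Gcd_dvd) simp
  then have g_pos: "0 < g" using k(1) by (metis dvd_0_left gr0I)
  have g_dvd: "g dvd card C" if "C \<in> cycles_of \<sigma>" for C
    unfolding g_def using that by (intro Gcd_dvd) simp
  have e_dvd: "e dvd g" if eu: "0 < e" "coprime u e" "ds \<in> rotation_lists \<sigma> k x0 e u" for e u ds
  proof -
    obtain y bs where "y \<in> equivariant_maps \<sigma> x0 e u" "bs \<in> cycle_lists \<sigma> k x0 e"
      using rotation_list_is_lift[OF \<sigma> eu(2,1,3)] by blast
    then have "e dvd card C" if "C \<in> cycles_of \<sigma>" for C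
      using equivariant_maps_dvd[OF \<sigma> \<open>coprime u e\<close> \<open>0 < e\<close>] that by blast
    moreover have "e dvd k" using \<open>bs \<in> _\<close> by (auto simp: cycle_lists_def)
    ultimately show ?thesis unfolding g_def by (intro Gcd_greatest) auto
  qed
  have "(\<Union>(e, u)\<in>(SIGMA e:{0<..}. totatives e). rotation_lists \<sigma> k x0 e u) = (\<Union>i\<in>?I. ?Y i)"
  proof (intro equalityI subsetI)
    fix ds assume "ds \<in> (\<Union>(e, u)\<in>(SIGMA e:{0<..}. totatives e). rotation_lists \<sigma> k x0 e u)"
    then obtain e u where eu: "0 < e" "u \<in> totatives e" "ds \<in> rotation_lists \<sigma> k x0 e u" by auto
    then have "e dvd g" using e_dvd[of e u ds] by (simp add: in_totatives_iff)
    then show "ds \<in> (\<Union>i\<in>?I. ?Y i)" using eu by (intro UN_I[of "(e, u)"]) auto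
  next
    fix ds assume "ds \<in> (\<Union>i\<in>?I. ?Y i)"
    then obtain e u where eu: "e dvd g" "u \<in> totatives e" "ds \<in> rotation_lists \<sigma> k x0 e u" by auto
    then have "0 < e" using g_pos by (metis dvd_0_left_iff gr0I)
    then show "ds \<in> (\<Union>(e, u)\<in>(SIGMA e:{0<..}. totatives e). rotation_lists \<sigma> k x0 e u)"
      using eu by (intro UN_I[of "(e, u)"]) auto
  qed
  then have "card {D \<in> hypersimplicial_DOSPs k. act_DOSP \<sigma> D = D} = card (\<Union>i\<in>?I. ?Y i)"
    unfolding card_fixed_DOSPs_eq_pointed_lists[of k \<sigma> x0] fixed_pointed_lists_eq by simp
  also have "\<dots> = (\<Sum>i\<in>?I. card (?Y i))"
  proof (rule card_UN_disjoint)
    show "finite ?I" using g_pos by (intro finite_SigmaI) auto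
    show "\<forall>i\<in>?I. finite (?Y i)"
      by (auto intro!: finite_subset[OF _ finite_decorated_lists[of k]] simp: rotation_lists_def pointed_lists_def)
    show "\<forall>i\<in>?I. \<forall>j\<in>?I. i \<noteq> j \<longrightarrow> ?Y i \<inter> ?Y j = {}"
      using rotation_lists_disjoint[of _ \<sigma> k x0] by (auto 0 3)
  qed
  also have "\<dots> = (\<Sum>e | e dvd g. \<Sum>u\<in>totatives e. card (rotation_lists \<sigma> k x0 e u))"
    using g_pos by (subst sum.Sigma) (auto simp: case_prod_unfold)
  finally have "of_nat (card {D \<in> hypersimplicial_DOSPs k. act_DOSP \<sigma> D = D}) =
      (\<Sum>e | e dvd g. \<Sum>u\<in>totatives e. of_nat (card (rotation_lists \<sigma> k x0 e u)) :: complex)" by simp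
  also have "\<dots> = (\<Sum>e | e dvd g. \<Sum>u\<in>totatives e. ?W)"
  proof (intro sum.cong refl)
    fix e u assume e: "e \<in> {e. e dvd g}" and u: "u \<in> totatives e"
    have "0 < e" using e g_pos by (metis dvd_0_left_iff gr0I mem_Collect_eq)
    moreover have "coprime u e" using u by (simp add: in_totatives_iff)
    moreover have "e dvd k" using e \<open>g dvd k\<close> by (metis dvd_trans mem_Collect_eq)
    moreover have dvd: "\<forall>C\<in>cycles_of \<sigma>. e dvd card C"
      using e g_dvd by (metis dvd_trans mem_Collect_eq)
    ultimately show "of_nat (card (rotation_lists \<sigma> k x0 e u)) = ?W"
      unfolding card_rotation_lists[OF \<sigma> \<open>coprime u e\<close> \<open>0 < e\<close>]
        card_equivariant_maps[OF \<sigma> \<open>coprime u e\<close> \<open>0 < e\<close> dvd]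
      by (intro card_cycle_lists[OF \<sigma> k])
  qed
  also have "\<dots> = of_nat (\<Sum>e | e dvd g. totient e) * ?W"
    by (simp add: totient_def sum_distrib_right)
  finally show ?thesis unfolding totient_divisor_sum g_def .
qed

section \<open>Linear congruences and sections of power series\<close>

definition box_gf :: "'a set \<Rightarrow> ('a \<Rightarrow> nat) \<Rightarrow> nat \<Rightarrow> complex fps" where
  "box_gf R w m = (\<Prod>i\<in>R. \<Sum>j<m. fps_X ^ (w i * j))"

definition weight_gf :: "'a set \<Rightarrow> ('a \<Rightarrow> nat) \<Rightarrow> complex fps" where
  "weight_gf R w = (\<Prod>i\<in>R. 1 - fps_X ^ w i)"

lemma box_gf_nth:
  assumes "finite R"
  shows "box_gf R w m $ a = of_nat (card {y \<in> R \<rightarrow>\<^sub>E {..<m}. (\<Sum>i\<in>R. w i * y i) = a})"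
proof -
  have fin: "finite (R \<rightarrow>\<^sub>E {..<m})" using assms by (intro finite_PiE) auto
  have "box_gf R w m = (\<Sum>y\<in>R \<rightarrow>\<^sub>E {..<m}. fps_X ^ (\<Sum>i\<in>R. w i * y i))"
    unfolding box_gf_def using assms by (subst prod_sum_PiE) (auto simp: power_sum)
  then have "box_gf R w m $ a = (\<Sum>y\<in>R \<rightarrow>\<^sub>E {..<m}. if (\<Sum>i\<in>R. w i * y i) = a then 1 else 0)"
    unfolding fps_sum_nth by (auto simp: fps_sum_nth fps_X_power_nth intro!: sum.cong)
  also have "\<dots> = of_nat (card {y \<in> R \<rightarrow>\<^sub>E {..<m}. (\<Sum>i\<in>R. w i * y i) = a})"
    using fin by (simp add: sum.If_cases Int_def)
  finally show ?thesis .
qed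

lemma weight_gf_times_box_gf: "weight_gf R w * box_gf R w m = (\<Prod>i\<in>R. 1 - fps_X ^ (m * w i))"
  unfolding weight_gf_def box_gf_def prod.distrib[symmetric]
proof (rule prod.cong[OF refl])
  fix i
  have "(1 - fps_X ^ w i) * (\<Sum>j<m. fps_X ^ (w i * j)) = 1 - (fps_X ^ w i :: complex fps) ^ m"
    by (simp add: power_mult one_diff_power_eq)
  then show "(1 - fps_X ^ w i) * (\<Sum>j<m. fps_X ^ (w i * j)) = (1 - fps_X ^ (m * w i) :: complex fps)"
    by (simp add: power_mult[symmetric] mult.commute)
qed

lemma weight_gf_nth_0: "\<forall>i\<in>R. 0 < w i \<Longrightarrow> weight_gf R w $ 0 = 1"
  unfolding weight_gf_def
  by (induction R rule: infinite_finite_induct) (auto simp: fps_X_power_nth)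

lemma weight_gf_inverse:
  assumes "\<forall>i\<in>R. 0 < w i"
  shows "weight_gf R w * inverse (weight_gf R w) = 1"
  using inverse_mult_eq_1'[of "weight_gf R w"] weight_gf_nth_0[of R w] assms by simp

lemma box_gf_eq:
  assumes "\<forall>i\<in>R. 0 < w i"
  shows "box_gf R w m = (\<Prod>i\<in>R. 1 - fps_X ^ (m * w i)) * inverse (weight_gf R w)"
  unfolding weight_gf_times_box_gf[symmetric]
  using weight_gf_inverse[of R w, OF assms] by (simp add: mult_ac)

text \<open>
  The series \<open>box_gf R w m\<close> is \<open>inverse (weight_gf R w)\<close> multiplied by \<open>weight_gf R w\<close> evaluated at \<open>X^m\<close>.  The latter
  has coefficients only at multiples of \<open>m\<close>, so picking the coefficients at \<open>m * i - h\<close> on both sides turns it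
  into \<open>weight_gf R w\<close>.
\<close>

lemma weight_gf_times_section:
  assumes pos: "\<forall>i\<in>R. 0 < w i" and "0 < m"
  shows "(weight_gf R w * Abs_fps (\<lambda>d. if h \<le> m * d then inverse (weight_gf R w) $ (m * d - h) else 0)) $ i =
    (if h \<le> m * i then box_gf R w m $ (m * i - h) else 0)"
proof -
  let ?D = "weight_gf R w"
  let ?P = "inverse ?D"
  have "?D oo fps_X ^ m = (\<Prod>i\<in>R. (1 - fps_X ^ w i) oo fps_X ^ m)"
    unfolding weight_gf_def using \<open>0 < m\<close> by (intro fps_compose_prod_distrib) (simp add: fps_X_power_nth)
  also have "\<dots> = (\<Prod>i\<in>R. 1 - fps_X ^ (m * w i))"
  proof (rule prod.cong[OF refl])
    fix i
    have "fps_X ^ w i oo fps_X ^ m = (fps_X ^ (m * w i) :: complex fps)"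
      using \<open>0 < m\<close> by (simp add: fps_compose_power[symmetric] fps_X_power_nth power_mult)
    then show "(1 - fps_X ^ w i) oo fps_X ^ m = (1 - fps_X ^ (m * w i) :: complex fps)"
      by (simp add: fps_compose_sub_distrib)
  qed
  finally have box: "box_gf R w m = (?D oo fps_X ^ m) * ?P"
    by (simp add: box_gf_eq[of R w, OF pos])
  show ?thesis
  proof (cases "h \<le> m * i")
    case True
    have "box_gf R w m $ (m * i - h) = (\<Sum>a = 0..m * i - h. (if m dvd a then ?D $ (a div m) else 0) * ?P $ (m * i - h - a))"
      unfolding box fps_mult_nth fps_nth_compose_X_power ..
    also have "\<dots> = (\<Sum>a\<in>(*) m ` {j. m * j \<le> m * i - h}. ?D $ (a div m) * ?P $ (m * i - h - a))"
      by (intro sum.mono_neutral_cong_right) (auto elim!: dvdE)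
    also have "\<dots> = (\<Sum>j | m * j \<le> m * i - h. ?D $ j * ?P $ (m * i - h - m * j))"
      using \<open>0 < m\<close> by (subst sum.reindex) (auto simp: inj_on_def)
    also have "\<dots> = (\<Sum>j = 0..i. ?D $ j * (if h \<le> m * (i - j) then ?P $ (m * (i - j) - h) else 0))"
    proof (rule sum.mono_neutral_cong_left)
      have le: "j \<le> i" if "m * j \<le> m * i - h" for j
        using that \<open>0 < m\<close> by (meson diff_le_self le_trans mult_le_cancel1)
      then show "{j. m * j \<le> m * i - h} \<subseteq> {0..i}" by auto
      show "\<forall>j\<in>{0..i} - {j. m * j \<le> m * i - h}. ?D $ j * (if h \<le> m * (i - j) then ?P $ (m * (i - j) - h) else 0) = 0"
      proof -
        have "m * j \<le> m * i - h" if "j \<le> i" "h \<le> m * (i - j)" for j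
        proof -
          have "m * i = m * (i - j) + m * j" using that(1) by (simp flip: distrib_left)
          then show ?thesis using that(2) by simp
        qed
        then show ?thesis by auto
      qed
      fix j assume j: "j \<in> {j. m * j \<le> m * i - h}"
      then have "h \<le> m * (i - j)" "m * i - h - m * j = m * (i - j) - h"
        using True by (auto simp: diff_mult_distrib2)
      then show "?D $ j * ?P $ (m * i - h - m * j) = ?D $ j * (if h \<le> m * (i - j) then ?P $ (m * (i - j) - h) else 0)"
        by simp
    qed simp
    finally show ?thesis using True by (simp add: fps_mult_nth)
  next
    case False
    have "\<not> h \<le> m * (i - j)" for j
      using False by (meson diff_le_self le_trans mult_le_mono2)
    then show ?thesis using False by (simp add: fps_mult_nth)
  qed
qed

text \<open>
  Expand the product \<open>\<Prod>(1 - X^((d+1) w))\<close> over subsets.  The subset \<open>S\<close> contributes the coefficient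
  of \<open>inverse (weight_gf R w)\<close> at \<open>k d - (d + 1) * sum w S\<close>, which is \<open>(k - sum w S) * d - sum w S\<close>; it is negative for
  all \<open>d\<close> unless \<open>sum w S < k\<close>.
\<close>

lemma box_series_nth:
  assumes "finite R" and pos: "\<forall>i\<in>R. 0 < w i" and "0 < k"
  shows "(weight_gf R w * Abs_fps (\<lambda>d. box_gf R w (Suc d) $ (k * d))) $ i =
    (\<Sum>S | S \<subseteq> R \<and> sum w S < k. (-1) ^ card S *
       (if sum w S \<le> (k - sum w S) * i then box_gf R w (k - sum w S) $ ((k - sum w S) * i - sum w S) else 0))"
proof -
  let ?P = "inverse (weight_gf R w)"
  let ?A = "{S. S \<subseteq> R \<and> sum w S < k}"
  let ?F = "\<lambda>S. Abs_fps (\<lambda>d. if sum w S \<le> (k - sum w S) * d then ?P $ ((k - sum w S) * d - sum w S) else 0)"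
  have finA: "finite ?A" using assms(1) by simp
  have "Abs_fps (\<lambda>d. box_gf R w (Suc d) $ (k * d)) = (\<Sum>S\<in>?A. fps_const ((-1) ^ card S) * ?F S)"
  proof (rule fps_ext)
    fix d
    have "box_gf R w (Suc d) $ (k * d) =
        (\<Sum>S | S \<subseteq> R \<and> (\<Sum>i\<in>S. Suc d * w i) \<le> k * d. (-1) ^ card S * ?P $ (k * d - (\<Sum>i\<in>S. Suc d * w i)))"
      unfolding box_gf_eq[of R w, OF pos] by (rule fps_nth_prod_one_minus[OF assms(1)])
    also have "\<dots> = (\<Sum>S\<in>?A. (-1) ^ card S * (if sum w S \<le> (k - sum w S) * d then ?P $ ((k - sum w S) * d - sum w S) else 0))"
    proof (rule sum.mono_neutral_cong_left)
      have iff: "(\<Sum>i\<in>S. Suc d * w i) \<le> k * d \<longleftrightarrow> sum w S < k \<and> sum w S \<le> (k - sum w S) * d"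
        and eq: "sum w S < k \<Longrightarrow> k * d - (\<Sum>i\<in>S. Suc d * w i) = (k - sum w S) * d - sum w S" for S
      proof -
        define a where "a = sum w S"
        have sm: "(\<Sum>i\<in>S. Suc d * w i) = a * d + a"
          unfolding a_def by (simp add: sum_distrib_left[symmetric] mult.commute del: mult_Suc) simp
        have "a * d + a \<le> k * d \<Longrightarrow> a < k"
          using \<open>0 < k\<close> by (metis add_leD1 add_leD2 add_le_same_cancel1 le_0_eq linorder_not_le mult_is_0 mult_le_cancel2 nle_le order_antisym_conv)
        moreover have "a * d + a \<le> k * d \<longleftrightarrow> a \<le> (k - a) * d" if "a < k"
        proof -
          have "k * d = a * d + (k - a) * d" using that by (simp flip: distrib_right)
          then show ?thesis by simp
        qed
        ultimately show "(\<Sum>i\<in>S. Suc d * w i) \<le> k * d \<longleftrightarrow> sum w S < k \<and> sum w S \<le> (k - sum w S) * d"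
          unfolding sm a_def[symmetric] by blast
        show "k * d - (\<Sum>i\<in>S. Suc d * w i) = (k - sum w S) * d - sum w S"
          unfolding sm a_def[symmetric] by (simp add: diff_mult_distrib)
      qed
      show "{S. S \<subseteq> R \<and> (\<Sum>i\<in>S. Suc d * w i) \<le> k * d} \<subseteq> ?A" using iff by blast
      show "\<forall>S\<in>?A - {S. S \<subseteq> R \<and> (\<Sum>i\<in>S. Suc d * w i) \<le> k * d}.
        (-1) ^ card S * (if sum w S \<le> (k - sum w S) * d then ?P $ ((k - sum w S) * d - sum w S) else 0) = 0"
        using iff by auto
      fix S assume "S \<in> {S. S \<subseteq> R \<and> (\<Sum>i\<in>S. Suc d * w i) \<le> k * d}"
      then have "sum w S < k" "sum w S \<le> (k - sum w S) * d" using iff by blast+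
      then show "(-1) ^ card S * ?P $ (k * d - (\<Sum>i\<in>S. Suc d * w i)) =
        (-1) ^ card S * (if sum w S \<le> (k - sum w S) * d then ?P $ ((k - sum w S) * d - sum w S) else 0)"
        using eq by simp
    qed (use finA in auto)
    finally show "Abs_fps (\<lambda>d. box_gf R w (Suc d) $ (k * d)) $ d = (\<Sum>S\<in>?A. fps_const ((-1) ^ card S) * ?F S) $ d"
      by (simp add: fps_sum_nth)
  qed
  then have "(weight_gf R w * Abs_fps (\<lambda>d. box_gf R w (Suc d) $ (k * d))) $ i =
      (\<Sum>S\<in>?A. (fps_const ((-1) ^ card S) * (weight_gf R w * ?F S)) $ i)"
    by (simp only: sum_distrib_left fps_sum_nth mult.left_commute)
  also have "\<dots> = (\<Sum>S\<in>?A. (-1) ^ card S *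
       (if sum w S \<le> (k - sum w S) * i then box_gf R w (k - sum w S) $ ((k - sum w S) * i - sum w S) else 0))"
    unfolding fps_mult_left_const_nth
    by (intro sum.cong refl arg_cong2[of _ _ _ _ "(*)"] weight_gf_times_section pos) auto
  finally show ?thesis .
qed

lemma box_weight_le:
  fixes w :: "'a \<Rightarrow> nat"
  assumes "y \<in> R \<rightarrow>\<^sub>E {..<m}"
  shows "(\<Sum>i\<in>R. w i * y i) \<le> (m - 1) * sum w R"
  unfolding sum_distrib_left
proof (rule sum_mono)
  fix i assume "i \<in> R"
  then have "y i \<le> m - 1" using assms by (force dest: PiE_mem)
  then show "w i * y i \<le> (m - 1) * w i" by (simp add: mult.commute)
qed

lemma box_index_le:
  assumes "0 < m" "h < k" "m * i \<le> (m - 1) * W + h"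
  shows "i \<le> W + (k::nat)"
proof (rule ccontr)
  assume "\<not> i \<le> W + k"
  then have "m * (W + k) < m * i" using assms(1) by simp
  moreover have "(m - 1) * W \<le> m * W" "k \<le> m * k" using assms(1) by (simp_all add: mult_le_mono1)
  moreover have "m * (W + k) = m * W + m * k" by (simp add: distrib_left)
  ultimately show False using assms(2,3) by linarith
qed

text \<open>
  This is where polynomiality comes from: the degree of \<open>box_gf R w m\<close> is \<open>(m - 1) * sum w R\<close>.
\<close>

lemma box_gf_section_eq_0:
  assumes "finite R" "0 < m" "h < k" "i > sum w R + k"
  shows "(if h \<le> m * i then box_gf R w m $ (m * i - h) else 0) = 0"
proof -
  have "{y \<in> R \<rightarrow>\<^sub>E {..<m}. (\<Sum>i\<in>R. w i * y i) = m * i - h} = {}" if "h \<le> m * i"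
  proof -
    have False if "y \<in> R \<rightarrow>\<^sub>E {..<m}" "(\<Sum>i\<in>R. w i * y i) = m * i - h" for y
    proof -
      have "m * i \<le> (m - 1) * sum w R + h"
        using box_weight_le[OF that(1), of w] that(2) \<open>h \<le> m * i\<close> by simp
      from box_index_le[OF assms(2,3) this] show False using assms(4) by simp
    qed
    then show ?thesis by blast
  qed
  then show ?thesis unfolding box_gf_nth[OF assms(1)] by (metis (lifting) card.empty of_nat_0)
qed

text \<open>
  The indices \<open>m * i - h\<close> run through a full residue class modulo \<open>m\<close>.
\<close>

lemma sum_box_gf_section:
  assumes "finite R" "0 < m" "h < k"
  shows "(\<Sum>i\<le>sum w R + k. if h \<le> m * i then box_gf R w m $ (m * i - h) else 0) =
    of_nat (card {y \<in> R \<rightarrow>\<^sub>E {..<m}. m dvd (\<Sum>i\<in>R. w i * y i) + h})"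
proof -
  let ?A = "\<lambda>i. {y \<in> R \<rightarrow>\<^sub>E {..<m}. (\<Sum>i\<in>R. w i * y i) + h = m * i}"
  have fin: "finite (R \<rightarrow>\<^sub>E {..<m})" using assms by (intro finite_PiE) auto
  have "(if h \<le> m * i then box_gf R w m $ (m * i - h) else 0) = of_nat (card (?A i))" for i
  proof (cases "h \<le> m * i")
    case True
    then have "{y \<in> R \<rightarrow>\<^sub>E {..<m}. (\<Sum>i\<in>R. w i * y i) = m * i - h} = ?A i" by auto
    then show ?thesis using True by (simp add: box_gf_nth[OF assms(1)])
  next
    case False
    then have "?A i = {}" by auto
    then show ?thesis using False by (metis (lifting) card.empty of_nat_0)
  qed
  then have "(\<Sum>i\<le>sum w R + k. if h \<le> m * i then box_gf R w m $ (m * i - h) else 0) =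
     of_nat (\<Sum>i\<le>sum w R + k. card (?A i))" by simp
  also have "(\<Sum>i\<le>sum w R + k. card (?A i)) = card (\<Union>i\<in>{..sum w R + k}. ?A i)"
    using fin \<open>0 < m\<close> by (intro card_UN_disjoint[symmetric]) auto
  also have "(\<Union>i\<in>{..sum w R + k}. ?A i) = {y \<in> R \<rightarrow>\<^sub>E {..<m}. m dvd (\<Sum>i\<in>R. w i * y i) + h}"
  proof (intro equalityI subsetI)
    fix y assume y: "y \<in> {y \<in> R \<rightarrow>\<^sub>E {..<m}. m dvd (\<Sum>i\<in>R. w i * y i) + h}"
    then obtain i where i: "(\<Sum>i\<in>R. w i * y i) + h = m * i" by (auto elim: dvdE)
    have "m * i \<le> (m - 1) * sum w R + h"
      using box_weight_le[of y R m w] y i by auto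
    from box_index_le[OF assms(2,3) this] show "y \<in> (\<Union>i\<in>{..sum w R + k}. ?A i)"
      using y i by auto
  qed auto
  finally show ?thesis .
qed

lemma exists_weighted_sum_cong:
  fixes w :: "'a \<Rightarrow> nat"
  assumes "finite R" "0 < m" "Gcd (insert m (w ` R)) dvd c"
  shows "\<exists>z. [(\<Sum>i\<in>R. w i * z i) = c] (mod m)"
  using assms(1,3)
proof (induction R arbitrary: c rule: finite_induct)
  case empty
  then show ?case by (simp add: cong_0_iff cong_sym_eq[of 0])
next
  case (insert x R)
  let ?g = "Gcd (insert m (w ` R))"
  have gc: "gcd (w x) ?g dvd c"
    using insert.prems by (simp add: gcd.left_commute)
  then obtain q where q: "c = gcd (w x) ?g * q" by (auto elim: dvdE)
  have gm: "?g dvd m" by (rule Gcd_dvd) simp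
  obtain y where "[w x * y = gcd (w x) ?g] (mod ?g)"
    using cong_solve_nat by blast
  then have y: "[w x * (y * q) = c] (mod ?g)"
    unfolding q mult.assoc[symmetric] by (rule cong_scalar_right)
  \<comment> \<open>Congruent to \<open>c - w x * (y * q)\<close> modulo \<open>m\<close>, hence also modulo \<open>?g\<close>, but without truncated subtraction.\<close>
  let ?c = "c + (m - 1) * (w x * (y * q))"
  have "[w x * (y * q) + (m - 1) * (w x * (y * q)) = ?c] (mod ?g)"
    using y by (rule cong_add_rcancel_nat[THEN iffD2])
  moreover have "w x * (y * q) + (m - 1) * (w x * (y * q)) = m * (w x * (y * q))"
    using \<open>0 < m\<close> by (cases m) auto
  ultimately have "[?c = 0] (mod ?g)"
    using gm by (metis cong_0_iff cong_sym cong_trans dvd_mult2)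
  then have "?g dvd ?c" by (simp add: cong_0_iff)
  from insert.IH[OF this] obtain z where z: "[(\<Sum>i\<in>R. w i * z i) = ?c] (mod m)" by blast
  have "(\<Sum>i\<in>insert x R. w i * (z(x := y * q)) i) = w x * (y * q) + (\<Sum>i\<in>R. w i * z i)"
    using insert.hyps by (simp add: sum.insert) (intro sum.cong refl, auto)
  moreover have "[w x * (y * q) + (\<Sum>i\<in>R. w i * z i) = w x * (y * q) + ?c] (mod m)"
    using z by (intro cong_add) auto
  moreover have "w x * (y * q) + ?c = c + m * (w x * (y * q))"
    using \<open>w x * (y * q) + (m - 1) * (w x * (y * q)) = m * (w x * (y * q))\<close> by simp
  moreover have "[c + m * (w x * (y * q)) = c] (mod m)"
    by (simp add: cong_def)
  ultimately show ?case by (metis cong_trans)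
qed

text \<open>
  Translation by \<open>z\<close> maps solutions for \<open>a\<close> to solutions for \<open>b\<close>.
\<close>

lemma card_box_cong_le:
  fixes w :: "'a \<Rightarrow> nat"
  assumes "finite R" "0 < m" and z: "[(\<Sum>i\<in>R. w i * z i) + b = a] (mod m)"
  shows "card {y \<in> R \<rightarrow>\<^sub>E {..<m}. m dvd (\<Sum>i\<in>R. w i * y i) + a}
       \<le> card {y \<in> R \<rightarrow>\<^sub>E {..<m}. m dvd (\<Sum>i\<in>R. w i * y i) + b}"
proof (rule card_inj_on_le)
  let ?f = "\<lambda>y. restrict (\<lambda>i. (y i + z i) mod m) R"
  show "inj_on ?f {y \<in> R \<rightarrow>\<^sub>E {..<m}. m dvd (\<Sum>i\<in>R. w i * y i) + a}"
  proof (rule inj_onI)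
    fix y y' assume y: "y \<in> {y \<in> R \<rightarrow>\<^sub>E {..<m}. m dvd (\<Sum>i\<in>R. w i * y i) + a}"
      "y' \<in> {y \<in> R \<rightarrow>\<^sub>E {..<m}. m dvd (\<Sum>i\<in>R. w i * y i) + a}" and eq: "?f y = ?f y'"
    have "y i = y' i" if "i \<in> R" for i
    proof -
      have "(y i + z i) mod m = (y' i + z i) mod m"
        using fun_cong[OF eq, of i] that by simp
      then have "[y i = y' i] (mod m)" by (simp flip: cong_def add: cong_add_rcancel_nat)
      moreover have "y i < m" "y' i < m" using y that by (auto dest: PiE_mem)
      ultimately show ?thesis by (simp add: cong_def)
    qed
    then show "y = y'" using y by (intro PiE_ext[of y R "\<lambda>_. {..<m}" y']) auto
  qed
  show "?f ` {y \<in> R \<rightarrow>\<^sub>E {..<m}. m dvd (\<Sum>i\<in>R. w i * y i) + a} \<subseteq> {y \<in> R \<rightarrow>\<^sub>E {..<m}. m dvd (\<Sum>i\<in>R. w i * y i) + b}"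
  proof (intro image_subsetI CollectI conjI)
    fix y assume y: "y \<in> {y \<in> R \<rightarrow>\<^sub>E {..<m}. m dvd (\<Sum>i\<in>R. w i * y i) + a}"
    show "?f y \<in> R \<rightarrow>\<^sub>E {..<m}" using \<open>0 < m\<close> by auto
    have "[(\<Sum>i\<in>R. w i * ?f y i) = (\<Sum>i\<in>R. w i * (y i + z i))] (mod m)"
      by (intro cong_sum) (simp add: cong_def mod_mult_right_eq)
    then have "[(\<Sum>i\<in>R. w i * ?f y i) + b = (\<Sum>i\<in>R. w i * (y i + z i)) + b] (mod m)"
      by (intro cong_add) auto
    also have "(\<Sum>i\<in>R. w i * (y i + z i)) + b = (\<Sum>i\<in>R. w i * y i) + ((\<Sum>i\<in>R. w i * z i) + b)"
      by (simp add: distrib_left sum.distrib)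
    also have "[\<dots> = (\<Sum>i\<in>R. w i * y i) + a] (mod m)"
      using z by (intro cong_add) auto
    finally show "m dvd (\<Sum>i\<in>R. w i * ?f y i) + b"
      using y by (metis (no_types, lifting) cong_dvd_iff mem_Collect_eq)
  qed
  show "finite {y \<in> R \<rightarrow>\<^sub>E {..<m}. m dvd (\<Sum>i\<in>R. w i * y i) + b}"
    using finite_PiE[OF assms(1), of "\<lambda>_. {..<m}"] by simp
qed

text \<open>
  The constant terms for which the congruence is solvable are the multiples of the greatest common divisor,
  and for each of them there is the same number of solutions, by translation.  Together, these solution
  sets partition all \<open>m ^ card R\<close> points of the box.
\<close>

lemma card_box_cong:
  fixes w :: "'a \<Rightarrow> nat"
  assumes R: "finite R" and m: "0 < m" and h: "Gcd (insert m (w ` R)) dvd h"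
  shows "m * card {y \<in> R \<rightarrow>\<^sub>E {..<m}. m dvd (\<Sum>i\<in>R. w i * y i) + h} = Gcd (insert m (w ` R)) * m ^ card R"
proof -
  define g where "g = Gcd (insert m (w ` R))"
  define N where "N = (\<lambda>h. {y \<in> R \<rightarrow>\<^sub>E {..<m}. m dvd (\<Sum>i\<in>R. w i * y i) + h})"
  have fin: "finite (R \<rightarrow>\<^sub>E {..<m})" using R by (intro finite_PiE) auto
  have gm: "g dvd m" unfolding g_def by (rule Gcd_dvd) simp
  have gw: "g dvd w i" if "i \<in> R" for i unfolding g_def using that by (intro Gcd_dvd) simp
  \<comment> \<open>Adding \<open>m - 1\<close> times \<open>b\<close> stands for subtracting \<open>b\<close> modulo \<open>m\<close>.\<close>
  have le: "card (N a) \<le> card (N b)" if "g dvd a" "g dvd b" for a b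
  proof -
    have "g dvd a + (m - 1) * b" using that by simp
    then obtain z where z: "[(\<Sum>i\<in>R. w i * z i) = a + (m - 1) * b] (mod m)"
      using exists_weighted_sum_cong[OF R m] unfolding g_def by blast
    have "[(\<Sum>i\<in>R. w i * z i) + b = a + (m - 1) * b + b] (mod m)"
      using z by (intro cong_add) auto
    also have "a + (m - 1) * b + b = a + m * b" using m by (cases m) auto
    also have "[a + m * b = a] (mod m)" by (simp add: cong_def)
    finally show ?thesis unfolding N_def by (rule card_box_cong_le[OF R m])
  qed
  have eq: "card (N a) = card (N h)" if "g dvd a" for a
    using le[of a h] le[of h a] that h unfolding g_def by simp
  have empty: "N a = {}" if "\<not> g dvd a" for a
  proof -
    have False if "y \<in> N a" for y
    proof -
      have "m dvd (\<Sum>i\<in>R. w i * y i) + a" using that by (simp add: N_def)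
      then have "g dvd (\<Sum>i\<in>R. w i * y i) + a" using gm dvd_trans by blast
      moreover have "g dvd (\<Sum>i\<in>R. w i * y i)" using gw by (intro dvd_sum) simp
      ultimately show False using \<open>\<not> g dvd a\<close> by (simp add: dvd_add_right_iff)
    qed
    then show ?thesis by blast
  qed
  have "m ^ card R = card (R \<rightarrow>\<^sub>E {..<m})" using R by (simp add: card_funcsetE)
  also have "R \<rightarrow>\<^sub>E {..<m} = (\<Union>a\<in>{..<m}. N a)"
  proof (intro equalityI subsetI)
    fix y assume y: "y \<in> R \<rightarrow>\<^sub>E {..<m}"
    let ?s = "\<Sum>i\<in>R. w i * y i"
    let ?a = "(m - ?s mod m) mod m"
    have "[?s + ?a = ?s mod m + (m - ?s mod m)] (mod m)"
      by (intro cong_add) (simp_all add: cong_def)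
    also have "?s mod m + (m - ?s mod m) = m" using m by (simp add: less_imp_le)
    finally have "m dvd ?s + ?a" by (simp add: cong_dvd_iff)
    moreover have "?a < m" using m by simp
    ultimately show "y \<in> (\<Union>a\<in>{..<m}. N a)" using y unfolding N_def by blast
  qed (auto simp: N_def)
  also have "card (\<Union>a\<in>{..<m}. N a) = (\<Sum>a<m. card (N a))"
  proof (rule card_UN_disjoint)
    have "a = b" if "a < m" "b < m" "y \<in> N a" "y \<in> N b" for a b y
    proof -
      let ?s = "\<Sum>i\<in>R. w i * y i"
      have "[?s + a = ?s + b] (mod m)"
        using that by (auto simp: N_def cong_def)
      then have "[a = b] (mod m)" by (simp only: cong_add_lcancel_nat)
      then show "a = b" using that by (simp add: cong_def)
    qed
    then show "\<forall>i\<in>{..<m}. \<forall>j\<in>{..<m}. i \<noteq> j \<longrightarrow> N i \<inter> N j = {}" by blast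
    show "\<forall>i\<in>{..<m}. finite (N i)" using fin by (simp add: N_def)
  qed simp
  also have "\<dots> = (\<Sum>a\<in>(*) g ` {..<m div g}. card (N h))"
  proof (rule sum.mono_neutral_cong_right)
    have "g > 0" using gm m by (metis dvd_0_left_iff gr0I)
    have md: "m = g * (m div g)" using gm by simp
    show "(*) g ` {..<m div g} \<subseteq> {..<m}"
    proof (intro image_subsetI)
      fix j assume "j \<in> {..<m div g}"
      then have "g * j < g * (m div g)" using \<open>g > 0\<close> by simp
      then show "g * j \<in> {..<m}" using md by simp
    qed
    show "\<forall>i\<in>{..<m} - (*) g ` {..<m div g}. card (N i) = 0"
    proof
      fix i assume i: "i \<in> {..<m} - (*) g ` {..<m div g}"
      have "\<not> g dvd i"
      proof
        assume "g dvd i"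
        then obtain j where j: "i = g * j" by (auto elim: dvdE)
        then have "j < m div g" using i md \<open>g > 0\<close> by (metis DiffE lessThan_iff mult_less_cancel1)
        then show False using i j by blast
      qed
      then show "card (N i) = 0" using empty by simp
    qed
  qed (auto intro: eq)
  also have "\<dots> = (m div g) * card (N h)"
  proof -
    have "g > 0" using gm m by (metis dvd_0_left_iff gr0I)
    then have "card ((*) g ` {..<m div g}) = m div g" by (subst card_image) (auto simp: inj_on_def)
    then show ?thesis by simp
  qed
  finally have "g * m ^ card R = (g * (m div g)) * card (N h)" by simp
  then show ?thesis using gm unfolding g_def N_def by simp
qed

text \<open>
  For every \<open>S\<close>, the greatest common divisor of \<open>k - sum w S\<close> and all weights is that of \<open>k\<close> and all weights,
  since \<open>sum w S\<close> is itself a sum of weights.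
\<close>

proposition box_series_sum:
  assumes R: "finite R" "R \<noteq> {}" and pos: "\<forall>i\<in>R. 0 < w i" and "0 < k"
  defines "H \<equiv> weight_gf R w * Abs_fps (\<lambda>d. box_gf R w (Suc d) $ (k * d))"
  shows "i > sum w R + k \<Longrightarrow> H $ i = 0"
    and "(\<Sum>i\<le>sum w R + k. H $ i) = of_nat (Gcd (insert k (w ` R))) * signed_subset_sum R w k (card R - 1)"
proof -
  let ?g = "Gcd (insert k (w ` R))"
  show "H $ i = 0" if "i > sum w R + k"
    unfolding H_def box_series_nth[of R w k, OF R(1) pos \<open>0 < k\<close>]
    using that R(1) by (intro sum.neutral ballI) (simp add: box_gf_section_eq_0[where k = k])
  have "(\<Sum>i\<le>sum w R + k. H $ i) = (\<Sum>S | S \<subseteq> R \<and> sum w S < k. (-1) ^ card S *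
       (\<Sum>i\<le>sum w R + k. (if sum w S \<le> (k - sum w S) * i then box_gf R w (k - sum w S) $ ((k - sum w S) * i - sum w S) else 0)))"
    unfolding H_def box_series_nth[of R w k, OF R(1) pos \<open>0 < k\<close>] sum_distrib_left by (rule sum.swap)
  also have "\<dots> = (\<Sum>S | S \<subseteq> R \<and> sum w S < k. of_nat ?g * ((-1) ^ card S * of_nat (k - sum w S) ^ (card R - 1)))"
  proof (rule sum.cong[OF refl])
    fix S assume S: "S \<in> {S. S \<subseteq> R \<and> sum w S < k}"
    let ?h = "sum w S" and ?m = "k - sum w S"
    have m: "0 < ?m" and h: "?h < k" using S by auto
    have dvd: "d dvd ?h" if "\<And>i. i \<in> R \<Longrightarrow> d dvd w i" for d using S that by (intro dvd_sum) auto
    have g_dvd: "?g dvd w i" if "i \<in> R" for i using that by (intro Gcd_dvd) simp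
    have G: "Gcd (insert ?m (w ` R)) = ?g"
    proof (rule dvd_antisym)
      let ?G = "Gcd (insert ?m (w ` R))"
      have *: "?G dvd w i" if "i \<in> R" for i using that by (intro Gcd_dvd) simp
      have "?G dvd ?m + ?h" using dvd[of ?G] * by (intro dvd_add) (auto intro: Gcd_dvd)
      then show "?G dvd ?g" using * h by (intro Gcd_greatest) auto
      have *: "?g dvd w i" if "i \<in> R" for i using that by (intro Gcd_dvd) simp
      have "?g dvd k - ?h" using dvd[of ?g] * by (intro dvd_diff_nat) (auto intro: Gcd_dvd)
      then show "?g dvd ?G" using * by (intro Gcd_greatest) auto
    qed
    have "?m * card {y \<in> R \<rightarrow>\<^sub>E {..<?m}. ?m dvd (\<Sum>i\<in>R. w i * y i) + ?h} = ?g * ?m ^ card R"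
      using card_box_cong[OF R(1) m, of w ?h] dvd[OF g_dvd] unfolding G by blast
    moreover have "?m ^ card R = ?m * ?m ^ (card R - 1)"
      using R by (simp add: power_eq_if card_gt_0_iff)
    ultimately have "?m * card {y \<in> R \<rightarrow>\<^sub>E {..<?m}. ?m dvd (\<Sum>i\<in>R. w i * y i) + ?h} = ?m * (?g * ?m ^ (card R - 1))"
      by (simp add: mult.left_commute)
    then have "card {y \<in> R \<rightarrow>\<^sub>E {..<?m}. ?m dvd (\<Sum>i\<in>R. w i * y i) + ?h} = ?g * ?m ^ (card R - 1)"
      using m by simp
    then show "(-1) ^ card S * (\<Sum>i\<le>sum w R + k. (if ?h \<le> ?m * i then box_gf R w ?m $ (?m * i - ?h) else 0)) =
       of_nat ?g * ((-1) ^ card S * of_nat ?m ^ (card R - 1))"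
      unfolding sum_box_gf_section[OF R(1) m h] by simp
  qed
  finally show "(\<Sum>i\<le>sum w R + k. H $ i) = of_nat ?g * signed_subset_sum R w k (card R - 1)"
    by (simp add: signed_subset_sum_def sum_distrib_left)
qed

section \<open>The equivariant \<open>H\<^sup>*\<close>-series at 1\<close>

lemma dilate_lattice_points_iff:
  assumes "0 < d"
  shows "x \<in> dilate_lattice_points k d \<longleftrightarrow>
    (\<forall>i. 0 \<le> vec_nth x i \<and> vec_nth x i \<le> real d \<and> vec_nth x i \<in> \<int>) \<and> (\<Sum>i\<in>UNIV. vec_nth x i) = real (k * d)"
proof -
  have "x \<in> (*\<^sub>R) (real d) ` hypersimplex k \<longleftrightarrow> (1 / real d) *\<^sub>R x \<in> hypersimplex k"
  proof
    assume "x \<in> (*\<^sub>R) (real d) ` hypersimplex k"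
    then show "(1 / real d) *\<^sub>R x \<in> hypersimplex k" using assms by auto
  next
    assume *: "(1 / real d) *\<^sub>R x \<in> hypersimplex k"
    have "x = real d *\<^sub>R ((1 / real d) *\<^sub>R x)" using assms by simp
    then show "x \<in> (*\<^sub>R) (real d) ` hypersimplex k" using * by (rule image_eqI)
  qed
  also have "\<dots> \<longleftrightarrow> (\<forall>i. 0 \<le> vec_nth x i \<and> vec_nth x i \<le> real d) \<and> (\<Sum>i\<in>UNIV. vec_nth x i) = real (k * d)"
    using assms by (simp add: hypersimplex_def sum_divide_distrib[symmetric] field_simps)
  finally show ?thesis unfolding dilate_lattice_points_def by auto
qed

text \<open>
  A fixed point is constant on cycles.  For \<open>d = 0\<close> the right-hand side counts the zero function, which agrees with the
  convention for the constant term of the series.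
\<close>

lemma ehrhart_character_eq_box_gf:
  fixes \<sigma> :: "'n::finite \<Rightarrow> 'n"
  assumes \<sigma>: "\<sigma> permutes UNIV"
  shows "ehrhart_character k d \<sigma> = box_gf (cycles_of \<sigma>) card (Suc d) $ (k * d)"
proof (cases "d = 0")
  case True
  have "{y \<in> cycles_of \<sigma> \<rightarrow>\<^sub>E {..<Suc 0}. (\<Sum>C\<in>cycles_of \<sigma>. card C * y C) = 0} = {\<lambda>C\<in>cycles_of \<sigma>. 0}"
  proof (intro equalityI subsetI)
    fix y assume "y \<in> {y \<in> cycles_of \<sigma> \<rightarrow>\<^sub>E {..<Suc 0}. (\<Sum>C\<in>cycles_of \<sigma>. card C * y C) = 0}"
    then have y: "y \<in> cycles_of \<sigma> \<rightarrow>\<^sub>E {..<Suc 0}" by blast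
    have "y C = 0" if "C \<in> cycles_of \<sigma>" for C using PiE_mem[OF y that] by simp
    then show "y \<in> {\<lambda>C\<in>cycles_of \<sigma>. 0}" using y by (auto intro!: PiE_ext[OF y, of _])
  qed auto
  then show ?thesis using True by (simp add: ehrhart_character_def box_gf_nth)
next
  case False
  let ?R = "cycles_of \<sigma>"
  let ?A = "{y \<in> ?R \<rightarrow>\<^sub>E {..<Suc d}. (\<Sum>C\<in>?R. card C * y C) = k * d}"
  let ?B = "{x \<in> dilate_lattice_points k d. perm_coords \<sigma> x = x}"
  define f :: "('n set \<Rightarrow> nat) \<Rightarrow> real ^ 'n" where "f = (\<lambda>y. vec_lambda (\<lambda>i. real (y (orbit \<sigma> i))))"
  have f_nth: "vec_nth (f y) i = real (y (orbit \<sigma> i))" for y i by (simp add: f_def)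
  have d: "0 < d" using False by simp
  have sum_orbits: "(\<Sum>i\<in>UNIV. real (y (orbit \<sigma> i))) = real (\<Sum>C\<in>?R. card C * y C)" for y
  proof -
    have "(\<Sum>i\<in>UNIV. real (y (orbit \<sigma> i))) = (\<Sum>C\<in>?R. \<Sum>i\<in>C. real (y (orbit \<sigma> i)))"
      using sum_over_cycles[OF \<sigma> order_refl] unfolding Union_cycles_of[OF \<sigma>] .
    also have "\<dots> = (\<Sum>C\<in>?R. \<Sum>i\<in>C. real (y C))"
      using mem_cycles_of_iff[OF \<sigma>] by (intro sum.cong refl) metis
    finally show ?thesis by simp
  qed
  have orbit_inv: "orbit \<sigma> (inv \<sigma> i) = orbit \<sigma> i" for i
    using orbit_apply[OF \<sigma>, of "inv \<sigma> i"] permutes_inverses(1)[OF \<sigma>, of i] by simp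
  have inj: "inj_on f ?A"
  proof (rule inj_onI)
    fix y y' assume y: "y \<in> ?A" "y' \<in> ?A" and eq: "f y = f y'"
    have "y C = y' C" if "C \<in> ?R" for C
    proof -
      obtain i where "C = orbit \<sigma> i" using \<open>C \<in> ?R\<close> by (auto simp: cycles_of_def)
      then show ?thesis using arg_cong[OF eq, of "\<lambda>x. vec_nth x i"] by (simp add: f_nth)
    qed
    then show "y = y'" using y by (intro PiE_ext[of y ?R "\<lambda>_. {..<Suc d}" y']) auto
  qed
  have "f ` ?A = ?B"
  proof (intro equalityI subsetI)
    fix x assume "x \<in> f ` ?A"
    then obtain y where y: "y \<in> ?A" and x: "x = f y" by blast
    have "y (orbit \<sigma> i) \<le> d" for i
    proof -
      have "y \<in> ?R \<rightarrow>\<^sub>E {..<Suc d}" using y by blast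
      then have "y (orbit \<sigma> i) \<in> {..<Suc d}" by (rule PiE_mem) (rule orbit_in_cycles_of)
      then show ?thesis by simp
    qed
    then have "x \<in> dilate_lattice_points k d"
      unfolding dilate_lattice_points_iff[OF d] x f_nth sum_orbits using y by simp
    moreover have "perm_coords \<sigma> x = x"
      unfolding x by (simp add: perm_coords_def vec_eq_iff f_nth orbit_inv)
    ultimately show "x \<in> ?B" by blast
  next
    fix x assume "x \<in> ?B"
    then have x: "x \<in> dilate_lattice_points k d" and fixed: "perm_coords \<sigma> x = x" by blast+
    note xD = x[unfolded dilate_lattice_points_iff[OF d]]
    have "vec_nth x (\<sigma> i) = vec_nth x i" for i
      using arg_cong[OF fixed, of "\<lambda>x. vec_nth x (\<sigma> i)"] permutes_inverses(2)[OF \<sigma>, of i]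
      by (simp add: perm_coords_def)
    then have const: "vec_nth x i = vec_nth x j" if "i \<in> orbit \<sigma> j" for i j
      by (rule invariant_on_orbit[where f = "vec_nth x", OF _ that])
    define y where "y = (\<lambda>C\<in>?R. nat \<lfloor>vec_nth x (SOME i. i \<in> C)\<rfloor>)"
    have y_orbit: "real (y (orbit \<sigma> i)) = vec_nth x i" for i
    proof -
      have "(SOME j. j \<in> orbit \<sigma> i) \<in> orbit \<sigma> i" using self_in_orbit[OF \<sigma>] by (rule someI)
      then have "y (orbit \<sigma> i) = nat \<lfloor>vec_nth x i\<rfloor>" using const by (simp add: y_def orbit_in_cycles_of)
      moreover have "0 \<le> vec_nth x i" "vec_nth x i \<in> \<int>" using xD by blast+
      ultimately show ?thesis by (auto elim!: Ints_cases)
    qed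
    have "y \<in> ?R \<rightarrow>\<^sub>E {..<Suc d}"
    proof (rule PiE_I)
      fix C assume "C \<in> ?R"
      then obtain i where "C = orbit \<sigma> i" by (auto simp: cycles_of_def)
      then have "real (y C) \<le> real d" using y_orbit[of i] xD by simp
      then show "y C \<in> {..<Suc d}" by simp
    qed (simp add: y_def)
    moreover have "real (\<Sum>C\<in>?R. card C * y C) = real (k * d)"
      unfolding sum_orbits[symmetric] y_orbit using xD by blast
    ultimately have "y \<in> ?A" by (simp only: of_nat_eq_iff mem_Collect_eq)
    moreover have "x = f y" by (simp add: vec_eq_iff f_nth y_orbit)
    ultimately show "x \<in> f ` ?A" by blast
  qed
  then have "card ?B = card ?A" using card_image[OF inj] by simp
  then show ?thesis using False by (simp add: ehrhart_character_def perm_character_def box_gf_nth)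
qed

proposition Hstar_at_1_eq:
  fixes \<sigma> :: "'n::finite \<Rightarrow> 'n"
  assumes \<sigma>: "\<sigma> permutes UNIV" and k: "0 < k"
  shows "Hstar_at_1 k \<sigma> =
    of_nat (Gcd (insert k (card ` cycles_of \<sigma>))) * signed_subset_sum (cycles_of \<sigma>) card k (card (cycles_of \<sigma>) - 1)"
proof -
  have series: "Hstar_series k \<tau> = weight_gf (cycles_of \<tau>) card * Abs_fps (\<lambda>d. box_gf (cycles_of \<tau>) card (Suc d) $ (k * d))"
    if "\<tau> permutes UNIV" for \<tau> :: "'n \<Rightarrow> 'n"
    unfolding Hstar_series_def det_I_minus_t_eq[OF that] ehrhart_character_eq_box_gf[OF that] weight_gf_def
    by (rule mult.commute)
  have n: "sum card (cycles_of \<tau>) = CARD('n)" if "\<tau> permutes UNIV" for \<tau> :: "'n \<Rightarrow> 'n"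
    using card_Union_cycles[OF that order_refl] Union_cycles_of[OF that] by simp
  have pos: "\<forall>C\<in>cycles_of \<tau>. 0 < card C" and ne: "cycles_of \<tau> \<noteq> {}" for \<tau> :: "'n \<Rightarrow> 'n"
    using card_cycle_pos by (blast, simp add: cycles_of_def)
  have vanish: "Hstar k m \<tau> = 0" if "\<tau> permutes UNIV" "m > CARD('n) + k" for m and \<tau> :: "'n \<Rightarrow> 'n"
    unfolding Hstar_def series[OF that(1)]
    using box_series_sum(1)[of "cycles_of \<tau>" card k m, OF finite ne pos k] that n[OF that(1)] by simp
  have "Hstar_at_1 k \<sigma> = (\<Sum>m\<le>CARD('n) + k. Hstar k m \<sigma>)"
    unfolding Hstar_at_1_def
  proof (rule sum.mono_neutral_left)
    show "{m. \<exists>\<tau> :: 'n \<Rightarrow> 'n. \<tau> permutes UNIV \<and> Hstar k m \<tau> \<noteq> 0} \<subseteq> {..CARD('n) + k}"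
      using vanish by (force simp: not_le[symmetric])
    show "\<forall>m\<in>{..CARD('n) + k} - {m. \<exists>\<tau> :: 'n \<Rightarrow> 'n. \<tau> permutes UNIV \<and> Hstar k m \<tau> \<noteq> 0}. Hstar k m \<sigma> = 0"
      using \<sigma> by blast
  qed simp
  also have "\<dots> = of_nat (Gcd (insert k (card ` cycles_of \<sigma>))) * signed_subset_sum (cycles_of \<sigma>) card k (card (cycles_of \<sigma>) - 1)"
    unfolding Hstar_def series[OF \<sigma>]
    using box_series_sum(2)[of "cycles_of \<sigma>" card k, OF finite ne pos k] n[OF \<sigma>] by simp
  finally show ?thesis .
qed

section \<open>Grouping sets of cycles by cycle lengths\<close>

text \<open>
  Both sides are the coefficient of \<open>X^h\<close> in the product of \<open>1 - X^(w x)\<close> over the elements of weight less than \<open>k\<close>.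
  On the right the factors with equal weights are collected and expanded by the binomial theorem.
\<close>

lemma sum_signs_eq_weighted_tuples:
  fixes w :: "'a \<Rightarrow> nat"
  assumes "finite R" and pos: "\<forall>i\<in>R. 0 < w i" and "h < k"
  shows "(\<Sum>S | S \<subseteq> R \<and> sum w S = h. (-1) ^ card S) =
    (\<Sum>I\<in>weighted_tuples k h. (-1) ^ (\<Sum>i = 1..k - 1. I i) * (\<Prod>i = 1..k - 1. of_nat (card {x \<in> R. w x = i} choose I i)) :: complex)"
proof -
  define R' where "R' = {x \<in> R. w x < k}"
  define lam where "lam = (\<lambda>j. card {x \<in> R. w x = j})"
  \<comment> \<open>A common bound for all entries that contribute: binomial coefficients vanish beyond \<open>card R\<close>, and the
    entries of a tuple of weight \<open>h\<close> are at most \<open>h\<close>.\<close>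
  define N where "N = card R + h"
  let ?J = "{1..k - 1}"
  let ?c = "\<lambda>I. (-1) ^ sum I ?J * (\<Prod>i\<in>?J. of_nat (lam i choose I i)) :: complex"
  have finR': "finite R'" using assms(1) by (simp add: R'_def)
  have lam_le: "lam j \<le> card R" for j unfolding lam_def using assms(1) by (intro card_mono) auto
  have "S \<subseteq> R \<and> sum w S = h \<longleftrightarrow> S \<subseteq> R' \<and> sum w S = h" for S
  proof -
    have "w x < k" if "S \<subseteq> R" "sum w S = h" "x \<in> S" for x
      using member_le_sum[of x S w] that assms(1,3) finite_subset[OF that(1)] by simp
    then show ?thesis unfolding R'_def by blast
  qed
  then have "(\<Sum>S | S \<subseteq> R \<and> sum w S = h. (-1) ^ card S :: complex) = (\<Sum>S | S \<subseteq> R' \<and> sum w S = h. (-1) ^ card S)"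
    by simp
  also have "\<dots> = (\<Sum>S | S \<subseteq> R' \<and> sum w S \<le> h. (-1) ^ card S * (1::complex fps) $ (h - sum w S))"
    using finR' by (intro sum.mono_neutral_cong_left) auto
  also have "\<dots> = (\<Prod>i\<in>R'. 1 - fps_X ^ w i) $ h"
    using fps_nth_prod_one_minus[OF finR', of w "1::complex fps" h] by simp
  also have "(\<Prod>i\<in>R'. 1 - fps_X ^ w i) = (\<Prod>j\<in>?J. \<Prod>i\<in>{x \<in> R'. w x = j}. 1 - fps_X ^ w i :: complex fps)"
    using finR' pos by (intro prod.group[symmetric]) (auto simp: R'_def)
  also have "\<dots> = (\<Prod>j\<in>?J. \<Sum>a\<le>N. fps_const (of_nat (lam j choose a) * (-1) ^ a) * fps_X ^ (j * a))"
  proof (rule prod.cong[OF refl])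
    fix j assume j: "j \<in> ?J"
    have "{x \<in> R'. w x = j} = {x \<in> R. w x = j}" using j by (auto simp: R'_def)
    then have "(\<Prod>i\<in>{x \<in> R'. w x = j}. 1 - fps_X ^ w i :: complex fps) = (- (fps_X ^ j) + 1) ^ lam j"
      by (simp add: lam_def)
    also have "\<dots> = (\<Sum>a\<le>lam j. of_nat (lam j choose a) * (- (fps_X ^ j)) ^ a)"
      unfolding binomial_ring by (simp only: power_one mult_1_right)
    also have "\<dots> = (\<Sum>a\<le>N. of_nat (lam j choose a) * (- (fps_X ^ j)) ^ a)"
      using lam_le[of j] by (intro sum.mono_neutral_left) (auto simp: N_def)
    also have "\<dots> = (\<Sum>a\<le>N. fps_const (of_nat (lam j choose a) * (-1) ^ a) * fps_X ^ (j * a))"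
    proof (rule sum.cong[OF refl])
      fix a
      have "(- (fps_X ^ j)) ^ a = ((-1) ^ a * fps_X ^ (j * a) :: complex fps)"
        unfolding power_mult by (rule power_minus)
      moreover have "((-1) ^ a :: complex fps) = fps_const ((-1) ^ a)"
        by (metis fps_const_1_eq_1 fps_const_neg fps_const_power)
      ultimately show "of_nat (lam j choose a) * (- (fps_X ^ j)) ^ a =
          fps_const (of_nat (lam j choose a) * (-1) ^ a) * (fps_X ^ (j * a) :: complex fps)"
        by (simp only: fps_of_nat[symmetric] fps_const_mult[symmetric] mult.assoc)
    qed
    finally show "(\<Prod>i\<in>{x \<in> R'. w x = j}. 1 - fps_X ^ w i :: complex fps) =
      (\<Sum>a\<le>N. fps_const (of_nat (lam j choose a) * (-1) ^ a) * fps_X ^ (j * a))" .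
  qed
  also have "\<dots> = (\<Sum>I\<in>?J \<rightarrow>\<^sub>E {..N}. \<Prod>j\<in>?J. fps_const (of_nat (lam j choose I j) * (-1) ^ I j) * fps_X ^ (j * I j))"
    by (rule prod_sum_PiE) auto
  also have "\<dots> = (\<Sum>I\<in>?J \<rightarrow>\<^sub>E {..N}. fps_const (?c I) * fps_X ^ (\<Sum>j\<in>?J. j * I j))"
  proof (rule sum.cong[OF refl])
    fix I
    have const: "(\<Prod>j\<in>A. fps_const (c j)) = fps_const (\<Prod>j\<in>A. c j)" for A and c :: "nat \<Rightarrow> complex"
      by (induction A rule: infinite_finite_induct) auto
    show "(\<Prod>j\<in>?J. fps_const (of_nat (lam j choose I j) * (-1) ^ I j) * fps_X ^ (j * I j)) =
      fps_const (?c I) * (fps_X ^ (\<Sum>j\<in>?J. j * I j) :: complex fps)"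
      unfolding prod.distrib const power_sum by (simp only: mult.commute)
  qed
  also have "\<dots> $ h = (\<Sum>I\<in>?J \<rightarrow>\<^sub>E {..N}. if (\<Sum>j\<in>?J. j * I j) = h then ?c I else 0)"
    unfolding fps_sum_nth fps_mult_left_const_nth fps_X_power_nth by (intro sum.cong) auto
  also have "\<dots> = (\<Sum>I\<in>weighted_tuples k h. ?c I)"
  proof (rule sum.mono_neutral_cong_right)
    show "finite (?J \<rightarrow>\<^sub>E {..N})" by (intro finite_PiE) auto
    show "weighted_tuples k h \<subseteq> ?J \<rightarrow>\<^sub>E {..N}"
    proof
      fix I assume I: "I \<in> weighted_tuples k h"
      have "I j \<le> N" if "j \<in> ?J" for j
      proof -
        have "I j \<le> j * I j" using that by simp
        also have "\<dots> \<le> (\<Sum>j\<in>?J. j * I j)" using that by (intro member_le_sum) auto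
        also have "\<dots> = h" using I by (simp add: weighted_tuples_def)
        finally show ?thesis by (simp add: N_def)
      qed
      then show "I \<in> ?J \<rightarrow>\<^sub>E {..N}" using I by (auto simp: weighted_tuples_def PiE_iff)
    qed
    show "\<forall>I\<in>(?J \<rightarrow>\<^sub>E {..N}) - weighted_tuples k h. (if (\<Sum>j\<in>?J. j * I j) = h then ?c I else 0) = 0"
      by (auto simp: weighted_tuples_def PiE_iff)
    show "(if (\<Sum>j\<in>?J. j * I j) = h then ?c I else 0) = ?c I" if "I \<in> weighted_tuples k h" for I
      using that by (simp add: weighted_tuples_def)
  qed
  finally show ?thesis by (simp only: lam_def)
qed

lemma signed_subset_sum_eq_weighted_tuples:
  fixes w :: "'a \<Rightarrow> nat"
  assumes "finite R" and pos: "\<forall>i\<in>R. 0 < w i" and "0 < k"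
  shows "signed_subset_sum R w k p = (\<Sum>h = 0..k - 1.
     (\<Sum>I\<in>weighted_tuples k h. (-1) ^ (\<Sum>i = 1..k - 1. I i) * (\<Prod>i = 1..k - 1. of_nat (card {x \<in> R. w x = i} choose I i)))
     * of_nat (k - h) ^ p)"
proof -
  let ?A = "{S. S \<subseteq> R \<and> sum w S < k}"
  have "signed_subset_sum R w k p =
     (\<Sum>h = 0..k - 1. \<Sum>S\<in>{S \<in> ?A. sum w S = h}. (-1) ^ card S * of_nat (k - sum w S) ^ p)"
    unfolding signed_subset_sum_def using assms by (intro sum.group[symmetric]) auto
  also have "\<dots> = (\<Sum>h = 0..k - 1. (\<Sum>S | S \<subseteq> R \<and> sum w S = h. (-1) ^ card S) * of_nat (k - h) ^ p)"
  proof (rule sum.cong[OF refl])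
    fix h assume "h \<in> {0..k - 1}"
    then have "{S \<in> ?A. sum w S = h} = {S. S \<subseteq> R \<and> sum w S = h}" using \<open>0 < k\<close> by auto
    then show "(\<Sum>S\<in>{S \<in> ?A. sum w S = h}. (-1) ^ card S * of_nat (k - sum w S) ^ p) =
       (\<Sum>S | S \<subseteq> R \<and> sum w S = h. (-1) ^ card S) * (of_nat (k - h) ^ p :: complex)"
      unfolding sum_distrib_right by (intro sum.cong) auto
  qed
  also have "\<dots> = (\<Sum>h = 0..k - 1.
     (\<Sum>I\<in>weighted_tuples k h. (-1) ^ (\<Sum>i = 1..k - 1. I i) * (\<Prod>i = 1..k - 1. of_nat (card {x \<in> R. w x = i} choose I i)))
     * of_nat (k - h) ^ p)"
    using \<open>0 < k\<close> by (intro sum.cong refl arg_cong2[of _ _ _ _ "(*)"] sum_signs_eq_weighted_tuples[OF assms(1) pos]) auto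
  finally show ?thesis .
qed

lemma Gcd_cycle_counts:
  fixes \<sigma> :: "'n::finite \<Rightarrow> 'n"
  shows "Gcd ({k} \<union> {i \<in> {1..CARD('n)}. cycle_count \<sigma> i \<ge> 1}) = Gcd (insert k (card ` cycles_of \<sigma>))"
proof -
  have iff: "cycle_count \<sigma> i \<ge> 1 \<longleftrightarrow> i \<in> card ` cycles_of \<sigma>" for i
  proof -
    have "cycle_count \<sigma> i \<ge> 1 \<longleftrightarrow> {C \<in> cycles_of \<sigma>. card C = i} \<noteq> {}"
      unfolding cycle_count_def by (simp add: card_gt_0_iff Suc_le_eq)
    then show ?thesis by auto
  qed
  have "card C \<in> {1..CARD('n)}" if "C \<in> cycles_of \<sigma>" for C
    using card_cycle_pos[OF that] card_mono[of UNIV C] by simp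
  then have "{i \<in> {1..CARD('n)}. cycle_count \<sigma> i \<ge> 1} = card ` cycles_of \<sigma>"
    unfolding iff by blast
  then show ?thesis by simp
qed

unbundle no fps_syntax
unbundle vec_syntax

section \<open>The two characters agree\<close>

theorem theorem4p1:
  fixes k :: nat
  assumes "2 \<le> k" and "k < CARD('n :: finite)"
  shows "(\<forall>\<sigma> :: 'n \<Rightarrow> 'n. \<sigma> permutes UNIV \<longrightarrow>
           Hstar_at_1 k \<sigma> = perm_character act_DOSP (hypersimplicial_DOSPs k) \<sigma>) \<and>
         (\<forall>\<sigma> :: 'n \<Rightarrow> 'n. \<sigma> permutes UNIV \<longrightarrow>
           (let r = card (cycles_of \<sigma>);
                lam = cycle_count \<sigma>;
                g = Gcd ({k} \<union> {i \<in> {1..CARD('n)}. lam i \<ge> 1})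
            in of_nat (card {D \<in> hypersimplicial_DOSPs k. act_DOSP \<sigma> D = D}) = Hstar_at_1 k \<sigma> \<and>
               Hstar_at_1 k \<sigma> =
                 of_nat g * (\<Sum>h = 0..k - 1.
                   (\<Sum>I\<in>weighted_tuples k h.
                      (-1) ^ (\<Sum>i = 1..k - 1. I i) * (\<Prod>i = 1..k - 1. of_nat (lam i choose I i)))
                   * of_nat (k - h) ^ (r - 1))))"
proof -
  have k: "0 < k" using assms(1) by simp
  have count: "of_nat (card {D \<in> hypersimplicial_DOSPs k. act_DOSP \<sigma> D = D}) = Hstar_at_1 k \<sigma>"
    if "\<sigma> permutes UNIV" for \<sigma> :: "'n \<Rightarrow> 'n"
    unfolding card_fixed_DOSPs[OF that k assms(2)] Hstar_at_1_eq[OF that k] ..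
  have "Hstar_at_1 k \<sigma> =
      of_nat (Gcd ({k} \<union> {i \<in> {1..CARD('n)}. cycle_count \<sigma> i \<ge> 1})) * (\<Sum>h = 0..k - 1.
        (\<Sum>I\<in>weighted_tuples k h.
          (-1) ^ (\<Sum>i = 1..k - 1. I i) * (\<Prod>i = 1..k - 1. of_nat (cycle_count \<sigma> i choose I i)))
        * of_nat (k - h) ^ (card (cycles_of \<sigma>) - 1))"
    if "\<sigma> permutes UNIV" for \<sigma> :: "'n \<Rightarrow> 'n"
  proof -
    have "\<forall>C\<in>cycles_of \<sigma>. 0 < card C" using card_cycle_pos by blast
    from signed_subset_sum_eq_weighted_tuples[OF finite this k, of "card (cycles_of \<sigma>) - 1"]
    show ?thesis
      unfolding Hstar_at_1_eq[OF that k] Gcd_cycle_counts by (simp only: cycle_count_def)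
  qed
  then show ?thesis using count unfolding Let_def perm_character_def
    by (intro conjI allI impI) (simp_all only:)
qed

end
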